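(* Let $a^2>0$, $b^2>0$, $c^2>0$ with $b^4\le 3a^2c^2$, let $R\in(0,\infty]$ and $k\in\mathbb Z\setminus\{0\}$. Then there exists a unique solution $(u,v)$ on $(0,R)$ of $$u''+\frac{u'}{r}-\frac{k^2u}{r^2}=h(u,v),\qquad v''+\frac{v'}{r}=g(u,v),$$ with $u(0)=0$, $v'(0)=0$, $u(R)=\frac{s_+}{\sqrt2}$, $v(R)=-\frac{s_+}{\sqrt6}$ (limits as $r\to\infty$ if $R=\infty$), satisfying $u>0$ and $v<0$ on $(0,R)$. Moreover this solution is strictly stable: $B(\xi,\eta)>0$ for all $(\xi,\eta)\in\hat X_R$ with $(\xi,\eta)\not\equiv0$. In particular, $(u,v)$ is a local minimizer of $\mathcal E_R$.
   Context: $s_+=\frac{b^2+\sqrt{b^4+24a^2c^2}}{4c^2}$, $h(u,v)=u\big[-a^2+\sqrt{\tfrac23}b^2v+c^2(u^2+v^2)\big]$, $g(u,v)=v\big[-a^2-\tfrac1{\sqrt6}b^2v+c^2(u^2+v^2)\big]+\tfrac1{\sqrt6}b^2u^2$. The space $\hat X_R$: for $R<\infty$, pairs $(\xi,\eta):[0,R]\to\mathbb R^2$ with $\sqrt r\xi',\sqrt r\eta',\xi/\sqrt r,\sqrt r\eta\in L^2(0,R)$ and $\xi(R)=\eta(R)=0$; for $R=\infty$, pairs with $\sqrt r\xi',\sqrt r\eta',(\frac1{\sqrt r}+\sqrt r)\xi,\sqrt r\eta\in L^2(0,\infty)$. The form $B$ is $$B(\xi,\eta)=\int_0^R\Big\{|\xi'|^2+\tfrac{k^2}{r^2}\xi^2+|\eta'|^2+\big(-a^2+\tfrac{2b^2}{\sqrt6}v+c^2(3u^2+v^2)\big)\xi^2+\big(-a^2-\tfrac{2b^2}{\sqrt6}v+c^2(u^2+3v^2)\big)\eta^2+4u\xi\eta\big(\tfrac{b^2}{\sqrt6}+c^2v\big)\Big\}r\,dr.$$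 The energy is $\mathcal E_{R'}(u,v)=\int_0^{R'}\big[\tfrac12\big((u')^2+(v')^2+\tfrac{k^2}{r^2}u^2\big)+f(u,v)\big]r\,dr$ with $f(u,v)=-\tfrac{a^2}{2}(u^2+v^2)+\tfrac{c^2}{4}(u^2+v^2)^2-\tfrac{b^2}{3\sqrt6}v(v^2-3u^2)$. "Local minimizer" means: for every $R'<R$ (or $R'=R$ when $R<\infty$) there is $\delta>0$ such that $\mathcal E_{R'}(u,v)\le\mathcal E_{R'}(u+\xi,v+\eta)$ for all $\xi,\eta\in C_c^\infty(0,R')$ with $\sup|\xi|+\sup|\eta|$ small (as in the paper, perturbations compactly supported in $(0,R')$ and sufficiently small). *)

theory Defs
  imports "HOL-Analysis.Analysis"
begin

text \<open>Parameters: real numbers a, b, c; the paper's constants are a^2, b^2, c^2.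
  The radius R is an extended real (R = \<infinity> allowed). The open interval (0,R):\<close>

definition dom0 :: "ereal \<Rightarrow> real set" where
  "dom0 R = {r. 0 < r \<and> ereal r < R}"

definition s_plus :: "real \<Rightarrow> real \<Rightarrow> real \<Rightarrow> real" where
  "s_plus a b c = (b^2 + sqrt (b^4 + 24 * a^2 * c^2)) / (4 * c^2)"

definition hfun :: "real \<Rightarrow> real \<Rightarrow> real \<Rightarrow> real \<Rightarrow> real \<Rightarrow> real" where
  "hfun a b c u v = u * (- (a^2) + sqrt (2/3) * b^2 * v + c^2 * (u^2 + v^2))"

definition gfun :: "real \<Rightarrow> real \<Rightarrow> real \<Rightarrow> real \<Rightarrow> real \<Rightarrow> real" where
  "gfun a b c u v = v * (- (a^2) - (1 / sqrt 6) * b^2 * v + c^2 * (u^2 + v^2))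
                    + (1 / sqrt 6) * b^2 * u^2"

definition ffun :: "real \<Rightarrow> real \<Rightarrow> real \<Rightarrow> real \<Rightarrow> real \<Rightarrow> real" where
  "ffun a b c u v = - (a^2 / 2) * (u^2 + v^2) + (c^2 / 4) * (u^2 + v^2)^2
                    - (b^2 / (3 * sqrt 6)) * v * (v^2 - 3 * u^2)"

definition at_end :: "ereal \<Rightarrow> real filter" where
  "at_end R = (if R = \<infinity> then at_top else at_left (real_of_ereal R))"

definition is_solution ::
  "real \<Rightarrow> real \<Rightarrow> real \<Rightarrow> ereal \<Rightarrow> int \<Rightarrow> (real \<Rightarrow> real) \<Rightarrow> (real \<Rightarrow> real) \<Rightarrow> bool" where
  "is_solution a b c R k u v \<longleftrightarrow>
     (\<forall>r \<in> dom0 R.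
        u differentiable (at r) \<and> deriv u differentiable (at r) \<and>
        v differentiable (at r) \<and> deriv v differentiable (at r) \<and>
        deriv (deriv u) r + deriv u r / r - (of_int k)^2 * u r / r^2 = hfun a b c (u r) (v r) \<and>
        deriv (deriv v) r + deriv v r / r = gfun a b c (u r) (v r) \<and>
        u r > 0 \<and> v r < 0) \<and>
     (u \<longlongrightarrow> 0) (at_right 0) \<and>
     (deriv v \<longlongrightarrow> 0) (at_right 0) \<and>
     (u \<longlongrightarrow> s_plus a b c / sqrt 2) (at_end R) \<and>
     (v \<longlongrightarrow> - s_plus a b c / sqrt 6) (at_end R)"

definition sq_int :: "ereal \<Rightarrow> (real \<Rightarrow> real) \<Rightarrow> bool" where
  "sq_int R f \<longleftrightarrow> f \<in> borel_measurable lborel \<and> set_integrable lborel (dom0 R) (\<lambda>r. (f r)^2)"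

text \<open>Weak derivative in one variable: f is locally absolutely continuous on (0,R) with
  derivative f' (locally integrable), i.e. f y - f x = \<integral>_x^y f'.\<close>

definition weak_deriv_on :: "ereal \<Rightarrow> (real \<Rightarrow> real) \<Rightarrow> (real \<Rightarrow> real) \<Rightarrow> bool" where
  "weak_deriv_on R f f' \<longleftrightarrow>
     (\<forall>x \<in> dom0 R. \<forall>y \<in> dom0 R. x \<le> y \<longrightarrow> (f' has_integral (f y - f x)) {x..y})"

definition hatX ::
  "ereal \<Rightarrow> (real \<Rightarrow> real) \<Rightarrow> (real \<Rightarrow> real) \<Rightarrow> (real \<Rightarrow> real) \<Rightarrow> (real \<Rightarrow> real) \<Rightarrow> bool" where
  "hatX R \<xi> \<xi>' \<eta> \<eta>' \<longleftrightarrow>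
     weak_deriv_on R \<xi> \<xi>' \<and> weak_deriv_on R \<eta> \<eta>' \<and>
     sq_int R (\<lambda>r. sqrt r * \<xi>' r) \<and> sq_int R (\<lambda>r. sqrt r * \<eta>' r) \<and>
     sq_int R (\<lambda>r. sqrt r * \<eta> r) \<and>
     (if R = \<infinity> then sq_int R (\<lambda>r. (1 / sqrt r + sqrt r) * \<xi> r)
      else sq_int R (\<lambda>r. \<xi> r / sqrt r) \<and>
           (\<xi> \<longlongrightarrow> 0) (at_left (real_of_ereal R)) \<and>
           (\<eta> \<longlongrightarrow> 0) (at_left (real_of_ereal R)))"

text \<open>The second variation form B (depending on the solution (u,v)).\<close>

definition Bform ::
  "real \<Rightarrow> real \<Rightarrow> real \<Rightarrow> ereal \<Rightarrow> int \<Rightarrow> (real \<Rightarrow> real) \<Rightarrow> (real \<Rightarrow> real) \<Rightarrow>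
   (real \<Rightarrow> real) \<Rightarrow> (real \<Rightarrow> real) \<Rightarrow> (real \<Rightarrow> real) \<Rightarrow> (real \<Rightarrow> real) \<Rightarrow> real" where
  "Bform a b c R k u v \<xi> \<xi>' \<eta> \<eta>' =
     (LINT r:dom0 R|lborel.
        ((\<xi>' r)^2 + (of_int k)^2 / r^2 * (\<xi> r)^2 + (\<eta>' r)^2
         + (- (a^2) + 2 * b^2 / sqrt 6 * v r + c^2 * (3 * (u r)^2 + (v r)^2)) * (\<xi> r)^2
         + (- (a^2) - 2 * b^2 / sqrt 6 * v r + c^2 * ((u r)^2 + 3 * (v r)^2)) * (\<eta> r)^2
         + 4 * u r * \<xi> r * \<eta> r * (b^2 / sqrt 6 + c^2 * v r)) * r)"

definition energy_density ::
  "real \<Rightarrow> real \<Rightarrow> real \<Rightarrow> int \<Rightarrow> (real \<Rightarrow> real) \<Rightarrow> (real \<Rightarrow> real) \<Rightarrow> real \<Rightarrow> real" where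
  "energy_density a b c k u v r =
     (1/2 * ((deriv u r)^2 + (deriv v r)^2 + (of_int k)^2 / r^2 * (u r)^2)
      + ffun a b c (u r) (v r)) * r"

definition energy ::
  "real \<Rightarrow> real \<Rightarrow> real \<Rightarrow> int \<Rightarrow> real \<Rightarrow> (real \<Rightarrow> real) \<Rightarrow> (real \<Rightarrow> real) \<Rightarrow> real" where
  "energy a b c k R' u v = (LINT r:{0<..<R'}|lborel. energy_density a b c k u v r)"

definition test_fun :: "real \<Rightarrow> (real \<Rightarrow> real) \<Rightarrow> bool" where
  "test_fun R' \<phi> \<longleftrightarrow>
     (\<forall>n x. ((deriv ^^ n) \<phi>) differentiable (at x)) \<and>
     (\<exists>K. compact K \<and> K \<subseteq> {0<..<R'} \<and> (\<forall>x. x \<notin> K \<longrightarrow> \<phi> x = 0))"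

definition local_minimizer ::
  "real \<Rightarrow> real \<Rightarrow> real \<Rightarrow> ereal \<Rightarrow> int \<Rightarrow> (real \<Rightarrow> real) \<Rightarrow> (real \<Rightarrow> real) \<Rightarrow> bool" where
  "local_minimizer a b c R k u v \<longleftrightarrow>
     (\<forall>R'::real. 0 < R' \<and> ereal R' \<le> R \<longrightarrow>
        set_integrable lborel {0<..<R'} (energy_density a b c k u v) \<and>
        (\<exists>\<delta>>0. \<forall>\<xi> \<eta>. test_fun R' \<xi> \<and> test_fun R' \<eta> \<and>
              (SUP x. \<bar>\<xi> x\<bar>) + (SUP x. \<bar>\<eta> x\<bar>) < \<delta> \<longrightarrow>
              energy a b c k R' u v \<le> energy a b c k R' (\<lambda>r. u r + \<xi> r) (\<lambda>r. v r + \<eta> r)))"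

end

(*
Write A = a^2, B = b^2/sqrt 6, C = c^2, q = s_+/sqrt 6, so that A = 4 C q^2 - 2 B q, the boundary values are
(sqrt 3 q, -q), and the hypothesis b^4 <= 3 a^2 c^2 says B <= C q.

The maximum principle gives u^2 + v^2 <= 4 q^2 and v <= -q for every solution. In that region B + C v <= 0,
so the system is cooperative, and the potential is uniformly convex as a function of (u^2, v^2). Since the
Dirichlet energy is convex in (u^2, v^2) too, Picone's identity yields uniqueness (Brezis-Oswald), and the
substitution xi = u phi, eta = v psi turns the second variation into a pointwise positive form.

Existence: monotone iteration for the cooperative system, starting from the constant supersolution
(sqrt 3 q, -q), uniformly in R. For R = infinity the limit at infinity is identified by a subsolution moving
on the circle u^2 + v^2 = 4 q^2 from (0, -2 q) to (sqrt 3 q, -q).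
*)

theory Submission
  imports Defs
begin

section \<open>Radial maximum principle\<close>

text \<open>The obstacles lie at the two ends of the interval. For R = \<infinity> no decay rate is
  available; since 1 / r is integrable neither at 0 nor at infinity, logarithmic divergence takes
  the place of decay: it supplies cut-off radii with small boundary terms and forces the uniqueness
  flux to vanish. The number 2 q is the radius beyond which the radial force is positive in every
  direction: A = 4 C q^2 - 2 B q makes s - 2 q a factor of C s^2 - B s - A. The iteration runs
  directly on (0,R), also for R = \<infinity>, without exhausting domains. Minimality among
  perturbations that are small only in the supremum norm needs a weighted L^2 lower bound for the
  second variation, because the cubic error is at most the supremum norm times the squared L^2 norm;
  the Hardy bound degenerates where u tends to 0 and is therefore mixed with a share of n^2 /
  r^2.\<close>

lemma dom0_iff: "r \<in> dom0 R \<longleftrightarrow> 0 < r \<and> ereal r < R"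
  by (simp add: dom0_def)

lemma dom0_einterval: "dom0 R = einterval 0 R"
  by (auto simp: dom0_def einterval_def zero_ereal_def)

lemma open_dom0: "open (dom0 R)"
  by (simp add: dom0_einterval)

lemma dom0_downward: "r \<in> dom0 R \<Longrightarrow> 0 < s \<Longrightarrow> s \<le> r \<Longrightarrow> s \<in> dom0 R"
  by (auto simp: dom0_def intro: le_less_trans[of "ereal s" "ereal r"])

lemma eventually_dom0_right_0:
  assumes "x \<in> dom0 R"
  shows "eventually (\<lambda>r. r \<in> dom0 R \<and> 0 < r \<and> r < x) (at_right 0)"
proof -
  have "0 < x" using assms by (simp add: dom0_def)
  then have "eventually (\<lambda>r. 0 < r \<and> r < x) (at_right (0::real))"
    by (auto simp: eventually_at_right[of 0 "x"])
  then show ?thesis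
    by eventually_elim (use assms dom0_downward in auto)
qed

lemma dom0_nonempty: "0 < R \<Longrightarrow> \<exists>x. x \<in> dom0 R"
  by (metis dom0_iff ereal_dense2 ereal_less(2))

lemma eventually_at_rightD:
  assumes "eventually P (at_right (0::real))" "0 < R"
  shows "\<exists>d\<in>dom0 R. \<forall>r. 0 < r \<longrightarrow> r \<le> d \<longrightarrow> P r"
proof -
  obtain b where b: "b > 0" "\<And>y. 0 < y \<Longrightarrow> y < b \<Longrightarrow> P y"
    using assms(1) by (auto simp: eventually_at_right_field)
  obtain x where x: "x \<in> dom0 R" using dom0_nonempty assms(2) by blast
  then have x0: "0 < x" by (simp add: dom0_def)
  have "min x (b/2) \<in> dom0 R" using x x0 b by (auto intro: dom0_downward)
  moreover have "P r" if "0 < r" "r \<le> min x (b/2)" for r using that b by auto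
  ultimately show ?thesis by blast
qed

lemma at_end_cases:
  assumes "0 < R"
  obtains "R = \<infinity>" "at_end R = at_top" | r where "R = ereal r" "0 < r" "at_end R = at_left r"
  using assms by (cases R) (auto simp: at_end_def)

lemma at_end_neq_bot: "0 < R \<Longrightarrow> at_end R \<noteq> bot"
  by (erule at_end_cases) (auto simp: trivial_limit_at_left_real)

lemma eventually_at_end:
  assumes "x \<in> dom0 R"
  shows "eventually (\<lambda>r. r \<in> dom0 R \<and> x < r) (at_end R)"
proof -
  have x0: "0 < x" and R: "ereal x < R" using assms by (auto simp: dom0_def)
  have "0 < R" using x0 R by (metis ereal_less(2) less_trans)
  then show ?thesis
  proof (cases rule: at_end_cases)
    case 1
    then show ?thesis using x0 by (auto simp: dom0_def intro: eventually_mono[OF eventually_gt_at_top[of x]])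
  next
    case (2 y)
    then have "eventually (\<lambda>r. r \<in> {x<..<y}) (at_left y)"
      using R by (intro eventually_at_left_real) auto
    then show ?thesis using x0 2 by (auto simp: dom0_def elim!: eventually_mono)
  qed
qed

lemma eventually_at_endD:
  assumes "eventually P (at_end R)" "0 < R"
  shows "\<exists>x\<in>dom0 R. \<forall>r\<in>dom0 R. x \<le> r \<longrightarrow> P r"
proof (cases rule: at_end_cases[OF assms(2)])
  case 1
  then obtain N where "\<And>r. r \<ge> N \<Longrightarrow> P r" using assms(1) by (auto simp: eventually_at_top_linorder)
  then show ?thesis using 1 by (intro bexI[of _ "max N 1"]) (auto simp: dom0_def)
next
  case (2 y)
  then obtain b where "b < y" "\<And>r. b < r \<Longrightarrow> r < y \<Longrightarrow> P r"
    using assms(1) by (auto simp: eventually_at_left_field)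
  then show ?thesis using 2 by (intro bexI[of _ "(max b 0 + y)/2"]) (auto simp: dom0_def)
qed

text \<open>The function \<open>f - e * ln\<close> is nondecreasing, so \<open>f\<close> descends at
  least as fast as \<open>e * ln\<close> towards the origin. Any lower bound for \<open>f\<close>
  thus excludes a flux \<open>r * f'\<close> that stays above a positive constant.\<close>

lemma logarithmic_blow_down:
  fixes f f' :: "real \<Rightarrow> real"
  assumes x: "0 < x" and e: "0 < e"
    and df: "\<And>r. 0 < r \<Longrightarrow> r \<le> x \<Longrightarrow> (f has_real_derivative f' r) (at r)"
    and ge: "\<And>r. 0 < r \<Longrightarrow> r \<le> x \<Longrightarrow> e \<le> r * f' r"
  shows "\<exists>t. 0 < t \<and> t \<le> x \<and> f t < M"
proof -
  have mono: "f t - e * ln t \<le> f x - e * ln x" if t: "0 < t" "t \<le> x" for t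
  proof (rule DERIV_nonneg_imp_nondecreasing[OF t(2)])
    fix s assume s: "t \<le> s" "s \<le> x"
    then have "((\<lambda>s. f s - e * ln s) has_real_derivative f' s - e * (1/s)) (at s)"
      using t by (auto intro!: derivative_eq_intros df)
    moreover have "0 \<le> f' s - e * (1/s)"
      using ge[of s] s t by (simp add: field_simps)
    ultimately show "\<exists>y. ((\<lambda>s. f s - e * ln s) has_real_derivative y) (at s) \<and> 0 \<le> y" by blast
  qed
  \<comment> \<open>Chosen so that \<open>e * ln t\<close> lies
    \<open>\<bar>f x - M\<bar> + 1\<close> below \<open>e * ln x\<close>, which pushes
    \<open>f t\<close> down to at most \<open>f x - \<bar>f x - M\<bar> - 1 < M\<close>.\<close>
  define t where "t = x * exp (- (\<bar>f x - M\<bar> + 1) / e)"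
  have t: "0 < t" "t \<le> x" using x e by (auto simp: t_def mult_le_cancel_left1 divide_le_0_iff)
  have "ln t = ln x - (\<bar>f x - M\<bar> + 1) / e" using x e by (simp add: t_def ln_mult field_simps)
  then have "e * ln t = e * ln x - (\<bar>f x - M\<bar> + 1)" using e by (simp add: field_simps)
  then have "f t < M" using mono[OF t] by (auto simp: abs_if split: if_splits)
  then show ?thesis using t by blast
qed

text \<open>On \<open>{f > L}\<close> the flux \<open>r f'\<close> increases; as it vanishes at the origin, \<open>f\<close> would keep
  growing once it exceeds \<open>L\<close>.\<close>

lemma radial_max_principle:
  fixes f f' F :: "real \<Rightarrow> real"
  assumes R: "0 < R"
    and df: "\<And>r. r \<in> dom0 R \<Longrightarrow> (f has_real_derivative f' r) (at r)"
    and dd: "\<And>r. r \<in> dom0 R \<Longrightarrow> ((\<lambda>s. s * f' s) has_real_derivative F r) (at r)"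
    and pos: "\<And>r. r \<in> dom0 R \<Longrightarrow> L < f r \<Longrightarrow> 0 < F r"
    and z: "((\<lambda>s. s * f' s) \<longlongrightarrow> 0) (at_right 0)"
    and e: "(f \<longlongrightarrow> L) (at_end R)"
    and r: "r \<in> dom0 R"
  shows "f r \<le> L"
proof (rule ccontr)
  assume "\<not> f r \<le> L"
  then have fr: "L < f r" by simp
  have incr: "s * f' s < x * f' x" if "0 < s" "s < x" "x \<in> dom0 R" "\<And>t. s \<le> t \<Longrightarrow> t \<le> x \<Longrightarrow> L < f t" for s x
  proof (rule DERIV_pos_imp_increasing[OF that(2)])
    fix t assume t: "s \<le> t" "t \<le> x"
    then have "t \<in> dom0 R" using that by (intro dom0_downward[OF that(3)]) auto
    then show "\<exists>y. ((\<lambda>s. s * f' s) has_real_derivative y) (at t) \<and> 0 < y"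
      using dd pos that(4) t by blast
  qed
  \<comment> \<open>If \<open>f\<close> has values at most \<open>L\<close> before \<open>x\<close>,
    take the last such point: the mean value theorem gives a positive flux between it and
    \<open>x\<close>, and the flux only increases from there. Otherwise the flux increases from its
    limit 0 at the origin.\<close>
  have grow: "0 < f' x" if x: "x \<in> dom0 R" and fx: "L < f x" for x
  proof -
    have x0: "0 < x" using x by (simp add: dom0_def)
    have "0 < x * f' x"
    proof (cases "\<exists>y. 0 < y \<and> y < x \<and> f y \<le> L")
      case True
      then obtain y where y: "0 < y" "y < x" "f y \<le> L" by blast
      have cf: "continuous_on {y..x} f"
        using y x by (intro continuous_at_imp_continuous_on ballI DERIV_isCont[OF df])
          (auto intro: dom0_downward)
      let ?S = "{t \<in> {y..x}. f t \<in> {..L}}"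
      have "closed ?S" by (rule continuous_closed_preimage[OF cf, unfolded vimage_def Int_def mem_Collect_eq]) auto
      moreover have "bounded ?S" by (rule bounded_subset[OF bounded_closed_interval[of y x]]) auto
      ultimately have "compact ?S" by (simp add: compact_eq_bounded_closed)
      moreover have "y \<in> ?S" using y by simp
      then have "?S \<noteq> {}" by blast
      ultimately obtain s where s: "s \<in> ?S" "\<And>t. t \<in> ?S \<Longrightarrow> t \<le> s"
        using compact_attains_sup[of ?S] by blast
      have ys: "y \<le> s" using s(2)[OF \<open>y \<in> ?S\<close>] .
      have sx: "s < x" using s fx by (cases "s = x") auto
      have gt: "L < f t" if "s < t" "t \<le> x" for t using s(2)[of t] s(1) that by force
      obtain w where w: "s < w" "w < x" "f x - f s = (x - s) * f' w"
      proof -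
        have "\<And>t. s \<le> t \<Longrightarrow> t \<le> x \<Longrightarrow> (f has_real_derivative f' t) (at t)"
          using ys y by (intro df dom0_downward[OF x]) auto
        then show thesis using MVT2[OF sx, of f f'] that by blast
      qed
      have "0 < (x - s) * f' w" using w(3) fx s(1) by auto
      then have "0 < f' w" using sx by (simp add: zero_less_mult_iff)
      moreover have "w * f' w < x * f' x"
        using w ys y x gt by (intro incr) auto
      moreover have "0 < w" using w(1) ys y(1) by linarith
      ultimately show ?thesis by (meson less_trans mult_pos_pos)
    next
      case False
      then have gt: "\<And>t. 0 < t \<Longrightarrow> t \<le> x \<Longrightarrow> L < f t" using fx by (metis linorder_not_le order_le_less)
      have "(x/2) * f' (x/2) < x * f' x" using x0 x gt by (intro incr) auto
      moreover have "0 \<le> (x/2) * f' (x/2)"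
      proof (rule tendsto_upperbound[OF z])
        have xx: "x/2 \<in> dom0 R" using x x0 by (intro dom0_downward[OF x]) auto
        show "eventually (\<lambda>s. s * f' s \<le> (x/2) * f' (x/2)) (at_right 0)"
          using eventually_dom0_right_0[OF xx]
        proof eventually_elim
          case (elim s)
          have "s * f' s < (x/2) * f' (x/2)" using elim xx x0 by (intro incr gt) auto
          then show ?case by simp
        qed
      qed simp
      ultimately show ?thesis by simp
    qed
    then show ?thesis using x0 by (simp add: zero_less_mult_iff)
  qed
  \<comment> \<open>A maximum over \<open>{r..y}\<close> attained before \<open>y\<close> would be a
    point with \<open>f' > 0\<close>, which is impossible. Hence \<open>f\<close> stays at or above
    \<open>f r > L\<close> up to the end, against its limit \<open>L\<close>.\<close>
  have "f r \<le> f y" if y: "y \<in> dom0 R" "r < y" for y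
  proof -
    have r0: "0 < r" using r by (simp add: dom0_def)
    have "continuous_on {r..y} f"
      using y r0 by (intro continuous_at_imp_continuous_on ballI DERIV_isCont[OF df])
        (auto intro: dom0_downward)
    then obtain s where s: "s \<in> {r..y}" "\<And>t. t \<in> {r..y} \<Longrightarrow> f t \<le> f s"
      using continuous_attains_sup[of "{r..y}" f] y by auto
    have sd: "s \<in> dom0 R" using s r0 by (auto intro: dom0_downward[OF y(1)])
    have "f r \<le> f s" using s y by auto
    have "s = y"
    proof (rule ccontr)
      assume "s \<noteq> y"
      then have sy: "s < y" using s by auto
      have "0 < f' s" using grow[OF sd] fr \<open>f r \<le> f s\<close> by simp
      then obtain d where d: "d > 0" "\<And>h. 0 < h \<Longrightarrow> h < d \<Longrightarrow> f s < f (s + h)"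
        using DERIV_pos_inc_right[OF df[OF sd]] by auto
      let ?h = "min (d/2) (y - s)"
      have "f s < f (s + ?h)" using d sy by auto
      moreover have "f (s + ?h) \<le> f s" using s sy d by (intro s(2)) auto
      ultimately show False by simp
    qed
    then show ?thesis using \<open>f r \<le> f s\<close> by simp
  qed
  then have "eventually (\<lambda>y. f r \<le> f y) (at_end R)"
    using eventually_at_end[OF r] by (auto elim: eventually_mono)
  then have "f r \<le> L" using tendsto_lowerbound[OF e] at_end_neq_bot[OF R] by blast
  then show False using fr by simp
qed

section \<open>A priori bounds for solutions\<close>

locale gl_params =
  fixes A B C q :: real and n :: nat
  assumes B: "0 < B" and C: "0 < C" and q: "0 < q"
    and A: "A = 4 * C * q^2 - 2 * B * q" and BC: "B \<le> C * q" and n: "1 \<le> n"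
begin

text \<open>\<open>hh\<close> and \<open>gg\<close> are the two partial derivatives of the potential
  \<open>ff\<close>.\<close>

definition hh :: "real \<Rightarrow> real \<Rightarrow> real" where
  "hh u v = u * (- A + 2 * B * v + C * (u^2 + v^2))"

definition gg :: "real \<Rightarrow> real \<Rightarrow> real" where
  "gg u v = v * (- A - B * v + C * (u^2 + v^2)) + B * u^2"

text \<open>The cubic \<open>v * (v^2 - 3 * u^2)\<close> is \<open>s^3\<close> times the cosine of a
  triple angle, hence at most \<open>s^3\<close>; the identity for the sixth power is cos^2 + sin^2
  = 1 for that angle. So the radial force is at least \<open>s^2 * (C * s^2 - B * s - A)\<close>,
  from which the relation for \<open>A\<close> splits off \<open>s - 2 * q\<close>.\<close>

lemma radial_force_pos:
  assumes P: "4 * q^2 < u^2 + v^2"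
  shows "0 < u * hh u v + v * gg u v"
proof -
  define s where "s = sqrt (u^2 + v^2)"
  have s2: "s^2 = u^2 + v^2" by (simp add: s_def)
  have "2 * q < s" unfolding s_def by (rule real_less_rsqrt) (use P in \<open>simp add: power_mult_distrib\<close>)
  have s0: "0 < s" using \<open>2 * q < s\<close> q by linarith
  have s6: "(s^2)^3 = (s^3)^2" by algebra
  have "(v * (v^2 - 3 * u^2))^2 + (u * (3 * v^2 - u^2))^2 = (s^2)^3"
    unfolding s2 by algebra
  then have "(v * (v^2 - 3 * u^2))^2 \<le> (s^3)^2"
    using zero_le_power2[of "u * (3 * v^2 - u^2)"] unfolding s6 by linarith
  then have cub: "v * (v^2 - 3 * u^2) \<le> s^3"
    by (rule power2_le_imp_le) (use s0 in simp)
  have "u * hh u v + v * gg u v = s^2 * (C * s^2 - A) - B * (v * (v^2 - 3 * u^2))"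
    unfolding s2 hh_def gg_def by algebra
  also have "\<dots> \<ge> s^2 * (C * s^2 - A) - B * s^3"
    using mult_left_mono[OF cub, of B] B by simp
  also have "s^2 * (C * s^2 - A) - B * s^3 = s^2 * ((s - 2 * q) * (C * (s + 2 * q) - B))"
    unfolding A by algebra
  finally have "s^2 * ((s - 2 * q) * (C * (s + 2 * q) - B)) \<le> u * hh u v + v * gg u v" .
  moreover have "B < C * (s + 2 * q)" using BC mult_pos_pos[OF C s0] mult_pos_pos[OF C q]
    by (simp add: algebra_simps)
  then have "0 < s^2 * ((s - 2 * q) * (C * (s + 2 * q) - B))"
    using s0 \<open>2 * q < s\<close> by (intro mult_pos_pos) auto
  ultimately show ?thesis by linarith
qed

text \<open>With \<open>y = - v\<close>, \<open>- gg\<close> is affine in \<open>u^2\<close> with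
  slope \<open>C * y - B\<close>. For a nonnegative slope the worst case is the circle
  \<open>u^2 = 4 * q^2 - y^2\<close>, where it factors as
  \<open>2 * B * ((y - q) * (y + 2 * q))\<close>; otherwise \<open>u = 0\<close> is the worst case
  and \<open>B \<le> C * q\<close> suffices.\<close>

lemma gg_pos:
  assumes v: "- q < v" "v < 0" and P: "u^2 + v^2 \<le> 4 * q^2"
  shows "0 < gg u v"
proof -
  define y where "y = - v"
  have y: "0 < y" "y < q" using v by (auto simp: y_def)
  have g: "- gg u v = y * (- A + C * y^2 + B * y) + u^2 * (C * y - B)"
    by (simp add: gg_def y_def algebra_simps power2_eq_square)
  have "- gg u v < 0"
  proof (cases "B \<le> C * y")
    case True
    have "u^2 * (C * y - B) \<le> (4 * q^2 - y^2) * (C * y - B)"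
      using True P by (intro mult_right_mono) (auto simp: y_def)
    then have "- gg u v \<le> y * (- A + C * y^2 + B * y) + (4 * q^2 - y^2) * (C * y - B)"
      using g by linarith
    also have "\<dots> = 2 * B * ((y - q) * (y + 2 * q))" unfolding A by algebra
    also have "\<dots> < 0" using B y q by (intro mult_pos_neg mult_neg_pos) auto
    finally show ?thesis .
  next
    case False
    have "C * y * y < B * y" using False y by (intro mult_strict_right_mono) auto
    moreover have "B * y < B * q" using y B by auto
    moreover have "B * q \<le> C * q * q" using BC q by (intro mult_right_mono) auto
    ultimately have "- A + C * y^2 + B * y < 0" unfolding A by (simp add: power2_eq_square)
    then have "y * (- A + C * y^2 + B * y) < 0" using y by (intro mult_pos_neg)
    moreover have "u^2 * (C * y - B) \<le> 0" using False by (intro mult_nonneg_nonpos) auto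
    ultimately show ?thesis using g by linarith
  qed
  then show ?thesis by simp
qed

end

text \<open>The derivatives are separate functions \<open>u1\<close>, \<open>v1\<close>, so that the
  locale covers both an arbitrary solution with \<open>deriv u\<close>, \<open>deriv v\<close> and
  the constructed one with its explicit formulas.\<close>

locale gl_sol = gl_params +
  fixes R :: ereal and u u1 v v1 :: "real \<Rightarrow> real"
  assumes R: "0 < R"
    and du: "r \<in> dom0 R \<Longrightarrow> (u has_real_derivative u1 r) (at r)"
    and ddu: "r \<in> dom0 R \<Longrightarrow>
      (u1 has_real_derivative ((real n)^2 * u r / r^2 + hh (u r) (v r) - u1 r / r)) (at r)"
    and dv: "r \<in> dom0 R \<Longrightarrow> (v has_real_derivative v1 r) (at r)"
    and ddv: "r \<in> dom0 R \<Longrightarrow> (v1 has_real_derivative (gg (u r) (v r) - v1 r / r)) (at r)"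
    and upos: "r \<in> dom0 R \<Longrightarrow> 0 < u r" and vneg: "r \<in> dom0 R \<Longrightarrow> v r < 0"
    and u0: "(u \<longlongrightarrow> 0) (at_right 0)" and v10: "(v1 \<longlongrightarrow> 0) (at_right 0)"
    and uR: "(u \<longlongrightarrow> sqrt 3 * q) (at_end R)" and vR: "(v \<longlongrightarrow> - q) (at_end R)"
begin

lemma flux_u:
  assumes "r \<in> dom0 R"
  shows "((\<lambda>s. s * u1 s) has_real_derivative ((real n)^2 * u r / r + r * hh (u r) (v r))) (at r)"
proof -
  have "0 < r" using assms by (simp add: dom0_def)
  then show ?thesis using ddu[OF assms]
    by (auto intro!: derivative_eq_intros simp: field_simps power2_eq_square)
qed

lemma flux_v:
  assumes "r \<in> dom0 R"
  shows "((\<lambda>s. s * v1 s) has_real_derivative (r * gg (u r) (v r))) (at r)"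
proof -
  have "0 < r" using assms by (simp add: dom0_def)
  then show ?thesis using ddv[OF assms]
    by (auto intro!: derivative_eq_intros simp: field_simps power2_eq_square)
qed

lemma cont_u: "continuous_on (dom0 R) u"
  by (intro continuous_at_imp_continuous_on ballI DERIV_isCont[OF du])

lemma cont_v: "continuous_on (dom0 R) v"
  by (intro continuous_at_imp_continuous_on ballI DERIV_isCont[OF dv])

lemma cont_u1: "continuous_on (dom0 R) u1"
  by (intro continuous_at_imp_continuous_on ballI DERIV_isCont[OF ddu])

lemma cont_v1: "continuous_on (dom0 R) v1"
  by (intro continuous_at_imp_continuous_on ballI DERIV_isCont[OF ddv])

text \<open>No value of \<open>v\<close> at the origin is prescribed; boundedness comes from the
  smallness of \<open>v1\<close> there.\<close>

lemma v_bounded_near_0: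
  "\<exists>d\<in>dom0 R. \<exists>K. \<forall>r. 0 < r \<longrightarrow> r \<le> d \<longrightarrow> \<bar>v r\<bar> \<le> K \<and> \<bar>u r\<bar> \<le> 1"
proof -
  have "eventually (\<lambda>r. \<bar>v1 r\<bar> < 1) (at_right 0)" "eventually (\<lambda>r. \<bar>u r\<bar> < 1) (at_right 0)"
    using tendstoD[OF v10, of 1] tendstoD[OF u0, of 1] by (auto simp: dist_real_def)
  then have ev: "eventually (\<lambda>r. \<bar>v1 r\<bar> < 1 \<and> \<bar>u r\<bar> < 1) (at_right 0)" by eventually_elim auto
  obtain d where d: "d \<in> dom0 R" "\<And>r. 0 < r \<Longrightarrow> r \<le> d \<Longrightarrow> \<bar>v1 r\<bar> < 1 \<and> \<bar>u r\<bar> < 1"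
    using eventually_at_rightD[OF ev R] by blast
  have "\<bar>v r\<bar> \<le> \<bar>v d\<bar> + d" if r: "0 < r" "r \<le> d" for r
  proof (cases "r = d")
    case False
    then have rd: "r < d" using r by simp
    obtain w where w: "r < w" "w < d" "v d - v r = (d - r) * v1 w"
      using MVT2[OF rd, of v v1] dv[OF dom0_downward[OF d(1)]] r by auto
    have "\<bar>v d - v r\<bar> \<le> (d - r) * 1"
      unfolding w(3) abs_mult using d(2)[of w] w r by (intro mult_mono) auto
    then show ?thesis using r by (smt (verit))
  qed (use r in auto)
  then show ?thesis using d by (intro bexI[of _ d] exI[of _ "\<bar>v d\<bar> + d"]) (auto intro: less_imp_le)
qed

text \<open>The two bounds say \<open>0 \<le> r u' / u \<le> n + 1\<close>: in the variable \<open>ln r\<close> the equation is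
  \<open>u'' = (n\<^sup>2 + o(1)) u\<close>, whose positive solutions with \<open>u \<longlongrightarrow> 0\<close> cannot violate them.\<close>

lemma flux_u_near_0:
  "\<exists>d\<in>dom0 R. \<forall>r. 0 < r \<longrightarrow> r \<le> d \<longrightarrow> 0 \<le> r * u1 r \<and> r * u1 r \<le> (real n + 1) * u r \<and>
        u r / 4 \<le> (real n)^2 * u r + r * (r * hh (u r) (v r))"
proof -
  obtain d0 K where d0: "d0 \<in> dom0 R" "\<And>r. 0 < r \<Longrightarrow> r \<le> d0 \<Longrightarrow> \<bar>v r\<bar> \<le> K \<and> \<bar>u r\<bar> \<le> 1"
    using v_bounded_near_0 by blast
  \<comment> \<open>\<open>H\<close> bounds the factor of \<open>u\<close> in \<open>hh\<close> near
    the origin. Since \<open>H \<ge> 1\<close>, radii up to \<open>1 / (2 * H)\<close> satisfy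
    \<open>r^2 * H \<le> 1 / 2\<close>, so the force perturbs \<open>n^2\<close> by at most
    1/2.\<close>
  define H where "H = \<bar>A\<bar> + 2 * B * K + C * (1 + K^2) + 1"
  define d where "d = min d0 (1 / (2 * H))"
  have d00: "0 < d0" using d0 by (simp add: dom0_def)
  have K0: "0 \<le> K" using d0(2)[of d0] d00 by force
  have H1: "1 \<le> H" unfolding H_def using B C K0 by simp
  have d: "0 < d" "d \<le> d0" using d00 H1 by (auto simp: d_def)
  have dd: "d \<in> dom0 R" using d by (intro dom0_downward[OF d0(1)])
  have dom: "r \<in> dom0 R" if "0 < r" "r \<le> d" for r using dom0_downward[OF dd] that by blast
  have coeff: "\<bar>r * (r * hh (u r) (v r))\<bar> \<le> u r / 2" if r: "0 < r" "r \<le> d" for r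
  proof -
    have b: "\<bar>v r\<bar> \<le> K" "\<bar>u r\<bar> \<le> 1" using d0(2)[of r] r d by auto
    have "(u r)^2 \<le> 1" "(v r)^2 \<le> K^2" using b K0 by (auto simp: abs_square_le_1 power2_le_iff_abs_le)
    then have "C * ((u r)^2 + (v r)^2) \<le> C * (1 + K^2)" using C by (intro mult_left_mono) auto
    moreover have "\<bar>2 * B * v r\<bar> \<le> 2 * B * K" using b B by (auto simp: abs_mult)
    moreover have "0 \<le> C * ((u r)^2 + (v r)^2)" using C by simp
    ultimately have Q: "\<bar>- A + 2 * B * v r + C * ((u r)^2 + (v r)^2)\<bar> \<le> H" unfolding H_def by linarith
    have "r \<le> 1 / (2 * H)" using r by (simp add: d_def)
    moreover have "1 / (2 * H) \<le> 1" using H1 by (simp add: field_simps)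
    ultimately have "r * r \<le> (1 / (2 * H)) * 1" using r H1 by (intro mult_mono) linarith+
    then have "(r * r) * \<bar>- A + 2 * B * v r + C * ((u r)^2 + (v r)^2)\<bar> \<le> (1 / (2 * H)) * 1 * H"
      using mult_mono[OF _ Q, of "r * r" "(1 / (2 * H)) * 1"] H1 by simp
    then have "(r * r) * \<bar>- A + 2 * B * v r + C * ((u r)^2 + (v r)^2)\<bar> \<le> 1 / 2" using H1 by simp
    then have "u r * ((r * r) * \<bar>- A + 2 * B * v r + C * ((u r)^2 + (v r)^2)\<bar>) \<le> u r * (1 / 2)"
      using upos[OF dom[OF r]] by (intro mult_left_mono) auto
    moreover have "r * (r * hh (u r) (v r)) = u r * ((r * r) * (- A + 2 * B * v r + C * ((u r)^2 + (v r)^2)))"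
      by (simp add: hh_def)
    ultimately show ?thesis using upos[OF dom[OF r]] r by (simp add: abs_mult)
  qed
  have n1: "1 \<le> (real n)^2" using n by simp
  have D: "((\<lambda>s. s * u1 s) has_real_derivative ((real n)^2 * u r / r + r * hh (u r) (v r))) (at r)"
    if "0 < r" "r \<le> d" for r using flux_u dom that by blast
  have pos: "u r / 4 \<le> (real n)^2 * u r + r * (r * hh (u r) (v r))" if "0 < r" "r \<le> d" for r
    using coeff[OF that] upos[OF dom[OF that]] mult_right_mono[OF n1, of "u r"] by linarith
  have flux_nonneg: "0 \<le> r * u1 r" if r: "0 < r" "r \<le> d" for r
  proof (rule ccontr)
    \<comment> \<open>The flux is nondecreasing, so a negative value persists at all smaller radii.
      Then \<open>- u\<close> descends logarithmically and \<open>u\<close> leaves the bound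
      1.\<close>
    assume neg: "\<not> 0 \<le> r * u1 r"
    have mono: "s * u1 s \<le> r * u1 r" if s: "0 < s" "s \<le> r" for s
    proof (rule DERIV_nonneg_imp_nondecreasing[OF s(2)])
      fix t assume t: "s \<le> t" "t \<le> r"
      then have t': "0 < t" "t \<le> d" using s r by auto
      have "0 \<le> (real n)^2 * u t + t * (t * hh (u t) (v t))" using pos[OF t'] upos[OF dom[OF t']] by linarith
      then have "0 \<le> (real n)^2 * u t / t + t * hh (u t) (v t)" using t' by (simp add: field_simps)
      then show "\<exists>y. ((\<lambda>s. s * u1 s) has_real_derivative y) (at t) \<and> 0 \<le> y" using D[OF t'] by blast
    qed
    have "\<exists>t. 0 < t \<and> t \<le> r \<and> - u t < - 1"
    proof (rule logarithmic_blow_down[OF r(1)])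
      show "0 < - (r * u1 r)" using neg by simp
      show "((\<lambda>r. - u r) has_real_derivative - u1 s) (at s)" if "0 < s" "s \<le> r" for s
        using du[of s] dom[of s] that r by (auto intro!: derivative_eq_intros)
      show "- (r * u1 r) \<le> s * - u1 s" if "0 < s" "s \<le> r" for s using mono[OF that] by simp
    qed
    then obtain t where "0 < t" "t \<le> r" "1 < u t" by auto
    then show False using d0(2)[of t] r d by auto
  qed
  have flux_le: "r * u1 r \<le> (real n + 1) * u r" if r: "0 < r" "r \<le> d" for r
  proof (rule ccontr)
    assume neg: "\<not> r * u1 r \<le> (real n + 1) * u r"
    define k where "k = n + 1"
    have k: "real k = real n + 1" by (simp add: k_def)
    \<comment> \<open>In the variable x = ln s this is exp (k x) (u' - k u), with derivative exp (k
      x) (u'' - k^2 u); it is nonpositive because n^2 + 1/2 < (n + 1)^2. A positive value thus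
      persists towards the origin, keeps the flux away from 0 and drives \<open>u\<close> below
      0.\<close>
    define th where "th = (\<lambda>s. s ^ k * (s * u1 s - real k * u s))"
    have mono: "th r \<le> th s" if s: "0 < s" "s \<le> r" for s
    proof (rule DERIV_nonpos_imp_nonincreasing[OF s(2)])
      fix t assume t: "s \<le> t" "t \<le> r"
      then have t': "0 < t" "t \<le> d" using s r by auto
      let ?D = "real k * t ^ n * (t * u1 t - real k * u t) + t ^ k * ((real n)^2 * u t / t + t * hh (u t) (v t) - real k * u1 t)"
      have "(th has_real_derivative ?D) (at t)"
        unfolding th_def
        by (rule DERIV_cong[OF DERIV_mult[OF DERIV_pow DERIV_diff[OF D[OF t'] DERIV_cmult[OF du[OF dom[OF t']]]]]])
          (simp add: k_def algebra_simps)
      moreover have "?D = t ^ n * ((real n)^2 * u t + t * (t * hh (u t) (v t)) - (real k)^2 * u t)"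
        using t' by (simp add: k_def field_simps power2_eq_square)
      moreover have "\<dots> \<le> 0"
      proof (rule mult_nonneg_nonpos)
        have "((real n)^2 + 1) * u t \<le> (real k)^2 * u t"
          using upos[OF dom[OF t']] by (intro mult_right_mono) (auto simp: k power2_eq_square algebra_simps)
        then show "(real n)^2 * u t + t * (t * hh (u t) (v t)) - (real k)^2 * u t \<le> 0"
          using coeff[OF t'] upos[OF dom[OF t']] by (simp add: algebra_simps)
      qed (use t' in auto)
      ultimately show "\<exists>y. (th has_real_derivative y) (at t) \<and> y \<le> 0" by auto
    qed
    have thr: "0 < th r" unfolding th_def using neg r k by auto
    have "\<exists>t. 0 < t \<and> t \<le> r \<and> u t < 0"
    proof (rule logarithmic_blow_down[OF r(1)])
      show "0 < th r / r ^ k" using thr r by simp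
      show "(u has_real_derivative u1 s) (at s)" if "0 < s" "s \<le> r" for s
        using du[of s] dom[of s] that r by auto
      show "th r / r ^ k \<le> s * u1 s" if s: "0 < s" "s \<le> r" for s
      proof -
        have sd: "s \<in> dom0 R" using dom[of s] s r by auto
        have "th r / r ^ k \<le> th s / s ^ k"
          using mono[OF s] s thr by (intro frac_le power_mono) auto
        also have "\<dots> = s * u1 s - real k * u s" using s by (simp add: th_def)
        also have "\<dots> \<le> s * u1 s" using upos[OF sd] by simp
        finally show ?thesis .
      qed
    qed
    then obtain t where "0 < t" "t \<le> r" "u t < 0" by auto
    then show False using upos[OF dom[of t]] r by auto
  qed
  show ?thesis by (intro bexI[OF _ dd] allI impI conjI flux_nonneg flux_le pos)
qed

lemma flux_u_tendsto_0: "((\<lambda>s. s * u1 s) \<longlongrightarrow> 0) (at_right 0)"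
proof -
  obtain d where d: "d \<in> dom0 R"
    "\<And>r. 0 < r \<Longrightarrow> r \<le> d \<Longrightarrow> 0 \<le> r * u1 r \<and> r * u1 r \<le> (real n + 1) * u r"
    using flux_u_near_0 by blast
  have ev: "eventually (\<lambda>r. 0 \<le> r * u1 r \<and> r * u1 r \<le> (real n + 1) * u r) (at_right 0)"
    using eventually_dom0_right_0[OF d(1)] by eventually_elim (use d(2) in auto)
  show ?thesis
  proof (rule tendsto_sandwich[OF _ _ tendsto_const])
    show "((\<lambda>r. (real n + 1) * u r) \<longlongrightarrow> 0) (at_right 0)" using tendsto_mult_right_zero[OF u0] .
  qed (use ev in \<open>auto elim: eventually_mono\<close>)
qed

lemma flux_v_tendsto_0: "((\<lambda>s. s * v1 s) \<longlongrightarrow> 0) (at_right 0)"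
  using tendsto_mult[OF tendsto_ident_at v10] by simp

text \<open>In the flux derivative of \<open>u^2 + v^2\<close> the gradient and centrifugal terms
  are nonnegative, and the rest is \<open>2 * r\<close> times the radial force. The limit at the
  end, 3 q^2 + q^2, is exactly the threshold of \<open>radial_force_pos\<close>.\<close>

lemma P_le: assumes "r \<in> dom0 R" shows "(u r)^2 + (v r)^2 \<le> 4 * q^2"
proof (rule radial_max_principle[where f' = "\<lambda>r. 2 * u r * u1 r + 2 * v r * v1 r", OF R _ _ _ _ _ assms])
  fix r assume r: "r \<in> dom0 R"
  have r0: "0 < r" using r by (simp add: dom0_def)
  show "((\<lambda>r. (u r)^2 + (v r)^2) has_real_derivative 2 * u r * u1 r + 2 * v r * v1 r) (at r)"
    using du[OF r] dv[OF r] by (auto intro!: derivative_eq_intros)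
  let ?F = "\<lambda>r. 2 * r * ((u1 r)^2 + (v1 r)^2) + 2 * (real n)^2 * (u r)^2 / r + 2 * r * (u r * hh (u r) (v r) + v r * gg (u r) (v r))"
  have "((\<lambda>s. 2 * u s * (s * u1 s) + 2 * v s * (s * v1 s)) has_real_derivative ?F r) (at r)"
    by (rule DERIV_cong[OF DERIV_add[OF DERIV_mult[OF DERIV_cmult[OF du[OF r]] flux_u[OF r]]
          DERIV_mult[OF DERIV_cmult[OF dv[OF r]] flux_v[OF r]]]])
      (use r0 in \<open>simp add: field_simps power2_eq_square\<close>)
  then show "((\<lambda>s. s * (2 * u s * u1 s + 2 * v s * v1 s)) has_real_derivative ?F r) (at r)"
    by (simp add: algebra_simps)
  show "0 < ?F r" if "4 * q^2 < (u r)^2 + (v r)^2"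
    using radial_force_pos[OF that] r0 by (intro add_nonneg_pos) auto
next
  obtain d K where d: "d \<in> dom0 R" "\<And>r. 0 < r \<Longrightarrow> r \<le> d \<Longrightarrow> \<bar>v r\<bar> \<le> K \<and> \<bar>u r\<bar> \<le> 1"
    using v_bounded_near_0 by blast
  have "eventually (\<lambda>r. norm (v r) \<le> K) (at_right 0)"
    using eventually_dom0_right_0[OF d(1)] by eventually_elim (use d(2) in auto)
  then have "((\<lambda>s. v s * (s * v1 s)) \<longlongrightarrow> 0) (at_right 0)"
    by (rule lim_null_mult_left_bounded[OF _ flux_v_tendsto_0])
  then have "((\<lambda>s. 2 * (u s * (s * u1 s)) + 2 * (v s * (s * v1 s))) \<longlongrightarrow> 0) (at_right 0)"
    using tendsto_add[OF tendsto_mult_right_zero[OF tendsto_mult_zero[OF u0 flux_u_tendsto_0], of 2] tendsto_mult_right_zero[of _ _ 2]] by simp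
  then show "((\<lambda>s. s * (2 * u s * u1 s + 2 * v s * v1 s)) \<longlongrightarrow> 0) (at_right 0)"
    by (simp add: algebra_simps)
  have "((\<lambda>r. (u r)^2 + (v r)^2) \<longlongrightarrow> (sqrt 3 * q)^2 + (- q)^2) (at_end R)"
    by (intro tendsto_intros uR vR)
  then show "((\<lambda>r. (u r)^2 + (v r)^2) \<longlongrightarrow> 4 * q^2) (at_end R)" by (simp add: power_mult_distrib)
qed

text \<open>\<open>gg_pos\<close> gives the sign only inside the disc, hence the appeal to
  \<open>P_le\<close>.\<close>

lemma v_le: assumes "r \<in> dom0 R" shows "v r \<le> - q"
proof (rule radial_max_principle[OF R dv flux_v _ flux_v_tendsto_0 vR assms])
  show "0 < r * gg (u r) (v r)" if "r \<in> dom0 R" "- q < v r" for r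
    using gg_pos[OF that(2) vneg P_le] that by (auto simp: dom0_def)
qed

lemma v_ge: assumes "r \<in> dom0 R" shows "- (2 * q) \<le> v r"
proof -
  have "(v r)^2 \<le> 4 * q^2" using P_le[OF assms] zero_le_power2[of "u r"] by linarith
  then have "(v r)^2 \<le> (2 * q)^2" by (simp add: power_mult_distrib)
  then show ?thesis using q abs_le_square_iff[of "v r" "2 * q"] by auto
qed

lemma u2_le: assumes "r \<in> dom0 R" shows "(u r)^2 \<le> 3 * q^2"
proof -
  have "q^2 \<le> (- v r)^2" using v_le[OF assms] q by (intro power_mono) auto
  then show ?thesis using P_le[OF assms] by auto
qed

lemma u_le: assumes "r \<in> dom0 R" shows "u r \<le> 2 * q"
proof (rule power2_le_imp_le)
  have "(u r)^2 \<le> 4 * q^2" using u2_le[OF assms] zero_le_power2[of q] by linarith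
  then show "(u r)^2 \<le> (2 * q)^2" by (simp add: power_mult_distrib)
qed (use q in auto)

lemma hh_bound:
  "\<exists>K>0. \<forall>r\<in>dom0 R. \<bar>hh (u r) (v r)\<bar> \<le> K \<and> \<bar>gg (u r) (v r)\<bar> \<le> K"
proof -
  have c: "continuous_on UNIV (\<lambda>(x, y). hh x y)" "continuous_on UNIV (\<lambda>(x, y). gg x y)"
    unfolding hh_def gg_def by (auto intro!: continuous_intros simp: case_prod_beta)
  let ?S = "{0..2*q} \<times> {-(2*q)..-q}"
  have S: "compact ?S" by (intro compact_Times) auto
  have "bounded ((\<lambda>(x, y). hh x y) ` ?S)" "bounded ((\<lambda>(x, y). gg x y) ` ?S)"
    using S c by (auto intro!: compact_imp_bounded compact_continuous_image intro: continuous_on_subset)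
  then obtain K1 K2 where K: "\<forall>x\<in>?S. \<bar>case x of (x, y) \<Rightarrow> hh x y\<bar> \<le> K1"
     "\<forall>x\<in>?S. \<bar>case x of (x, y) \<Rightarrow> gg x y\<bar> \<le> K2"
    unfolding bounded_iff ball_simps real_norm_def by blast
  show ?thesis
  proof (intro exI[of _ "\<bar>K1\<bar> + \<bar>K2\<bar> + 1"] conjI[of "_ < _"] ballI)
    fix r assume r: "r \<in> dom0 R"
    have "(u r, v r) \<in> ?S" using u_le[OF r] upos[OF r] v_le[OF r] v_ge[OF r] by auto
    then show "\<bar>hh (u r) (v r)\<bar> \<le> \<bar>K1\<bar> + \<bar>K2\<bar> + 1 \<and> \<bar>gg (u r) (v r)\<bar> \<le> \<bar>K1\<bar> + \<bar>K2\<bar> + 1"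
      using bspec[OF K(1), of "(u r, v r)"] bspec[OF K(2), of "(u r, v r)"] by auto
  qed simp
qed

end

section \<open>Picone's inequality for weak derivatives\<close>

lemma set_integral_FTC:
  fixes f F :: "real \<Rightarrow> real"
  assumes "a \<le> b" and F: "\<And>x. a \<le> x \<Longrightarrow> x \<le> b \<Longrightarrow> (F has_real_derivative f x) (at x)"
    and "continuous_on {a..b} f"
  shows "set_integrable lborel {a..b} f" "(LINT x:{a..b}|lborel. f x) = F b - F a"
proof -
  show "set_integrable lborel {a..b} f" by (rule borel_integrable_atLeastAtMost'[OF assms(3)])
  show "(LINT x:{a..b}|lborel. f x) = F b - F a"
    unfolding set_lebesgue_integral_def
    using assms(1,3) F by (intro integral_FTC_atLeastAtMost)
      (auto simp flip: has_real_derivative_iff_has_vector_derivative intro: has_field_derivative_at_within)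
qed

text \<open>Fubini for \<open>f' s * g' t\<close> on the triangle s \<le> t. The factors are merely
  primitives of Lebesgue integrable functions, as the perturbation space provides no pointwise
  derivatives.\<close>

lemma lebesgue_product_rule:
  fixes f f' g g' :: "real \<Rightarrow> real"
  assumes ab: "a \<le> b"
    and f': "set_integrable lborel {a..b} f'" and g': "set_integrable lborel {a..b} g'"
    and f: "\<And>t. a \<le> t \<Longrightarrow> t \<le> b \<Longrightarrow> f t = f a + (LINT s:{a..t}|lborel. f' s)"
    and g: "\<And>t. a \<le> t \<Longrightarrow> t \<le> b \<Longrightarrow> g t = g a + (LINT s:{a..t}|lborel. g' s)"
  shows "set_integrable lborel {a..b} (\<lambda>t. f' t * g t + f t * g' t)" (is ?int)
    and "(LINT t:{a..b}|lborel. f' t * g t + f t * g' t) = f b * g b - f a * g a" (is ?eq)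
proof -
  define F where "F = (\<lambda>s. indicator {a..b} s * f' s)"
  define G where "G = (\<lambda>s. indicator {a..b} s * g' s)"
  have F: "integrable lborel F" and G: "integrable lborel G"
    using f' g' by (simp_all add: set_integrable_def F_def G_def)
  have [measurable]: "F \<in> borel_measurable borel" "G \<in> borel_measurable borel"
    using borel_measurable_integrable[OF F] borel_measurable_integrable[OF G] by simp_all
  define K where "K = (\<lambda>s t. indicator {s..} t * (F s * G t))"
  have FG: "integrable (lborel \<Otimes>\<^sub>M lborel) (\<lambda>(s, t). F s * G t)"
  proof (rule lborel_pair.Fubini_integrable)
    have "(\<integral>t. norm (case (s, t) of (s, t) \<Rightarrow> F s * G t) \<partial>lborel) = \<bar>F s\<bar> * (\<integral>t. \<bar>G t\<bar> \<partial>lborel)" for s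
      by (simp add: abs_mult)
    then show "integrable lborel (\<lambda>s. \<integral>t. norm (case (s, t) of (s, t) \<Rightarrow> F s * G t) \<partial>lborel)"
      using F by (simp add: integrable_abs)
    show "AE s in lborel. integrable lborel (\<lambda>t. case (s, t) of (s, t) \<Rightarrow> F s * G t)"
      using G by simp
  qed measurable
  have Km: "(\<lambda>(s, t). K s t) \<in> borel_measurable (lborel \<Otimes>\<^sub>M lborel)"
  proof -
    have "(\<lambda>(s, t). K s t) = (\<lambda>p. if fst p \<le> snd p then F (fst p) * G (snd p) else 0)"
      by (auto simp: K_def fun_eq_iff)
    then show ?thesis by simp
  qed
  have K: "integrable (lborel \<Otimes>\<^sub>M lborel) (\<lambda>(s, t). K s t)"
    by (rule Bochner_Integration.integrable_bound[OF FG Km]) (auto simp: K_def split: split_indicator)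
  have inner_t: "(\<integral>s. K s t \<partial>lborel) = G t * (f t - f a)" for t
  proof (cases "t \<in> {a..b}")
    case True
    have "(\<integral>s. K s t \<partial>lborel) = (\<integral>s. G t * (indicator {a..t} s * f' s) \<partial>lborel)"
      using True by (intro Bochner_Integration.integral_cong) (auto simp: K_def F_def split: split_indicator)
    also have "\<dots> = G t * (f t - f a)"
      using f[of t] True by (simp add: set_lebesgue_integral_def)
    finally show ?thesis .
  qed (simp add: K_def G_def)
  have inner_s: "(\<integral>t. K s t \<partial>lborel) = F s * (g b - g s)" for s
  proof (cases "s \<in> {a..b}")
    case True
    \<comment> \<open>The two integrands differ only at \<open>t = s\<close>.\<close>
    have "(\<integral>t. K s t \<partial>lborel) = (\<integral>t. F s * (G t - indicator {a..s} t * g' t) \<partial>lborel)"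
    proof (rule integral_cong_AE)
      have "AE t in lborel. t \<noteq> s" by (rule AE_lborel_singleton)
      then show "AE t in lborel. K s t = F s * (G t - indicator {a..s} t * g' t)"
        by eventually_elim (use True in \<open>auto simp: K_def G_def split: split_indicator\<close>)
      have "set_integrable lborel {a..s} g'"
        using True by (intro set_integrable_subset[OF g']) auto
      then have [measurable]: "(\<lambda>t. indicator {a..s} t * g' t) \<in> borel_measurable lborel"
        using borel_measurable_integrable by (force simp: set_integrable_def)
      show "(\<lambda>t. F s * (G t - indicator {a..s} t * g' t)) \<in> borel_measurable lborel" by measurable
      show "K s \<in> borel_measurable lborel" unfolding K_def by measurable
    qed
    also have "\<dots> = F s * ((\<integral>t. G t \<partial>lborel) - (\<integral>t. indicator {a..s} t * g' t \<partial>lborel))"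
    proof -
      have "set_integrable lborel {a..s} g'"
        using True by (intro set_integrable_subset[OF g']) auto
      then show ?thesis using G by (simp add: set_integrable_def)
    qed
    also have "\<dots> = F s * ((g b - g a) - (g s - g a))"
      using g[of b] g[of s] True ab by (simp add: set_lebesgue_integral_def G_def)
    finally show ?thesis by simp
  qed (simp add: K_def F_def)
  have 1: "integrable lborel (\<lambda>t. G t * (f t - f a))" "integrable lborel (\<lambda>s. F s * (g b - g s))"
    using lborel_pair.integrable_snd[OF K] lborel_pair.integrable_fst[OF K] by (simp_all add: inner_t inner_s)
  have 2: "(\<integral>t. G t * (f t - f a) \<partial>lborel) = (\<integral>s. F s * (g b - g s) \<partial>lborel)"
    using lborel_pair.Fubini_integral[OF K] by (simp add: inner_t inner_s)
  have eq: "indicator {a..b} t * (f' t * g t + f t * g' t)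
      = F t * g b + G t * f a + (G t * (f t - f a) - F t * (g b - g t))" for t
    by (simp add: F_def G_def algebra_simps split: split_indicator)
  have 3: "(\<integral>t. F t \<partial>lborel) = f b - f a" "(\<integral>t. G t \<partial>lborel) = g b - g a"
    using f[of b] g[of b] ab by (simp_all add: set_lebesgue_integral_def F_def G_def)
  show ?int
    unfolding set_integrable_def real_scaleR_def eq using 1 F G by simp
  show ?eq
  proof -
    define X where "X = (\<lambda>t. G t * (f t - f a))"
    define Y where "Y = (\<lambda>t. F t * (g b - g t))"
    have "integrable lborel X" "integrable lborel Y" "integral\<^sup>L lborel X = integral\<^sup>L lborel Y"
      using 1 2 by (simp_all add: X_def Y_def)
    then have "(\<integral>t. F t * g b + G t * f a + (X t - Y t) \<partial>lborel) = (f b - f a) * g b + (g b - g a) * f a"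
      using F G by (simp add: 3)
    then show ?thesis
      unfolding set_lebesgue_integral_def real_scaleR_def eq by (simp add: X_def Y_def algebra_simps)
  qed
qed

lemma set_integral_mono_superset:
  fixes f :: "real \<Rightarrow> real"
  assumes "set_integrable lborel S f" "T \<in> sets lborel" "T \<subseteq> S" "\<And>x. x \<in> S \<Longrightarrow> 0 \<le> f x"
  shows "(LINT x:T|lborel. f x) \<le> (LINT x:S|lborel. f x)"
  unfolding set_lebesgue_integral_def
  using assms(1) set_integrable_subset[OF assms(1-3)] assms(3,4)
  by (intro integral_mono) (auto simp: set_integrable_def split: split_indicator)

text \<open>An integrable nonnegative function cannot dominate \<open>e / r\<close> on intervals
  with unbounded \<open>ln (y / x)\<close>. This is how radii with small boundary terms are found
  near 0 and near infinity.\<close>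

lemma set_integral_log_bound:
  fixes f :: "real \<Rightarrow> real"
  assumes S: "set_integrable lborel S f" "\<And>r. r \<in> S \<Longrightarrow> 0 \<le> f r"
    and x: "0 < x" "x \<le> y" "{x..y} \<subseteq> S" and e: "\<And>r. x \<le> r \<Longrightarrow> r \<le> y \<Longrightarrow> e / r \<le> f r"
  shows "e * ln (y / x) \<le> (LINT r:S|lborel. f r)"
proof -
  have c: "continuous_on {x..y} (\<lambda>r. e / r)" using x by (intro continuous_intros) auto
  have d: "((\<lambda>r. e * ln r) has_real_derivative e / r) (at r)" if "x \<le> r" "r \<le> y" for r
    using that x by (auto intro!: derivative_eq_intros)
  have "e * ln (y / x) = e * ln y - e * ln x" using x by (simp add: ln_div algebra_simps)
  also have "\<dots> = (LINT r:{x..y}|lborel. e / r)"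
    using set_integral_FTC(2)[OF x(2) d c] by simp
  also have "\<dots> \<le> (LINT r:{x..y}|lborel. f r)"
    using x e by (intro set_integral_mono set_integral_FTC(1)[OF x(2) d c] set_integrable_subset[OF S(1)]) auto
  also have "\<dots> \<le> (LINT r:S|lborel. f r)"
    by (rule set_integral_mono_superset[OF S(1) _ x(3) S(2)]) auto
  finally show ?thesis .
qed

text \<open>The estimate is uniform over all larger intervals, so that the endpoints can afterwards
  be moved to radii with small boundary terms. Exhausting the integral of
  \<open>\<bar>f\<bar>\<close> instead of \<open>f\<close> gives this uniformity.\<close>

lemma set_integral_exhaustion:
  fixes f :: "real \<Rightarrow> real"
  assumes f: "set_integrable lborel (dom0 R) f" and R: "0 < R" and e: "0 < e"
  shows "\<exists>a\<in>dom0 R. \<exists>b\<in>dom0 R. a < b \<and> (\<forall>x\<in>dom0 R. \<forall>y\<in>dom0 R. x \<le> a \<longrightarrow> b \<le> y \<longrightarrow>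
     \<bar>(LINT r:dom0 R|lborel. f r) - (LINT r:{x..y}|lborel. f r)\<bar> < e)"
proof -
  obtain u l :: "nat \<Rightarrow> real" where ul: "einterval 0 R = (\<Union>i. {l i .. u i})"
    "incseq u" "decseq l" "\<And>i. l i < u i" "\<And>i. 0 < ereal (l i)" "\<And>i. ereal (u i) < R"
    by (blast intro: einterval_Icc_approximation[OF R])
  let ?I = "LINT r:dom0 R|lborel. \<bar>f r\<bar>"
  have fa: "set_integrable lborel (dom0 R) (\<lambda>r. \<bar>f r\<bar>)" using f by (rule set_integrable_abs)
  have "(\<lambda>i. LINT r:{l i..u i}|lborel. \<bar>f r\<bar>) \<longlonglongrightarrow> (LINT r:(\<Union>i. {l i..u i})|lborel. \<bar>f r\<bar>)"
  proof (rule set_integral_cont_up)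
    show "incseq (\<lambda>i. {l i..u i})"
      using ul(2,3) by (auto simp: incseq_def decseq_def intro: order_trans)
    show "set_integrable lborel (\<Union>i. {l i..u i}) (\<lambda>r. \<bar>f r\<bar>)"
      using fa by (simp add: dom0_einterval flip: ul(1))
  qed auto
  then have "(\<lambda>i. LINT r:{l i..u i}|lborel. \<bar>f r\<bar>) \<longlonglongrightarrow> ?I"
    by (simp add: dom0_einterval flip: ul(1))
  then obtain i where i: "\<bar>(LINT r:{l i..u i}|lborel. \<bar>f r\<bar>) - ?I\<bar> < e"
    using e unfolding LIMSEQ_iff real_norm_def by blast
  have d: "l i \<in> dom0 R" "u i \<in> dom0 R"
    using ul(4,5,6)[of i] by (auto simp: dom0_def zero_ereal_def) (meson ereal_less(2) less_ereal.simps(1) less_trans)+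
  have "\<bar>(LINT r:dom0 R|lborel. f r) - (LINT r:{x..y}|lborel. f r)\<bar> < e"
    if xy: "x \<in> dom0 R" "y \<in> dom0 R" "x \<le> l i" "u i \<le> y" for x y
  proof -
    have sub: "{x..y} \<subseteq> dom0 R" using xy by (auto simp: dom0_def intro: le_less_trans[of _ "ereal y"])
    have fxy: "set_integrable lborel {x..y} f" by (rule set_integrable_subset[OF f _ sub]) auto
    have fd: "set_integrable lborel (dom0 R - {x..y}) f"
      by (rule set_integrable_subset[OF f]) (auto simp: dom0_einterval)
    have un: "dom0 R = (dom0 R - {x..y}) \<union> {x..y}" using sub by auto
    have 1: "(LINT r:dom0 R|lborel. g r) = (LINT r:(dom0 R - {x..y})|lborel. g r) + (LINT r:{x..y}|lborel. g r)"
      if "set_integrable lborel (dom0 R - {x..y}) g" "set_integrable lborel {x..y} g" for g :: "real \<Rightarrow> real"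
      by (subst un, rule set_integral_Un) (use that in auto)
    have "\<bar>(LINT r:dom0 R|lborel. f r) - (LINT r:{x..y}|lborel. f r)\<bar> = \<bar>LINT r:(dom0 R - {x..y})|lborel. f r\<bar>"
      using 1[OF fd fxy] by simp
    also have "\<dots> \<le> (LINT r:(dom0 R - {x..y})|lborel. \<bar>f r\<bar>)"
      using set_integral_norm_bound[OF fd] by simp
    also have "\<dots> = ?I - (LINT r:{x..y}|lborel. \<bar>f r\<bar>)"
      using 1[OF set_integrable_abs[OF fd] set_integrable_abs[OF fxy]] by simp
    also have "\<dots> \<le> ?I - (LINT r:{l i..u i}|lborel. \<bar>f r\<bar>)"
      using xy set_integral_mono_superset[OF set_integrable_abs[OF fxy], of "{l i..u i}"] by auto
    also have "\<dots> < e" using i by linarith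
    finally show ?thesis .
  qed
  then show ?thesis using d ul(4)[of i] by blast
qed

text \<open>For R = \<infinity> the mean value theorem on \<open>{r..r + 1}\<close> yields a point
  with derivative at most \<open>2 * M\<close>, and the flux changes by at most
  \<open>K * (r + 1)\<close> up to there; dividing by \<open>r\<close> leaves a bound. On a finite
  interval the flux is compared with its value at \<open>r0\<close>.\<close>

lemma flux_bound_imp_deriv_bounded:
  fixes f f' F :: "real \<Rightarrow> real"
  assumes R: "0 < R" and r0: "r0 \<in> dom0 R"
    and df: "\<And>r. r \<in> dom0 R \<Longrightarrow> (f has_real_derivative f' r) (at r)"
    and dd: "\<And>r. r \<in> dom0 R \<Longrightarrow> ((\<lambda>s. s * f' s) has_real_derivative F r) (at r)"
    and bd: "\<And>r. r \<in> dom0 R \<Longrightarrow> r0 \<le> r \<Longrightarrow> \<bar>F r\<bar> \<le> K * r \<and> \<bar>f r\<bar> \<le> M"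
  shows "\<exists>L. \<forall>r\<in>dom0 R. r0 \<le> r \<longrightarrow> \<bar>f' r\<bar> \<le> L"
proof -
  have r00: "0 < r0" using r0 by (simp add: dom0_def)
  have "0 \<le> K * r0" using bd[OF r0] by (meson abs_ge_zero order_refl order_trans)
  then have K0: "0 \<le> K" using r00 by (simp add: zero_le_mult_iff)
  have M0: "0 \<le> M" using bd[OF r0] by force
  have flux: "\<bar>y * f' y - x * f' x\<bar> \<le> (y - x) * (K * y)" if xy: "r0 \<le> x" "x \<le> y" "y \<in> dom0 R" for x y
  proof (cases "x = y")
    case False
    then have lt: "x < y" using xy by simp
    obtain w where w: "x < w" "w < y" "y * f' y - x * f' x = (y - x) * F w"
      using MVT2[OF lt, of "\<lambda>s. s * f' s" F] dd dom0_downward[OF xy(3)] xy r00 by force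
    have wd: "w \<in> dom0 R" using w xy r00 by (intro dom0_downward[OF xy(3)]) auto
    have "\<bar>F w\<bar> \<le> K * w" using bd[OF wd] w xy by auto
    also have "\<dots> \<le> K * y" using w K0 by (intro mult_left_mono) auto
    finally show ?thesis unfolding w(3) abs_mult using lt by (intro mult_mono) auto
  qed simp
  show ?thesis
  proof (cases rule: at_end_cases[OF R])
    case 1
    have "\<bar>f' r\<bar> \<le> (r0 + 1) / r0 * (2 * M + K * (r0 + 1) / r0)" if r: "r \<in> dom0 R" "r0 \<le> r" for r
    proof -
      have dom: "s \<in> dom0 R" if "r \<le> s" for s using that r r00 1 by (auto simp: dom0_def)
      have r0': "0 < r" using r r00 by simp
      obtain w where w: "r < w" "w < r + 1" "f (r + 1) - f r = (r + 1 - r) * f' w"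
        using MVT2[of r "r + 1" f f'] df dom by auto
      have fw: "\<bar>f' w\<bar> \<le> 2 * M" using w(3) bd[OF dom[of r]] bd[OF dom[of "r+1"]] r by auto
      have "\<bar>w * f' w - r * f' r\<bar> \<le> (w - r) * (K * w)" using w r dom by (intro flux) auto
      also have "\<dots> \<le> 1 * (K * (r + 1))" using w r0' K0 by (intro mult_mono) auto
      finally have "\<bar>r * f' r\<bar> \<le> \<bar>w * f' w\<bar> + K * (r + 1)" by linarith
      also have "\<bar>w * f' w\<bar> \<le> (r + 1) * (2 * M)"
        unfolding abs_mult using w fw r0' by (intro mult_mono) auto
      finally have "r * \<bar>f' r\<bar> \<le> (r + 1) * (2 * M + K)" using r0' by (simp add: abs_mult algebra_simps)
      then have "\<bar>f' r\<bar> \<le> (1 + 1 / r) * (2 * M + K)" using r0' by (simp add: field_simps)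
      also have "\<dots> \<le> (1 + 1 / r0) * (2 * M + K)"
        using r r00 M0 K0 by (intro mult_right_mono add_left_mono divide_left_mono) auto
      also have "\<dots> \<le> (1 + 1 / r0) * (2 * M + K * (r0 + 1) / r0)"
        using r00 K0 by (intro mult_left_mono add_left_mono) (auto simp: field_simps)
      finally show ?thesis using r00 by (simp add: field_simps)
    qed
    then show ?thesis by blast
  next
    case (2 y)
    have "\<bar>f' r\<bar> \<le> (r0 * \<bar>f' r0\<bar> + y * (K * y)) / r0" if r: "r \<in> dom0 R" "r0 \<le> r" for r
    proof -
      have ry: "r \<le> y" using r 2 by (auto simp: dom0_def)
      have "\<bar>r * f' r - r0 * f' r0\<bar> \<le> (r - r0) * (K * r)" by (rule flux[OF order_refl r(2,1)])
      also have "\<dots> \<le> y * (K * y)" using r ry r00 K0 by (intro mult_mono) auto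
      finally have "\<bar>r * f' r\<bar> \<le> \<bar>r0 * f' r0\<bar> + y * (K * y)" by linarith
      moreover have "r0 * \<bar>f' r\<bar> \<le> \<bar>r * f' r\<bar>" using r r00 by (auto simp: abs_mult intro: mult_right_mono)
      ultimately show ?thesis using r00 by (simp add: field_simps abs_mult)
    qed
    then show ?thesis by blast
  qed
qed

lemma primitive_continuous:
  fixes w w' :: "real \<Rightarrow> real"
  assumes "x \<le> y" and w: "\<And>t. x \<le> t \<Longrightarrow> t \<le> y \<Longrightarrow> (w' has_integral (w t - w x)) {x..t}"
  shows "continuous_on {x..y} w"
proof -
  have "continuous_on {x..y} (\<lambda>t. w x + integral {x..t} w')"
    using w[of y] assms(1) by (intro continuous_intros indefinite_integral_continuous_1) auto
  moreover have "w x + integral {x..t} w' = w t" if "t \<in> {x..y}" for t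
    using integral_unique[OF w[of t]] that by simp
  ultimately show ?thesis by (rule continuous_on_eq)
qed

text \<open>Picone's identity: \<open>w'\<^sup>2 - 2 w w' z'/z + w\<^sup>2 z'\<^sup>2/z\<^sup>2 = (w' - w z'/z)\<^sup>2\<close>.\<close>

lemma picone_inequality:
  fixes z z1 c w w' :: "real \<Rightarrow> real"
  assumes xy: "0 < x" "x \<le> y"
    and z: "\<And>r. x \<le> r \<Longrightarrow> r \<le> y \<Longrightarrow> z r \<noteq> 0"
    and dz: "\<And>r. x \<le> r \<Longrightarrow> r \<le> y \<Longrightarrow> (z has_real_derivative z1 r) (at r)"
    and ddz: "\<And>r. x \<le> r \<Longrightarrow> r \<le> y \<Longrightarrow> ((\<lambda>s. s * z1 s) has_real_derivative r * (c r * z r)) (at r)"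
    and c: "continuous_on {x..y} c" and z1: "continuous_on {x..y} z1"
    and w': "set_integrable lborel {x..y} w'" and w'2: "set_integrable lborel {x..y} (\<lambda>r. r * (w' r)^2)"
    and w: "\<And>t. x \<le> t \<Longrightarrow> t \<le> y \<Longrightarrow> (w' has_integral (w t - w x)) {x..t}"
  shows "set_integrable lborel {x..y} (\<lambda>r. ((w' r)^2 + c r * (w r)^2) * r)" (is ?int)
    and "y * (z1 y / z y) * (w y)^2 - x * (z1 x / z x) * (w x)^2
       \<le> (LINT r:{x..y}|lborel. ((w' r)^2 + c r * (w r)^2) * r)" (is ?le)
proof -
  \<comment> \<open>\<open>p\<close> is the flux of ln |z| and satisfies the Riccati equation
    \<open>p' = r * c - p^2 / r\<close>, which makes the derivative of \<open>w^2 * p\<close> at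
    most the integrand.\<close>
  define p where "p = (\<lambda>r. r * z1 r / z r)"
  define p' where "p' = (\<lambda>r. r * c r - r * (z1 r / z r)^2)"
  have dp: "(p has_real_derivative p' r) (at r)" if "x \<le> r" "r \<le> y" for r
    unfolding p_def
    by (rule DERIV_cong[OF DERIV_divide[OF ddz[OF that] dz[OF that] z[OF that]]])
      (use z[OF that] in \<open>simp add: p'_def field_simps power2_eq_square\<close>)
  have cz: "continuous_on {x..y} z"
    by (intro continuous_at_imp_continuous_on ballI) (use DERIV_isCont[OF dz] in auto)
  have cp': "continuous_on {x..y} p'"
    unfolding p'_def using c z1 cz z by (intro continuous_intros) auto
  have p: "p t = p x + (LINT s:{x..t}|lborel. p' s)" if "x \<le> t" "t \<le> y" for t
    using set_integral_FTC(2)[OF that(1), of p p'] dp that continuous_on_subset[OF cp', of "{x..t}"] by auto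
  have wl: "w t = w x + (LINT s:{x..t}|lborel. w' s)" if t: "x \<le> t" "t \<le> y" for t
  proof -
    have "set_integrable lborel {x..t} w'" using t by (intro set_integrable_subset[OF w']) auto
    then have "(LINT s:{x..t}|lborel. w' s) = integral {x..t} w'" by (rule set_borel_integral_eq_integral(2))
    then show ?thesis using integral_unique[OF w[OF t]] by simp
  qed
  have cw: "continuous_on {x..y} w" by (rule primitive_continuous[OF xy(2) w])
  \<comment> \<open>As \<open>w\<close> is merely absolutely continuous, the derivative of
    \<open>w^2 * p\<close> takes two uses of the Lebesgue product rule, for \<open>w * w\<close> and
    then for \<open>w2 * p\<close>.\<close>
  define w2 where "w2 = (\<lambda>t. w t * w t)"
  define w2' where "w2' = (\<lambda>t. w' t * w t + w t * w' t)"
  have sub: "set_integrable lborel {x..t} w'" if "t \<le> y" for t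
    using that by (intro set_integrable_subset[OF w']) auto
  have w2i: "set_integrable lborel {x..y} w2'"
    unfolding w2'_def using lebesgue_product_rule(1)[OF xy(2) w' w' wl wl] .
  have w2: "w2 t = w2 x + (LINT s:{x..t}|lborel. w2' s)" if t: "x \<le> t" "t \<le> y" for t
  proof -
    have wl': "w s = w x + (LINT s:{x..s}|lborel. w' s)" if "x \<le> s" "s \<le> t" for s
      using wl[of s] that t by simp
    show ?thesis
      using lebesgue_product_rule(2)[OF t(1) sub[OF t(2)] sub[OF t(2)] wl' wl'] by (simp add: w2_def w2'_def)
  qed
  have p'i: "set_integrable lborel {x..y} p'" by (rule borel_integrable_atLeastAtMost'[OF cp'])
  have prod_int: "set_integrable lborel {x..y} (\<lambda>t. w2' t * p t + w2 t * p' t)"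
    and prod: "(LINT t:{x..y}|lborel. w2' t * p t + w2 t * p' t) = w2 y * p y - w2 x * p x"
    using lebesgue_product_rule[OF xy(2) w2i p'i w2 p] by blast+
  have "set_integrable lborel {x..y} (\<lambda>r. c r * (w r)^2 * r)"
    by (intro borel_integrable_atLeastAtMost' continuous_intros c cw)
  from set_integral_add(1)[OF w'2 this] show ?int by (simp add: algebra_simps)
  have "w2 y * p y - w2 x * p x \<le> (LINT r:{x..y}|lborel. ((w' r)^2 + c r * (w r)^2) * r)"
    unfolding prod[symmetric]
  proof (rule set_integral_mono[OF prod_int \<open>?int\<close>])
    fix r assume r: "r \<in> {x..y}"
    then have zr: "z r \<noteq> 0" and r0: "0 < r" using z xy by auto
    have "((w' r)^2 + c r * (w r)^2) * r - (w2' r * p r + w2 r * p' r) = r * (w' r - w r * (z1 r / z r))^2"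
      using zr by (simp add: w2'_def w2_def p_def p'_def power2_eq_square algebra_simps)
    also have "\<dots> \<ge> 0" using r0 by simp
    finally show "w2' r * p r + w2 r * p' r \<le> ((w' r)^2 + c r * (w r)^2) * r" by simp
  qed
  then show ?le by (simp add: w2_def p_def power2_eq_square mult.commute)
qed

section \<open>Hardy decomposition of the second variation\<close>

context gl_params
begin

definition dens :: "real \<Rightarrow> real \<Rightarrow> real \<Rightarrow> real \<Rightarrow> real \<Rightarrow> real \<Rightarrow> real \<Rightarrow> real" where
  "dens r u v x x' y y' =
     (x'^2 + (real n)^2 / r^2 * x^2 + y'^2
      + (- A + 2 * B * v + C * (3 * u^2 + v^2)) * x^2
      + (- A - 2 * B * v + C * (u^2 + 3 * v^2)) * y^2
      + 4 * u * x * y * (B + C * v)) * r"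

text \<open>What remains of the zeroth order terms of \<open>dens\<close> after removing the
  potentials \<open>hh u v / u\<close> and \<open>gg u v / v\<close>. Those are the potentials for
  which \<open>u\<close> and \<open>v\<close> themselves solve the linear equations, so Picone's
  inequality applies to them with these two functions.\<close>

definition QQ :: "real \<Rightarrow> real \<Rightarrow> real \<Rightarrow> real \<Rightarrow> real" where
  "QQ u v x y = 2 * C * u^2 * x^2 + 4 * u * (B + C * v) * x * y
     + (2 * C * v^2 - B * v - B * u^2 / v) * y^2"

text \<open>The completed square in \<open>QQ_lower\<close> requires \<open>lam \<le> C\<close> and
  \<open>lam * (1 + 8 * q^2) \<le> 3 * B * q\<close>.\<close>

definition lam :: real where "lam = min C (3 * B * q / (1 + 8 * q^2))"

text \<open>For \<open>u\<close> and \<open>\<bar>v\<bar>\<close> up to \<open>2 * q\<close>,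
  \<open>16 * C * q^2\<close> bounds the C-part of either diagonal coefficient, and the remaining
  \<open>8 * C * q^2\<close> pays for the mixed term.\<close>

definition coeff_bound :: real where "coeff_bound = \<bar>A\<bar> + 4 * B * q + 24 * C * q^2"

lemma lam_pos: "0 < lam"
  unfolding lam_def using B C q by (auto intro!: divide_pos_pos add_pos_nonneg)

lemma coeff_bound_pos: "0 < coeff_bound"
  unfolding coeff_bound_def using B C q by (intro add_nonneg_pos add_nonneg_nonneg) auto

lemma dens_split:
  assumes "u \<noteq> 0" "v \<noteq> 0"
  shows "dens r u v x x' y y' = (x'^2 + ((real n)^2 / r^2 + hh u v / u) * x^2) * r
           + (y'^2 + gg u v / v * y^2) * r + QQ u v x y * r"
proof -
  have e1: "hh u v / u = - A + 2 * B * v + C * (u^2 + v^2)" using assms by (simp add: hh_def)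
  have e2: "gg u v / v = - A - B * v + C * (u^2 + v^2) + B * u^2 / v"
    using assms by (simp add: gg_def field_simps)
  show ?thesis unfolding dens_def QQ_def e1 e2 by (simp add: algebra_simps)
qed

lemma B_plus_Cv: "- (2 * q) \<le> v \<Longrightarrow> v \<le> - q \<Longrightarrow> \<bar>B + C * v\<bar> \<le> 2 * C * q"
  using mult_left_mono[of "- (2 * q)" v C] mult_left_mono[of v "- q" C] B C q BC
    mult_pos_pos[OF C q] by (auto simp: abs_le_iff)

text \<open>Completing the square gives \<open>2 * C * QQ = Z^2 + E * y^2\<close>, and
  \<open>v \<le> - q\<close> with \<open>B \<le> C * q\<close> gives
  \<open>E \<ge> 6 * C * B * q\<close>. The term \<open>u * x\<close> is recovered from
  \<open>Z\<close> and \<open>y\<close> because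
  \<open>\<bar>B + C * v\<bar> \<le> 2 * C * q\<close>.\<close>

lemma QQ_lower:
  assumes v: "- (2 * q) \<le> v" "v \<le> - q"
  shows "lam * (u^2 * x^2 + y^2) \<le> QQ u v x y"
proof -
  define Z where "Z = 2 * C * u * x + 2 * (B + C * v) * y"
  define E where "E = - 10 * C * B * v - 4 * B^2 + 2 * C * B * (u^2 / (- v))"
  have v0: "v \<noteq> 0" using v q by auto
  have Q: "2 * C * QQ u v x y = Z^2 + E * y^2"
    unfolding QQ_def Z_def E_def using v0 by (simp add: field_simps power2_eq_square)
  have "C * B * q \<le> C * B * (- v)" using v B C by (intro mult_left_mono) auto
  moreover have "B * B \<le> B * (C * q)" using BC B by (intro mult_left_mono) auto
  moreover have "0 \<le> 2 * C * B * (u^2 / (- v))" using v q B C by (intro mult_nonneg_nonneg divide_nonneg_pos) auto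
  ultimately have E: "6 * C * B * q \<le> E"
    unfolding E_def by (simp add: power2_eq_square algebra_simps)
  have "\<bar>B + C * v\<bar>^2 \<le> (2 * C * q)^2" using B_plus_Cv[OF v] by (intro power_mono) auto
  then have BCv: "(B + C * v)^2 \<le> 4 * C^2 * q^2" by (simp add: power_mult_distrib)
  have "4 * C^2 * (u^2 * x^2) = (Z - 2 * (B + C * v) * y)^2"
    unfolding Z_def by (simp add: power2_eq_square)
  also have "\<dots> \<le> 2 * Z^2 + 8 * ((B + C * v)^2 * y^2)"
    using zero_le_power2[of "Z + 2 * (B + C * v) * y"] by (simp add: power2_eq_square algebra_simps)
  also have "\<dots> \<le> 2 * Z^2 + 8 * ((4 * C^2 * q^2) * y^2)"
    using mult_right_mono[OF BCv zero_le_power2[of y]] by linarith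
  finally have "u^2 * x^2 \<le> Z^2 / (2 * C^2) + 8 * q^2 * y^2"
    using C by (simp add: field_simps)
  then have "lam * (u^2 * x^2 + y^2) \<le> lam * (Z^2 / (2 * C^2) + (1 + 8 * q^2) * y^2)"
    using lam_pos by (intro mult_left_mono) (auto simp: algebra_simps)
  also have "\<dots> = lam * (Z^2 / (2 * C^2)) + (lam * (1 + 8 * q^2)) * y^2" by (simp add: algebra_simps)
  also have "\<dots> \<le> C * (Z^2 / (2 * C^2)) + (3 * B * q) * y^2"
  proof (intro add_mono mult_right_mono)
    have "lam * (1 + 8 * q^2) \<le> (3 * B * q / (1 + 8 * q^2)) * (1 + 8 * q^2)"
      by (intro mult_right_mono) (auto simp: lam_def)
    also have "\<dots> = 3 * B * q" using zero_le_power2[of q] by (simp add: add_nonneg_eq_0_iff)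
    finally show "lam * (1 + 8 * q^2) \<le> 3 * B * q" .
  qed (auto simp: lam_def)
  also have "\<dots> = (Z^2 + (6 * C * B * q) * y^2) / (2 * C)" using C by (simp add: field_simps power2_eq_square)
  also have "\<dots> \<le> (Z^2 + E * y^2) / (2 * C)"
    using C mult_right_mono[OF E, of "y^2"] by (intro divide_right_mono) auto
  also have "\<dots> = QQ u v x y" using Q C by (simp add: field_simps)
  finally show ?thesis .
qed

lemma dens_potential_bound:
  assumes v: "- (2 * q) \<le> v" "v \<le> - q" and u: "0 \<le> u" "u \<le> 2 * q"
  shows "\<bar>(- A + 2 * B * v + C * (3 * u^2 + v^2)) * x^2
      + (- A - 2 * B * v + C * (u^2 + 3 * v^2)) * y^2
      + 4 * u * x * y * (B + C * v)\<bar> \<le> coeff_bound * (x^2 + y^2)"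
proof -
  have u2: "u^2 \<le> 4 * q^2" using power_mono[OF u(2,1), of 2] by (simp add: power_mult_distrib)
  have v2: "v^2 \<le> 4 * q^2" using power_mono[of "- v" "2 * q" 2] v q by (simp add: power_mult_distrib)
  have Bv: "\<bar>2 * B * v\<bar> \<le> 4 * B * q" using v q B mult_left_mono[of "- v" "2 * q" B] by (auto simp: abs_mult)
  have 1: "C * (3 * u^2 + v^2) \<le> C * (16 * q^2)" "C * (u^2 + 3 * v^2) \<le> C * (16 * q^2)"
    using u2 v2 C by (auto intro!: mult_left_mono)
  have 2: "0 \<le> C * (3 * u^2 + v^2)" "0 \<le> C * (u^2 + 3 * v^2)" using C by auto
  let ?k = "\<bar>A\<bar> + 4 * B * q + 16 * C * q^2"
  have a: "\<bar>- A + 2 * B * v + C * (3 * u^2 + v^2)\<bar> \<le> ?k" "\<bar>- A - 2 * B * v + C * (u^2 + 3 * v^2)\<bar> \<le> ?k"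
    using Bv 1 2 by linarith+
  have "\<bar>4 * u * x * y * (B + C * v)\<bar> = (2 * u * \<bar>B + C * v\<bar>) * (2 * \<bar>x * y\<bar>)"
    using u by (simp add: abs_mult)
  also have "\<dots> \<le> (2 * u * \<bar>B + C * v\<bar>) * (x^2 + y^2)"
    using u zero_le_power2[of "\<bar>x\<bar> - \<bar>y\<bar>"]
    by (intro mult_left_mono) (auto simp: abs_mult power2_diff)
  finally have b: "\<bar>4 * u * x * y * (B + C * v)\<bar> \<le> (2 * u * \<bar>B + C * v\<bar>) * (x^2 + y^2)" .
  have "u * \<bar>B + C * v\<bar> \<le> (2 * q) * (2 * C * q)"
    using u B_plus_Cv[OF v] q by (intro mult_mono) auto
  then have "2 * u * \<bar>B + C * v\<bar> \<le> 8 * C * q^2" by (simp add: power2_eq_square mult_ac)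
  then have "(2 * u * \<bar>B + C * v\<bar>) * (x^2 + y^2) \<le> (8 * C * q^2) * (x^2 + y^2)"
    by (intro mult_right_mono) auto
  with b have c: "\<bar>4 * u * x * y * (B + C * v)\<bar> \<le> (8 * C * q^2) * (x^2 + y^2)" by linarith
  have "\<bar>(- A + 2 * B * v + C * (3 * u^2 + v^2)) * x^2\<bar> \<le> ?k * x^2"
    "\<bar>(- A - 2 * B * v + C * (u^2 + 3 * v^2)) * y^2\<bar> \<le> ?k * y^2"
    using mult_right_mono[OF a(1), of "x^2"] mult_right_mono[OF a(2), of "y^2"] by (simp_all add: abs_mult)
  then have "\<bar>(- A + 2 * B * v + C * (3 * u^2 + v^2)) * x^2
      + (- A - 2 * B * v + C * (u^2 + 3 * v^2)) * y^2
      + 4 * u * x * y * (B + C * v)\<bar> \<le> ?k * x^2 + ?k * y^2 + (8 * C * q^2) * (x^2 + y^2)"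
    using c by linarith
  also have "\<dots> = coeff_bound * (x^2 + y^2)" by (simp add: coeff_bound_def algebra_simps)
  finally show ?thesis .
qed

text \<open>The complement of \<open>QQ_lower\<close>: near the origin, where the weight
  \<open>u^2\<close> degenerates, the centrifugal term dominates everything of zeroth order in
  \<open>x\<close>.\<close>

lemma dens_lower:
  assumes "- (2 * q) \<le> v" "v \<le> - q" "0 \<le> u" "u \<le> 2 * q" "0 < r"
  shows "(((real n)^2 / r^2 - coeff_bound) * x^2 - coeff_bound * y^2) * r \<le> dens r u v x x' y y'"
proof -
  have "- (coeff_bound * (x^2 + y^2)) \<le> (- A + 2 * B * v + C * (3 * u^2 + v^2)) * x^2
      + (- A - 2 * B * v + C * (u^2 + 3 * v^2)) * y^2 + 4 * u * x * y * (B + C * v)"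
    using dens_potential_bound[OF assms(1-4), of x y] by linarith
  then have "((real n)^2 / r^2 - coeff_bound) * x^2 - coeff_bound * y^2
    \<le> x'^2 + (real n)^2 / r^2 * x^2 + y'^2 + (- A + 2 * B * v + C * (3 * u^2 + v^2)) * x^2
      + (- A - 2 * B * v + C * (u^2 + 3 * v^2)) * y^2 + 4 * u * x * y * (B + C * v)"
    unfolding left_diff_distrib distrib_left using zero_le_power2[of x'] zero_le_power2[of y'] by linarith
  then show ?thesis unfolding dens_def using assms(5) by (intro mult_right_mono) auto
qed

text \<open>The five terms on the right are exactly those whose integrability follows from
  \<open>hatX\<close>.\<close>

lemma dens_bound:
  assumes "- (2 * q) \<le> v" "v \<le> - q" "0 \<le> u" "u \<le> 2 * q" "0 < r"
  shows "\<bar>dens r u v x x' y y'\<bar>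
    \<le> (1 + (real n)^2 + coeff_bound) * (r * x'^2 + r * y'^2 + x^2 / r + r * x^2 + r * y^2)"
proof -
  define P where "P = (- A + 2 * B * v + C * (3 * u^2 + v^2)) * x^2
      + (- A - 2 * B * v + C * (u^2 + 3 * v^2)) * y^2 + 4 * u * x * y * (B + C * v)"
  have P: "\<bar>P\<bar> * r \<le> (coeff_bound * (x^2 + y^2)) * r"
    unfolding P_def using dens_potential_bound[OF assms(1-4), of x y] assms(5) by (intro mult_right_mono) auto
  have d: "dens r u v x x' y y' = r * x'^2 + r * y'^2 + (real n)^2 * (x^2 / r) + P * r"
    unfolding dens_def P_def using assms(5) by (simp add: field_simps power2_eq_square)
  define S where "S = r * x'^2 + r * y'^2 + x^2 / r + r * x^2 + r * y^2"
  have nn: "0 \<le> r * x'^2" "0 \<le> r * y'^2" "0 \<le> x^2 / r" "0 \<le> r * x^2" "0 \<le> r * y^2" using assms(5) by auto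
  have "\<bar>dens r u v x x' y y'\<bar> \<le> (r * x'^2 + r * y'^2) + (real n)^2 * (x^2 / r) + \<bar>P\<bar> * r"
  proof -
    have "0 \<le> (real n)^2 * (x^2 / r)" using nn by (intro mult_nonneg_nonneg) auto
    moreover have "\<bar>P * r\<bar> = \<bar>P\<bar> * r" using assms(5) by (simp add: abs_mult)
    ultimately show ?thesis unfolding d using nn by linarith
  qed
  also have "\<dots> \<le> S + (real n)^2 * S + coeff_bound * S"
  proof (intro add_mono)
    show "r * x'^2 + r * y'^2 \<le> S" unfolding S_def using nn by linarith
    show "(real n)^2 * (x^2 / r) \<le> (real n)^2 * S" unfolding S_def using nn by (intro mult_left_mono) auto
    have "coeff_bound * (r * x^2 + r * y^2) \<le> coeff_bound * S"
      unfolding S_def using nn coeff_bound_pos by (intro mult_left_mono) auto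
    then show "\<bar>P\<bar> * r \<le> coeff_bound * S" using P by (simp add: algebra_simps)
  qed
  finally show ?thesis by (simp add: S_def algebra_simps)
qed

end

lemma dom0_Icc: "y \<in> dom0 R \<Longrightarrow> 0 < x \<Longrightarrow> x \<le> r \<Longrightarrow> r \<le> y \<Longrightarrow> r \<in> dom0 R"
  by (auto intro: dom0_downward)

context gl_sol
begin

text \<open>In the variable ln r the equation gives u'' \<ge> u / 4 with u' \<ge> 0, so the energy
  \<open>E\<close> is nondecreasing. It vanishes at the origin, hence
  \<open>r * u1 \<ge> u / 2\<close> and \<open>u^2 / r\<close> is nondecreasing. This crude rate is
  what makes the centrifugal energy integrable.\<close>

lemma u2_le_linear: "\<exists>d\<in>dom0 R. \<exists>K. \<forall>r. 0 < r \<longrightarrow> r \<le> d \<longrightarrow> (u r)^2 \<le> K * r"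
proof -
  obtain d where d: "d \<in> dom0 R" and near: "\<And>r. 0 < r \<Longrightarrow> r \<le> d \<Longrightarrow> 0 \<le> r * u1 r \<and> r * u1 r \<le> (real n + 1) * u r \<and>
        u r / 4 \<le> (real n)^2 * u r + r * (r * hh (u r) (v r))"
    using flux_u_near_0 by blast
  have d0: "0 < d" using d by (simp add: dom0_def)
  have dom: "r \<in> dom0 R" if "0 < r" "r \<le> d" for r using dom0_downward[OF d] that by blast
  define E where "E = (\<lambda>r. (r * u1 r)^2 - (u r)^2 / 4)"
  have E_mono: "E s \<le> E r" if s: "0 < s" "s \<le> r" "r \<le> d" for s r
  proof (rule DERIV_nonneg_imp_nondecreasing[OF s(2)])
    fix t assume t: "s \<le> t" "t \<le> r"
    then have t': "0 < t" "t \<le> d" using s by auto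
    have D: "(E has_real_derivative
        2 * (t * u1 t) * ((real n)^2 * u t / t + t * hh (u t) (v t)) - 2 * u t * u1 t / 4) (at t)"
      unfolding E_def
      by (rule DERIV_cong[OF DERIV_diff[OF DERIV_power[OF flux_u[OF dom[OF t']], of 2] DERIV_cdivide[OF DERIV_power[OF du[OF dom[OF t']], of 2], of 4]]]) simp
    have "2 * (t * u1 t) * ((real n)^2 * u t / t + t * hh (u t) (v t)) - 2 * u t * u1 t / 4
        = 2 * u1 t * (((real n)^2 * u t + t * (t * hh (u t) (v t))) - u t / 4)"
      using t' by (simp add: field_simps)
    also have "\<dots> \<ge> 0"
    proof (rule mult_nonneg_nonneg)
      show "0 \<le> 2 * u1 t" using near[OF t'] t' by (simp add: zero_le_mult_iff)
    qed (use near[OF t'] in auto)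
    finally show "\<exists>y. (E has_real_derivative y) (at t) \<and> 0 \<le> y" using D by blast
  qed
  have E_lim: "(E \<longlongrightarrow> 0) (at_right 0)"
    unfolding E_def using tendsto_diff[OF tendsto_power[OF flux_u_tendsto_0, of 2] tendsto_divide[OF tendsto_power[OF u0, of 2] tendsto_const, of 4]]
    by simp
  have E_nonneg: "0 \<le> E r" if r: "0 < r" "r \<le> d" for r
  proof (rule tendsto_upperbound[OF E_lim])
    show "eventually (\<lambda>s. E s \<le> E r) (at_right 0)"
      using eventually_dom0_right_0[OF dom[OF r]] by eventually_elim (use E_mono r in auto)
  qed simp
  have "(u r)^2 / r \<le> (u d)^2 / d" if r: "0 < r" "r \<le> d" for r
  proof (rule DERIV_nonneg_imp_nondecreasing[OF r(2)])
    fix t assume t: "r \<le> t" "t \<le> d"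
    then have t': "0 < t" "t \<le> d" using r by auto
    have "(u t / 2)^2 \<le> (t * u1 t)^2" using E_nonneg[OF t'] by (simp add: E_def power_divide)
    then have "u t / 2 \<le> t * u1 t" by (rule power2_le_imp_le) (rule conjunct1[OF near[OF t']])
    then have "0 \<le> 2 * u t * (t * u1 t - u t / 2) / t^2"
      using upos[OF dom[OF t']] by (intro divide_nonneg_nonneg mult_nonneg_nonneg) auto
    moreover have "((\<lambda>r. (u r)^2 / r) has_real_derivative 2 * u t * (t * u1 t - u t / 2) / t^2) (at t)"
      by (rule DERIV_cong[OF DERIV_divide[OF DERIV_power[OF du[OF dom[OF t']], of 2] DERIV_ident]])
        (use t' in \<open>simp_all add: field_simps power2_eq_square\<close>)
    ultimately show "\<exists>y. ((\<lambda>r. (u r)^2 / r) has_real_derivative y) (at t) \<and> 0 \<le> y" by blast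
  qed
  then have "(u r)^2 \<le> (u d)^2 / d * r" if "0 < r" "r \<le> d" for r
    using that by (simp add: field_simps)
  then show ?thesis using d by blast
qed

text \<open>The flux starts from 0 at the origin and has derivative \<open>r * gg\<close> with
  \<open>gg\<close> bounded, so it is of order r^2.\<close>

lemma v1_le_linear: "\<exists>K>0. \<forall>r\<in>dom0 R. \<bar>v1 r\<bar> \<le> K * r"
proof -
  obtain K where K: "0 < K" "\<And>r. r \<in> dom0 R \<Longrightarrow> \<bar>hh (u r) (v r)\<bar> \<le> K \<and> \<bar>gg (u r) (v r)\<bar> \<le> K"
    using hh_bound by blast
  have "\<bar>v1 r\<bar> \<le> K * r" if r: "r \<in> dom0 R" for r
  proof -
    have r0: "0 < r" using r by (simp add: dom0_def)
    have step: "\<bar>r * v1 r - s * v1 s\<bar> \<le> r * (r * K)" if s: "0 < s" "s < r" for s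
    proof -
      have "\<And>t. s \<le> t \<Longrightarrow> t \<le> r \<Longrightarrow> ((\<lambda>s. s * v1 s) has_real_derivative t * gg (u t) (v t)) (at t)"
        using s by (intro flux_v dom0_Icc[OF r s(1)])
      then obtain w where w: "s < w" "w < r" "r * v1 r - s * v1 s = (r - s) * (w * gg (u w) (v w))"
        using MVT2[OF s(2), of "\<lambda>s. s * v1 s" "\<lambda>t. t * gg (u t) (v t)"] by blast
      have "w \<in> dom0 R" using w s by (intro dom0_Icc[OF r s(1)]) auto
      then have "\<bar>gg (u w) (v w)\<bar> \<le> K" using K by blast
      then show ?thesis unfolding w(3) abs_mult using w s by (intro mult_mono) auto
    qed
    have "\<bar>r * v1 r - 0\<bar> \<le> r * (r * K)"
    proof (rule tendsto_upperbound)
      show "((\<lambda>s. \<bar>r * v1 r - s * v1 s\<bar>) \<longlongrightarrow> \<bar>r * v1 r - 0\<bar>) (at_right 0)"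
        by (intro tendsto_intros flux_v_tendsto_0)
      show "eventually (\<lambda>s. \<bar>r * v1 r - s * v1 s\<bar> \<le> r * (r * K)) (at_right 0)"
        using eventually_dom0_right_0[OF r] by eventually_elim (use step in auto)
    qed simp
    then show ?thesis using r0 by (simp add: abs_mult mult.commute)
  qed
  then show ?thesis using K by blast
qed

lemma deriv_bounded:
  assumes r0: "r0 \<in> dom0 R"
  shows "\<exists>L>0. \<forall>r\<in>dom0 R. r0 \<le> r \<longrightarrow> \<bar>u1 r\<bar> \<le> L \<and> \<bar>v1 r\<bar> \<le> L"
proof -
  obtain K where K: "0 < K" "\<And>r. r \<in> dom0 R \<Longrightarrow> \<bar>hh (u r) (v r)\<bar> \<le> K \<and> \<bar>gg (u r) (v r)\<bar> \<le> K"
    using hh_bound by blast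
  have r00: "0 < r0" using r0 by (simp add: dom0_def)
  have "\<exists>L. \<forall>r\<in>dom0 R. r0 \<le> r \<longrightarrow> \<bar>u1 r\<bar> \<le> L"
  proof (rule flux_bound_imp_deriv_bounded[OF R r0 du flux_u])
    fix r assume r: "r \<in> dom0 R" "r0 \<le> r"
    have "(real n)^2 * u r / r \<le> (real n)^2 * (2 * q) / r0^2 * r"
    proof -
      have "(real n)^2 * u r * r0^2 \<le> (real n)^2 * (2 * q) * r^2"
        using u_le[OF r(1)] upos[OF r(1)] r r00 q by (intro mult_mono power_mono) auto
      then show ?thesis using r r00 by (simp add: field_simps power2_eq_square)
    qed
    moreover have "0 \<le> (real n)^2 * u r / r" using upos[OF r(1)] r r00 by simp
    moreover have "\<bar>r * hh (u r) (v r)\<bar> \<le> K * r" using K(2)[OF r(1)] r r00 by (simp add: abs_mult mult.commute)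
    ultimately have "\<bar>(real n)^2 * u r / r + r * hh (u r) (v r)\<bar> \<le> ((real n)^2 * (2 * q) / r0^2 + K) * r"
      unfolding ring_distribs by linarith
    then show "\<bar>(real n)^2 * u r / r + r * hh (u r) (v r)\<bar> \<le> ((real n)^2 * (2 * q) / r0^2 + K) * r \<and> \<bar>u r\<bar> \<le> 2 * q"
      using u_le[OF r(1)] upos[OF r(1)] by auto
  qed
  moreover have "\<exists>L. \<forall>r\<in>dom0 R. r0 \<le> r \<longrightarrow> \<bar>v1 r\<bar> \<le> L"
  proof (rule flux_bound_imp_deriv_bounded[OF R r0 dv flux_v])
    fix r assume r: "r \<in> dom0 R" "r0 \<le> r"
    then show "\<bar>r * gg (u r) (v r)\<bar> \<le> K * r \<and> \<bar>v r\<bar> \<le> 2 * q"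
      using K(2)[OF r(1)] r r00 v_ge[OF r(1)] vneg[OF r(1)] by (simp add: abs_mult mult.commute)
  qed
  ultimately obtain L1 L2 where L: "\<forall>r\<in>dom0 R. r0 \<le> r \<longrightarrow> \<bar>u1 r\<bar> \<le> L1" "\<forall>r\<in>dom0 R. r0 \<le> r \<longrightarrow> \<bar>v1 r\<bar> \<le> L2"
    by blast
  then show ?thesis by (intro exI[of _ "max (max L1 L2) 1"]) (auto simp: le_max_iff_disj)
qed

text \<open>Near the end \<open>u\<close> exceeds \<open>q\<close>, as its limit is
  \<open>sqrt 3 * q\<close>; the remaining piece is compact.\<close>

lemma u_bounded_below:
  assumes r0: "r0 \<in> dom0 R"
  shows "\<exists>m>0. \<forall>r\<in>dom0 R. r0 \<le> r \<longrightarrow> m \<le> u r"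
proof -
  have "q < sqrt 3 * q" using q by simp
  then have "eventually (\<lambda>r. q < u r) (at_end R)" using order_tendstoD(1)[OF uR] by blast
  from eventually_at_endD[OF this R] obtain x where x: "x \<in> dom0 R" "\<And>r. r \<in> dom0 R \<Longrightarrow> x \<le> r \<Longrightarrow> q < u r"
    by blast
  have r00: "0 < r0" using r0 by (simp add: dom0_def)
  have sub: "{r0..max r0 x} \<subseteq> dom0 R"
    using r0 x r00 by (auto intro: dom0_downward simp: max_def split: if_splits)
  obtain s where s: "s \<in> {r0..max r0 x}" "\<And>t. t \<in> {r0..max r0 x} \<Longrightarrow> u s \<le> u t"
    using continuous_attains_inf[of "{r0..max r0 x}" u] continuous_on_subset[OF cont_u sub] by auto
  show ?thesis
  proof (intro exI[of _ "min q (u s)"] conjI ballI impI)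
    show "0 < min q (u s)" using q upos s sub by auto
    show "min q (u s) \<le> u r" if "r \<in> dom0 R" "r0 \<le> r" for r
      using x(2)[of r] s(2)[of r] that by (cases "x \<le> r") auto
  qed
qed

text \<open>The boundary terms left by Picone's inequality for the pairs (\<xi>, u) and (\<eta>,
  v).\<close>

definition bdry :: "(real \<Rightarrow> real) \<Rightarrow> (real \<Rightarrow> real) \<Rightarrow> real \<Rightarrow> real" where
  "bdry \<xi> \<eta> r = r * (u1 r / u r) * (\<xi> r)^2 + r * (v1 r / v r) * (\<eta> r)^2"

text \<open>The bound is \<open>r\<close> times \<xi>^2 / r + r \<eta>^2, an integrable function on
  the perturbation space; hence the boundary term cannot stay away from 0 near the origin.\<close>

lemma bdry_near_0:
  "\<exists>d\<in>dom0 R. \<exists>K>0. \<forall>r. 0 < r \<longrightarrow> r \<le> d \<longrightarrow> (\<forall>\<xi> \<eta>. \<bar>bdry \<xi> \<eta> r\<bar> \<le> K * ((\<xi> r)^2 + r^2 * (\<eta> r)^2))"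
proof -
  obtain d where d: "d \<in> dom0 R" and near: "\<And>r. 0 < r \<Longrightarrow> r \<le> d \<Longrightarrow> 0 \<le> r * u1 r \<and> r * u1 r \<le> (real n + 1) * u r"
    using flux_u_near_0 by blast
  obtain K where K: "0 < K" "\<And>r. r \<in> dom0 R \<Longrightarrow> \<bar>v1 r\<bar> \<le> K * r" using v1_le_linear by blast
  let ?K = "real n + 1 + K / q"
  have "\<bar>bdry \<xi> \<eta> r\<bar> \<le> ?K * ((\<xi> r)^2 + r^2 * (\<eta> r)^2)" if r: "0 < r" "r \<le> d" for r \<xi> \<eta>
  proof -
    have rd: "r \<in> dom0 R" using dom0_downward[OF d r] .
    have "\<bar>r * (u1 r / u r)\<bar> \<le> real n + 1" using near[OF r] upos[OF rd] by (simp add: field_simps)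
    then have 1: "\<bar>r * (u1 r / u r) * (\<xi> r)^2\<bar> \<le> (real n + 1) * (\<xi> r)^2"
      unfolding abs_mult[of "r * (u1 r / u r)"] abs_power2 by (rule mult_right_mono) simp
    have "\<bar>v1 r / v r\<bar> \<le> (K * r) / q"
      unfolding abs_divide using K(2)[OF rd] v_le[OF rd] q by (intro frac_le) auto
    then have "\<bar>r * (v1 r / v r)\<bar> \<le> r * ((K * r) / q)" unfolding abs_mult using r by (intro mult_mono) auto
    then have "\<bar>r * (v1 r / v r) * (\<eta> r)^2\<bar> \<le> r * ((K * r) / q) * (\<eta> r)^2"
      unfolding abs_mult[of "r * (v1 r / v r)"] abs_power2 by (rule mult_right_mono) simp
    also have "\<dots> = (K / q) * (r^2 * (\<eta> r)^2)" by (simp add: power2_eq_square)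
    finally have 2: "\<bar>r * (v1 r / v r) * (\<eta> r)^2\<bar> \<le> (K / q) * (r^2 * (\<eta> r)^2)" .
    have "0 \<le> (K / q) * (\<xi> r)^2" "0 \<le> (real n + 1) * (r^2 * (\<eta> r)^2)" using K(1) q by auto
    then have "(real n + 1) * (\<xi> r)^2 + (K / q) * (r^2 * (\<eta> r)^2) \<le> ?K * ((\<xi> r)^2 + r^2 * (\<eta> r)^2)"
      unfolding distrib_left distrib_right[of "real n + 1"] by linarith
    then show ?thesis unfolding bdry_def using 1 2 by linarith
  qed
  moreover have "0 < ?K" using K(1) q n by (intro add_pos_pos divide_pos_pos) auto
  ultimately show ?thesis using d by blast
qed

lemma bdry_near_end:
  assumes r0: "r0 \<in> dom0 R"
  shows "\<exists>K>0. \<forall>r\<in>dom0 R. r0 \<le> r \<longrightarrow> (\<forall>\<xi> \<eta>. \<bar>bdry \<xi> \<eta> r\<bar> \<le> K * (r * ((\<xi> r)^2 + (\<eta> r)^2)))"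
proof -
  obtain L where L: "0 < L" "\<And>r. r \<in> dom0 R \<Longrightarrow> r0 \<le> r \<Longrightarrow> \<bar>u1 r\<bar> \<le> L \<and> \<bar>v1 r\<bar> \<le> L"
    using deriv_bounded[OF r0] by blast
  obtain m where m: "0 < m" "\<And>r. r \<in> dom0 R \<Longrightarrow> r0 \<le> r \<Longrightarrow> m \<le> u r"
    using u_bounded_below[OF r0] by blast
  let ?K = "L / m + L / q"
  have "\<bar>bdry \<xi> \<eta> r\<bar> \<le> ?K * (r * ((\<xi> r)^2 + (\<eta> r)^2))" if r: "r \<in> dom0 R" "r0 \<le> r" for r \<xi> \<eta>
  proof -
    have rp: "0 < r" using r by (simp add: dom0_def)
    have "\<bar>u1 r / u r\<bar> \<le> L / m"
      unfolding abs_divide using L m m(2)[OF r] L(2)[OF r] by (intro frac_le) auto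
    moreover have "\<bar>v1 r / v r\<bar> \<le> L / q"
      unfolding abs_divide using L q v_le[OF r(1)] L(2)[OF r] by (intro frac_le) auto
    moreover have "0 \<le> L / m" "0 \<le> L / q" using L m q by auto
    ultimately have k: "\<bar>u1 r / u r\<bar> \<le> ?K" "\<bar>v1 r / v r\<bar> \<le> ?K" by linarith+
    then have "\<bar>u1 r / u r\<bar> * (r * (\<xi> r)^2) \<le> ?K * (r * (\<xi> r)^2)" "\<bar>v1 r / v r\<bar> * (r * (\<eta> r)^2) \<le> ?K * (r * (\<eta> r)^2)"
      using rp by (intro mult_right_mono[OF k(1)] mult_right_mono[OF k(2)]; simp)+
    moreover have "\<bar>bdry \<xi> \<eta> r\<bar> \<le> \<bar>u1 r / u r\<bar> * (r * (\<xi> r)^2) + \<bar>v1 r / v r\<bar> * (r * (\<eta> r)^2)"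
      unfolding bdry_def by (rule order_trans[OF abs_triangle_ineq]) (use rp in \<open>simp add: abs_mult mult_ac\<close>)
    ultimately show ?thesis by (simp add: ring_distribs)
  qed
  moreover have "0 < ?K" using L m q by (intro add_pos_pos divide_pos_pos) auto
  ultimately show ?thesis by blast
qed

text \<open>Picone's inequality with the positive \<open>u\<close> and the negative \<open>v\<close>
  takes the place of the substitution by quotients, and \<open>QQ_lower\<close> estimates the
  rest.\<close>

lemma hardy_interval:
  assumes x: "0 < x" "x \<le> y" and y: "y \<in> dom0 R"
    and \<xi>': "set_integrable lborel {x..y} \<xi>'" "set_integrable lborel {x..y} (\<lambda>r. r * (\<xi>' r)^2)"
    and \<xi>: "\<And>t. x \<le> t \<Longrightarrow> t \<le> y \<Longrightarrow> (\<xi>' has_integral (\<xi> t - \<xi> x)) {x..t}"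
    and \<eta>': "set_integrable lborel {x..y} \<eta>'" "set_integrable lborel {x..y} (\<lambda>r. r * (\<eta>' r)^2)"
    and \<eta>: "\<And>t. x \<le> t \<Longrightarrow> t \<le> y \<Longrightarrow> (\<eta>' has_integral (\<eta> t - \<eta> x)) {x..t}"
  shows "set_integrable lborel {x..y} (\<lambda>r. dens r (u r) (v r) (\<xi> r) (\<xi>' r) (\<eta> r) (\<eta>' r))" (is ?int)
    and "bdry \<xi> \<eta> y - bdry \<xi> \<eta> x + (LINT r:{x..y}|lborel. lam * ((u r)^2 * (\<xi> r)^2 + (\<eta> r)^2) * r)
      \<le> (LINT r:{x..y}|lborel. dens r (u r) (v r) (\<xi> r) (\<xi>' r) (\<eta> r) (\<eta>' r))" (is ?le)
proof -
  have dom: "r \<in> dom0 R" if "x \<le> r" "r \<le> y" for r using dom0_Icc[OF y x(1)] that by blast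
  have sub: "{x..y} \<subseteq> dom0 R" using dom by auto
  note cs = continuous_on_subset[OF _ sub]
  have cu: "continuous_on {x..y} u" "continuous_on {x..y} v" "continuous_on {x..y} u1" "continuous_on {x..y} v1"
    by (auto intro!: cs cont_u cont_v cont_u1 cont_v1)
  have nz: "u r \<noteq> 0" "v r \<noteq> 0" "r \<noteq> 0" if "r \<in> {x..y}" for r
    using upos[of r] vneg[of r] dom[of r] that x by auto
  have c\<xi>: "continuous_on {x..y} \<xi>" and c\<eta>: "continuous_on {x..y} \<eta>"
    using primitive_continuous[OF x(2) \<xi>] primitive_continuous[OF x(2) \<eta>] by blast+
  let ?cu = "\<lambda>r. (real n)^2 / r^2 + hh (u r) (v r) / u r"
  let ?cv = "\<lambda>r. gg (u r) (v r) / v r"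
  have P1: "set_integrable lborel {x..y} (\<lambda>r. ((\<xi>' r)^2 + ?cu r * (\<xi> r)^2) * r)"
    "y * (u1 y / u y) * (\<xi> y)^2 - x * (u1 x / u x) * (\<xi> x)^2 \<le> (LINT r:{x..y}|lborel. ((\<xi>' r)^2 + ?cu r * (\<xi> r)^2) * r)"
  proof -
    have c: "continuous_on {x..y} ?cu"
      unfolding hh_def using nz by (intro continuous_intros cu) auto
    have f: "((\<lambda>s. s * u1 s) has_real_derivative r * (?cu r * u r)) (at r)" if "x \<le> r" "r \<le> y" for r
      by (rule DERIV_cong[OF flux_u[OF dom[OF that]]])
        (use nz[of r] that in \<open>simp add: field_simps power2_eq_square\<close>)
    show "set_integrable lborel {x..y} (\<lambda>r. ((\<xi>' r)^2 + ?cu r * (\<xi> r)^2) * r)"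
      "y * (u1 y / u y) * (\<xi> y)^2 - x * (u1 x / u x) * (\<xi> x)^2 \<le> (LINT r:{x..y}|lborel. ((\<xi>' r)^2 + ?cu r * (\<xi> r)^2) * r)"
      using picone_inequality[OF x _ du[OF dom] f c cu(3) \<xi>' \<xi>] nz by auto
  qed
  have P2: "set_integrable lborel {x..y} (\<lambda>r. ((\<eta>' r)^2 + ?cv r * (\<eta> r)^2) * r)"
    "y * (v1 y / v y) * (\<eta> y)^2 - x * (v1 x / v x) * (\<eta> x)^2 \<le> (LINT r:{x..y}|lborel. ((\<eta>' r)^2 + ?cv r * (\<eta> r)^2) * r)"
  proof -
    have c: "continuous_on {x..y} ?cv"
      unfolding gg_def using nz by (intro continuous_intros cu) auto
    have f: "((\<lambda>s. s * v1 s) has_real_derivative r * (?cv r * v r)) (at r)" if "x \<le> r" "r \<le> y" for r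
      by (rule DERIV_cong[OF flux_v[OF dom[OF that]]]) (use nz[of r] that in simp)
    show "set_integrable lborel {x..y} (\<lambda>r. ((\<eta>' r)^2 + ?cv r * (\<eta> r)^2) * r)"
      "y * (v1 y / v y) * (\<eta> y)^2 - x * (v1 x / v x) * (\<eta> x)^2 \<le> (LINT r:{x..y}|lborel. ((\<eta>' r)^2 + ?cv r * (\<eta> r)^2) * r)"
      using picone_inequality[OF x _ dv[OF dom] f c cu(4) \<eta>' \<eta>] nz by auto
  qed
  have P3: "set_integrable lborel {x..y} (\<lambda>r. QQ (u r) (v r) (\<xi> r) (\<eta> r) * r)"
    unfolding QQ_def using nz by (intro borel_integrable_atLeastAtMost' continuous_intros cu c\<xi> c\<eta>) auto
  have P4: "set_integrable lborel {x..y} (\<lambda>r. lam * ((u r)^2 * (\<xi> r)^2 + (\<eta> r)^2) * r)"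
    by (intro borel_integrable_atLeastAtMost' continuous_intros cu c\<xi> c\<eta>)
  have eq: "dens r (u r) (v r) (\<xi> r) (\<xi>' r) (\<eta> r) (\<eta>' r)
     = ((\<xi>' r)^2 + ?cu r * (\<xi> r)^2) * r + ((\<eta>' r)^2 + ?cv r * (\<eta> r)^2) * r + QQ (u r) (v r) (\<xi> r) (\<eta> r) * r"
    if "r \<in> {x..y}" for r
    by (rule dens_split) (use nz[OF that] in auto)
  note I = set_integral_add(1)[OF set_integral_add(1)[OF P1(1) P2(1)] P3]
  show ?int using I by (rule set_integrable_cong[THEN iffD2, rotated -1]) (use eq in auto)
  have "(LINT r:{x..y}|lborel. dens r (u r) (v r) (\<xi> r) (\<xi>' r) (\<eta> r) (\<eta>' r)) =
    (LINT r:{x..y}|lborel. ((\<xi>' r)^2 + ?cu r * (\<xi> r)^2) * r + ((\<eta>' r)^2 + ?cv r * (\<eta> r)^2) * r + QQ (u r) (v r) (\<xi> r) (\<eta> r) * r)"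
    by (intro set_lebesgue_integral_cong) (use eq in auto)
  also have "\<dots> = (LINT r:{x..y}|lborel. ((\<xi>' r)^2 + ?cu r * (\<xi> r)^2) * r) + (LINT r:{x..y}|lborel. ((\<eta>' r)^2 + ?cv r * (\<eta> r)^2) * r)
      + (LINT r:{x..y}|lborel. QQ (u r) (v r) (\<xi> r) (\<eta> r) * r)"
    using set_integral_add(2)[OF set_integral_add(1)[OF P1(1) P2(1)] P3] set_integral_add(2)[OF P1(1) P2(1)] by simp
  finally have E: "(LINT r:{x..y}|lborel. dens r (u r) (v r) (\<xi> r) (\<xi>' r) (\<eta> r) (\<eta>' r)) = \<dots>" .
  have "(LINT r:{x..y}|lborel. lam * ((u r)^2 * (\<xi> r)^2 + (\<eta> r)^2) * r) \<le> (LINT r:{x..y}|lborel. QQ (u r) (v r) (\<xi> r) (\<eta> r) * r)"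
  proof (rule set_integral_mono[OF P4 P3])
    fix r assume r: "r \<in> {x..y}"
    then show "lam * ((u r)^2 * (\<xi> r)^2 + (\<eta> r)^2) * r \<le> QQ (u r) (v r) (\<xi> r) (\<eta> r) * r"
      using QQ_lower v_le[OF dom] v_ge[OF dom] x by (intro mult_right_mono) auto
  qed
  then show ?le unfolding E bdry_def using P1(2) P2(2) by linarith
qed

end

section \<open>Measurability and integrability in the perturbation space\<close>

lemma indicator_quotient_measurable:
  fixes c f :: "real \<Rightarrow> real"
  assumes "(\<lambda>r. c r * f r) \<in> borel_measurable lborel" "c \<in> borel_measurable borel"
    and "\<And>r. 0 < r \<Longrightarrow> c r \<noteq> 0"
  shows "(\<lambda>r. indicator (dom0 R) r * f r) \<in> borel_measurable borel"
proof -
  have [measurable]: "dom0 R \<in> sets borel" "(\<lambda>r. c r * f r) \<in> borel_measurable borel" "c \<in> borel_measurable borel"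
    using assms open_dom0 by auto
  have "(\<lambda>r. indicator (dom0 R) r * f r) = (\<lambda>r. indicator (dom0 R) r * ((c r * f r) / c r))"
    using assms(3) by (auto simp: fun_eq_iff dom0_def split: split_indicator)
  also have "\<dots> \<in> borel_measurable borel" by measurable
  finally show ?thesis .
qed

text \<open>\<open>sq_int\<close> provides measurability of the weighted functions only. The weights
  can vanish off the positive axis, so the functions themselves are recovered after restriction to
  \<open>dom0 R\<close>.\<close>

lemma hatX_measurable:
  assumes "hatX R \<xi> \<xi>' \<eta> \<eta>'"
  shows "(\<lambda>r. indicator (dom0 R) r * \<xi> r) \<in> borel_measurable borel"
    "(\<lambda>r. indicator (dom0 R) r * \<xi>' r) \<in> borel_measurable borel"
    "(\<lambda>r. indicator (dom0 R) r * \<eta> r) \<in> borel_measurable borel"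
    "(\<lambda>r. indicator (dom0 R) r * \<eta>' r) \<in> borel_measurable borel"
proof -
  show "(\<lambda>r. indicator (dom0 R) r * \<xi> r) \<in> borel_measurable borel"
  proof (cases "R = \<infinity>")
    case True
    then have "(\<lambda>r. (1 / sqrt r + sqrt r) * \<xi> r) \<in> borel_measurable lborel"
      using assms by (simp add: hatX_def sq_int_def)
    then show ?thesis
      by (rule indicator_quotient_measurable) (auto simp: add_nonneg_eq_0_iff)
  next
    case False
    then have "(\<lambda>r. (1 / sqrt r) * \<xi> r) \<in> borel_measurable lborel"
      using assms by (simp add: hatX_def sq_int_def)
    then show ?thesis by (rule indicator_quotient_measurable) auto
  qed
qed (rule indicator_quotient_measurable[where c = sqrt], use assms in \<open>auto simp: hatX_def sq_int_def\<close>)+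

text \<open>For R = \<infinity> the squared weight \<open>(1 / sqrt r + sqrt r)^2\<close> expands to
  \<open>1 / r + 2 + r\<close>; for finite \<open>R\<close> the factor \<open>r^2\<close> is
  bounded, so \<open>\<xi>^2 / r\<close> controls \<open>r * \<xi>^2\<close>. The function
  \<open>W\<close> in the proof is a common majorant.\<close>

lemma hatX_integrable:
  assumes "hatX R \<xi> \<xi>' \<eta> \<eta>'" and R: "0 < R"
  shows "set_integrable lborel (dom0 R) (\<lambda>r. r * (\<xi>' r)^2)"
    "set_integrable lborel (dom0 R) (\<lambda>r. r * (\<eta>' r)^2)"
    "set_integrable lborel (dom0 R) (\<lambda>r. (\<xi> r)^2 / r)"
    "set_integrable lborel (dom0 R) (\<lambda>r. r * (\<xi> r)^2)"
    "set_integrable lborel (dom0 R) (\<lambda>r. r * (\<eta> r)^2)"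
proof -
  have sq: "set_integrable lborel (dom0 R) (\<lambda>r. r * (f r)^2)" if "sq_int R (\<lambda>r. sqrt r * f r)" for f
  proof -
    have "set_integrable lborel (dom0 R) (\<lambda>r. (sqrt r * f r)^2)" using that by (simp add: sq_int_def)
    then show ?thesis
      by (rule set_integrable_cong[THEN iffD1, rotated -1]) (auto simp: power_mult_distrib dom0_def)
  qed
  show "set_integrable lborel (dom0 R) (\<lambda>r. r * (\<xi>' r)^2)" "set_integrable lborel (dom0 R) (\<lambda>r. r * (\<eta>' r)^2)"
    "set_integrable lborel (dom0 R) (\<lambda>r. r * (\<eta> r)^2)"
    using assms sq by (auto simp: hatX_def)
  have m\<xi>: "(\<lambda>r. indicator (dom0 R) r * \<xi> r) \<in> borel_measurable borel"
    by (rule hatX_measurable[OF assms(1)])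
  have [measurable]: "dom0 R \<in> sets borel" using open_dom0 by auto
  have m: "set_borel_measurable lborel (dom0 R) (\<lambda>r. c r * (\<xi> r)^2)" if [measurable]: "c \<in> borel_measurable borel" for c :: "real \<Rightarrow> real"
  proof -
    note m\<xi>[measurable]
    have "(\<lambda>r. indicator (dom0 R) r *\<^sub>R (c r * (\<xi> r)^2)) = (\<lambda>r. c r * (indicator (dom0 R) r * \<xi> r)^2)"
      by (auto simp: fun_eq_iff split: split_indicator)
    then show ?thesis unfolding set_borel_measurable_def by simp
  qed
  obtain W where W: "set_integrable lborel (dom0 R) W" "\<And>r. r \<in> dom0 R \<Longrightarrow> (\<xi> r)^2 / r \<le> W r"
    "\<And>r. r \<in> dom0 R \<Longrightarrow> r * (\<xi> r)^2 \<le> W r"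
  proof (cases "R = \<infinity>")
    case True
    show thesis
    proof (rule that)
      show "set_integrable lborel (dom0 R) (\<lambda>r. ((1 / sqrt r + sqrt r) * \<xi> r)^2)"
        using assms True by (simp add: hatX_def sq_int_def)
      fix r assume "r \<in> dom0 R"
      then have r: "0 < r" by (simp add: dom0_def)
      have "((1 / sqrt r + sqrt r) * \<xi> r)^2 = (1 / r + 2 + r) * (\<xi> r)^2"
        using r by (simp add: power_mult_distrib power2_sum power_divide)
      also have "\<dots> = (\<xi> r)^2 / r + 2 * (\<xi> r)^2 + r * (\<xi> r)^2" by (simp add: algebra_simps)
      finally have e: "((1 / sqrt r + sqrt r) * \<xi> r)^2 = \<dots>" .
      show "(\<xi> r)^2 / r \<le> ((1 / sqrt r + sqrt r) * \<xi> r)^2" "r * (\<xi> r)^2 \<le> ((1 / sqrt r + sqrt r) * \<xi> r)^2"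
        unfolding e using r by simp_all
    qed
  next
    case False
    then obtain y where y: "R = ereal y" "0 < y" using R by (cases R) auto
    show thesis
    proof (rule that)
      have "set_integrable lborel (dom0 R) (\<lambda>r. (\<xi> r / sqrt r)^2)"
        using assms False by (simp add: hatX_def sq_int_def)
      then have "set_integrable lborel (dom0 R) (\<lambda>r. (1 + y^2) * (\<xi> r / sqrt r)^2)" by simp
      then show "set_integrable lborel (dom0 R) (\<lambda>r. (1 + y^2) * ((\<xi> r)^2 / r))"
        by (rule set_integrable_cong[THEN iffD1, rotated -1]) (auto simp: power_divide dom0_def)
      fix r assume "r \<in> dom0 R"
      then have r: "0 < r" "r < y" using y by (simp_all add: dom0_def)
      then have n: "0 \<le> (\<xi> r)^2 / r" by simp
      then show "(\<xi> r)^2 / r \<le> (1 + y^2) * ((\<xi> r)^2 / r)"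
        using mult_right_mono[OF _ n, of 1 "1 + y^2"] by simp
      have "r * (\<xi> r)^2 = r^2 * ((\<xi> r)^2 / r)" using r by (simp add: power2_eq_square)
      also have "\<dots> \<le> (1 + y^2) * ((\<xi> r)^2 / r)"
      proof (rule mult_right_mono[OF _ n])
        have "r^2 \<le> y^2" using r by (intro power_mono) auto
        then show "r^2 \<le> 1 + y^2" by simp
      qed
      finally show "r * (\<xi> r)^2 \<le> (1 + y^2) * ((\<xi> r)^2 / r)" .
    qed
  qed
  show "set_integrable lborel (dom0 R) (\<lambda>r. (\<xi> r)^2 / r)"
  proof (rule set_integrable_bound[OF W(1)])
    show "set_borel_measurable lborel (dom0 R) (\<lambda>r. (\<xi> r)^2 / r)"
      using m[of "\<lambda>r. 1 / r"] by simp
    show "AE r in lborel. r \<in> dom0 R \<longrightarrow> norm ((\<xi> r)^2 / r) \<le> norm (W r)"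
      by (rule AE_I2) (use W(2) in \<open>force simp: dom0_def\<close>)
  qed
  show "set_integrable lborel (dom0 R) (\<lambda>r. r * (\<xi> r)^2)"
  proof (rule set_integrable_bound[OF W(1)])
    show "set_borel_measurable lborel (dom0 R) (\<lambda>r. r * (\<xi> r)^2)"
      using m[of "\<lambda>r. r"] by simp
    show "AE r in lborel. r \<in> dom0 R \<longrightarrow> norm (r * (\<xi> r)^2) \<le> norm (W r)"
      by (rule AE_I2) (use W(3) in \<open>force simp: dom0_def abs_mult\<close>)
  qed
qed

text \<open>\<open>weak_deriv_on\<close> speaks of the gauge integral. The Lebesgue integrability
  required by Picone's inequality comes from the weighted square integrability and
  \<open>\<bar>w'\<bar> \<le> 1 + w'^2\<close> on an interval of finite length away from 0.\<close>

lemma weak_deriv_integrable: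
  assumes x: "0 < x" "x \<le> y" "y \<in> dom0 R"
    and m: "(\<lambda>r. indicator (dom0 R) r * w' r) \<in> borel_measurable borel"
    and w': "set_integrable lborel (dom0 R) (\<lambda>r. r * (w' r)^2)"
  shows "set_integrable lborel {x..y} w'" "set_integrable lborel {x..y} (\<lambda>r. r * (w' r)^2)"
proof -
  have sub: "{x..y} \<subseteq> dom0 R" using dom0_Icc[OF x(3) x(1)] by auto
  show 2: "set_integrable lborel {x..y} (\<lambda>r. r * (w' r)^2)"
    by (rule set_integrable_subset[OF w' _ sub]) auto
  have 1: "set_integrable lborel {x..y} (\<lambda>r. 1 :: real)"
    by (intro borel_integrable_atLeastAtMost' continuous_intros)
  have "set_integrable lborel {x..y} (\<lambda>r. 1 + (1 / x) * (r * (w' r)^2))"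
    using set_integral_add(1)[OF 1 set_integrable_mult_right[OF 2, of "1 / x"]] .
  then show "set_integrable lborel {x..y} w'"
  proof (rule set_integrable_bound)
    have "(\<lambda>r. indicator {x..y} r *\<^sub>R w' r) = (\<lambda>r. indicator {x..y} r * (indicator (dom0 R) r * w' r))"
      using sub by (auto simp: fun_eq_iff split: split_indicator)
    also have "\<dots> \<in> borel_measurable lborel" using m by simp
    finally show "set_borel_measurable lborel {x..y} w'" unfolding set_borel_measurable_def .
    show "AE r in lborel. r \<in> {x..y} \<longrightarrow> norm (w' r) \<le> norm (1 + (1 / x) * (r * (w' r)^2))"
    proof (intro AE_I2 impI)
      fix r assume r: "r \<in> {x..y}"
      have "\<bar>w' r\<bar> \<le> 1 + (w' r)^2"
        using zero_le_power2[of "\<bar>w' r\<bar> - 1/2"] by (simp add: power2_diff) (simp add: power2_eq_square)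
      also have "(w' r)^2 \<le> (r / x) * (w' r)^2"
        using mult_right_mono[of 1 "r / x" "(w' r)^2"] r x by simp
      finally show "norm (w' r) \<le> norm (1 + (1 / x) * (r * (w' r)^2))" by simp
    qed
  qed
qed

context gl_sol
begin

lemma dens_integrable:
  assumes h: "hatX R \<xi> \<xi>' \<eta> \<eta>'"
  shows "set_integrable lborel (dom0 R) (\<lambda>r. dens r (u r) (v r) (\<xi> r) (\<xi>' r) (\<eta> r) (\<eta>' r))"
proof -
  have [measurable]: "dom0 R \<in> sets borel" using open_dom0 by auto
  note I = hatX_integrable[OF h R]
  have "set_integrable lborel (dom0 R) (\<lambda>r. (1 + (real n)^2 + coeff_bound) *
      (r * (\<xi>' r)^2 + r * (\<eta>' r)^2 + (\<xi> r)^2 / r + r * (\<xi> r)^2 + r * (\<eta> r)^2))"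
    by (intro set_integrable_mult_right set_integral_add(1) I)
  then show ?thesis
  proof (rule set_integrable_bound)
    let ?i = "indicator (dom0 R) :: real \<Rightarrow> real"
    note hatX_measurable[OF h, measurable]
    have [measurable]: "(\<lambda>r. ?i r * u r) \<in> borel_measurable borel" "(\<lambda>r. ?i r * v r) \<in> borel_measurable borel"
      using borel_measurable_continuous_on_indicator[OF _ cont_u] borel_measurable_continuous_on_indicator[OF _ cont_v]
      by simp_all
    \<comment> \<open>Measurability is known only for the cut-off functions, so the indicator is
      inserted into every argument.\<close>
    have "(\<lambda>r. indicator (dom0 R) r *\<^sub>R dens r (u r) (v r) (\<xi> r) (\<xi>' r) (\<eta> r) (\<eta>' r))
      = (\<lambda>r. ?i r * dens r (?i r * u r) (?i r * v r) (?i r * \<xi> r) (?i r * \<xi>' r) (?i r * \<eta> r) (?i r * \<eta>' r))"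
      by (auto simp: fun_eq_iff split: split_indicator)
    also have "\<dots> \<in> borel_measurable lborel" unfolding dens_def by measurable
    finally show "set_borel_measurable lborel (dom0 R) (\<lambda>r. dens r (u r) (v r) (\<xi> r) (\<xi>' r) (\<eta> r) (\<eta>' r))"
      unfolding set_borel_measurable_def .
    show "AE r in lborel. r \<in> dom0 R \<longrightarrow> norm (dens r (u r) (v r) (\<xi> r) (\<xi>' r) (\<eta> r) (\<eta>' r))
       \<le> norm ((1 + (real n)^2 + coeff_bound) * (r * (\<xi>' r)^2 + r * (\<eta>' r)^2 + (\<xi> r)^2 / r + r * (\<xi> r)^2 + r * (\<eta> r)^2))"
    proof (intro AE_I2 impI)
      fix r assume r: "r \<in> dom0 R"
      then have "\<bar>dens r (u r) (v r) (\<xi> r) (\<xi>' r) (\<eta> r) (\<eta>' r)\<bar> \<le> (1 + (real n)^2 + coeff_bound) * (r * (\<xi>' r)^2 + r * (\<eta>' r)^2 + (\<xi> r)^2 / r + r * (\<xi> r)^2 + r * (\<eta> r)^2)"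
        using v_ge[OF r] v_le[OF r] u_le[OF r] upos[OF r] by (intro dens_bound) (auto simp: dom0_def)
      then show "norm (dens r (u r) (v r) (\<xi> r) (\<xi>' r) (\<eta> r) (\<eta>' r))
       \<le> norm ((1 + (real n)^2 + coeff_bound) * (r * (\<xi>' r)^2 + r * (\<eta>' r)^2 + (\<xi> r)^2 / r + r * (\<xi> r)^2 + r * (\<eta> r)^2))"
        unfolding real_norm_def by linarith
    qed
  qed
qed

text \<open>Otherwise the integrable function \<open>G\<close> would dominate
  \<open>(e / K) / r\<close> near the origin.\<close>

lemma small_bdry_0:
  assumes h: "hatX R \<xi> \<xi>' \<eta> \<eta>'" and e: "0 < e" and a: "a \<in> dom0 R"
  shows "\<exists>x. 0 < x \<and> x \<le> a \<and> \<bar>bdry \<xi> \<eta> x\<bar> < e"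
proof (rule ccontr)
  assume no: "\<not> ?thesis"
  obtain d K where d: "d \<in> dom0 R" "0 < K"
    "\<And>r. 0 < r \<Longrightarrow> r \<le> d \<Longrightarrow> \<bar>bdry \<xi> \<eta> r\<bar> \<le> K * ((\<xi> r)^2 + r^2 * (\<eta> r)^2)"
    using bdry_near_0 by blast
  define y where "y = min a d"
  have y: "0 < y" "y \<le> a" "y \<le> d" using a d by (auto simp: y_def dom0_def)
  note I = hatX_integrable[OF h R]
  define G where "G = (\<lambda>r. (\<xi> r)^2 / r + r * (\<eta> r)^2)"
  have G: "set_integrable lborel (dom0 R) G" unfolding G_def by (intro set_integral_add(1) I)
  have Gpos: "0 \<le> G r" if "r \<in> dom0 R" for r using that by (auto simp: G_def dom0_def)
  have low: "(e / K) / r \<le> G r" if r: "0 < r" "r \<le> y" for r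
  proof -
    have "e \<le> \<bar>bdry \<xi> \<eta> r\<bar>" using no r y by (meson not_less order_trans)
    also have "\<dots> \<le> K * ((\<xi> r)^2 + r^2 * (\<eta> r)^2)" using d(3) r y by auto
    finally have "e / K \<le> (\<xi> r)^2 + r^2 * (\<eta> r)^2" using d(2) by (simp add: field_simps)
    then have "(e / K) / r \<le> ((\<xi> r)^2 + r^2 * (\<eta> r)^2) / r" using r by (intro divide_right_mono) auto
    then show ?thesis using r by (simp add: G_def add_divide_distrib power2_eq_square)
  qed
  define J where "J = (LINT r:dom0 R|lborel. G r)"
  \<comment> \<open>Makes \<open>(e / K) * ln (y / x)\<close> equal to
    \<open>\<bar>J\<bar> + 1\<close>, more than the whole integral.\<close>
  define x where "x = y * exp (- ((\<bar>J\<bar> + 1) * K / e))"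
  have x: "0 < x" "x \<le> y" using y d(2) e by (auto simp: x_def mult_le_cancel_left1)
  have "(e / K) * ln (y / x) \<le> J"
    unfolding J_def
  proof (rule set_integral_log_bound[OF G Gpos x])
    show "{x..y} \<subseteq> dom0 R" using x y by (auto intro: dom0_downward[OF a])
  qed (use low x in auto)
  moreover have "ln (y / x) = (\<bar>J\<bar> + 1) * K / e" using y by (simp add: x_def exp_minus field_simps)
  ultimately show False using e d(2) by simp
qed

text \<open>For R = \<infinity> a persistent boundary term would give \<open>G \<ge> e / K\<close>,
  weakened to \<open>(e / K) / r\<close> in order to reuse the logarithmic bound. For finite
  \<open>R\<close> the vanishing boundary values suffice.\<close>

lemma small_bdry_end:
  assumes h: "hatX R \<xi> \<xi>' \<eta> \<eta>'" and e: "0 < e" and a: "a \<in> dom0 R"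
  shows "\<exists>x\<in>dom0 R. a \<le> x \<and> \<bar>bdry \<xi> \<eta> x\<bar> < e"
proof -
  obtain K where K: "0 < K" "\<And>r. r \<in> dom0 R \<Longrightarrow> a \<le> r \<Longrightarrow> \<bar>bdry \<xi> \<eta> r\<bar> \<le> K * (r * ((\<xi> r)^2 + (\<eta> r)^2))"
    using bdry_near_end[OF a] by blast
  have a0: "0 < a" using a by (simp add: dom0_def)
  show ?thesis
  proof (cases rule: at_end_cases[OF R])
    case 1
    show ?thesis
    proof (rule ccontr)
      assume no: "\<not> ?thesis"
      have dom: "r \<in> dom0 R" if "0 < r" for r using that 1 by (simp add: dom0_def)
      define b where "b = max a 1"
      note I = hatX_integrable[OF h R]
      define G where "G = (\<lambda>r. r * (\<xi> r)^2 + r * (\<eta> r)^2)"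
      have G: "set_integrable lborel (dom0 R) G" unfolding G_def by (intro set_integral_add(1) I)
      have Gpos: "0 \<le> G r" if "r \<in> dom0 R" for r using that by (auto simp: G_def dom0_def)
      have low: "(e / K) / r \<le> G r" if r: "b \<le> r" for r
      proof -
        have r1: "1 \<le> r" "a \<le> r" using r by (auto simp: b_def)
        have "e \<le> \<bar>bdry \<xi> \<eta> r\<bar>" using no r1 dom[of r] by force
        also have "\<dots> \<le> K * G r" using K(2)[OF dom] r1 by (simp add: G_def ring_distribs)
        finally have "e / K \<le> G r" using K(1) by (simp add: field_simps)
        moreover have "(e / K) / r \<le> e / K" using r1 e K(1) by (simp add: field_simps)
        ultimately show ?thesis by simp
      qed
      define J where "J = (LINT r:dom0 R|lborel. G r)"
      have b: "0 < b" by (simp add: b_def)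
      define y where "y = b * exp ((\<bar>J\<bar> + 1) * K / e)"
      have y: "b \<le> y" using b K(1) e by (auto simp: y_def)
      have "(e / K) * ln (y / b) \<le> J"
        unfolding J_def
      proof (rule set_integral_log_bound[OF G Gpos b y])
        show "{b..y} \<subseteq> dom0 R" using b dom by auto
      qed (use low in auto)
      moreover have "ln (y / b) = (\<bar>J\<bar> + 1) * K / e" using b by (simp add: y_def)
      ultimately show False using e K(1) by simp
    qed
  next
    case (2 y)
    have l: "(\<xi> \<longlongrightarrow> 0) (at_end R)" "(\<eta> \<longlongrightarrow> 0) (at_end R)"
      using h 2 by (auto simp: hatX_def)
    have "((\<lambda>r. K * (y * ((\<xi> r)^2 + (\<eta> r)^2))) \<longlongrightarrow> K * (y * (0^2 + 0^2))) (at_end R)"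
      by (intro tendsto_intros l)
    then have "eventually (\<lambda>r. K * (y * ((\<xi> r)^2 + (\<eta> r)^2)) < e) (at_end R)"
      using e by (intro order_tendstoD(2)) auto
    then have "eventually (\<lambda>r. r \<in> dom0 R \<and> a < r \<and> K * (y * ((\<xi> r)^2 + (\<eta> r)^2)) < e) (at_end R)"
      using eventually_at_end[OF a] by eventually_elim auto
    then obtain r where r: "r \<in> dom0 R" "a < r" "K * (y * ((\<xi> r)^2 + (\<eta> r)^2)) < e"
      using eventually_happens at_end_neq_bot[OF R] by blast
    have "r \<le> y" using r 2 by (simp add: dom0_def)
    then have "K * (r * ((\<xi> r)^2 + (\<eta> r)^2)) \<le> K * (y * ((\<xi> r)^2 + (\<eta> r)^2))"
      using K(1) by (intro mult_left_mono mult_right_mono) auto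
    then have "\<bar>bdry \<xi> \<eta> r\<bar> < e" using K(2)[OF r(1)] r(2,3) by linarith
    then show ?thesis using r by (intro bexI[of _ r]) auto
  qed
qed

text \<open>\<open>hardy_interval\<close> on a large interval with three errors below
  \<open>e / 3\<close>: the two boundary terms and the truncation of the integral. The endpoints are
  chosen after the truncation level.\<close>

lemma hardy_global:
  assumes h: "hatX R \<xi> \<xi>' \<eta> \<eta>'" and x0: "0 < x0" "x0 \<le> y0" "y0 \<in> dom0 R"
  shows "(LINT r:{x0..y0}|lborel. lam * ((u r)^2 * (\<xi> r)^2 + (\<eta> r)^2) * r)
    \<le> (LINT r:dom0 R|lborel. dens r (u r) (v r) (\<xi> r) (\<xi>' r) (\<eta> r) (\<eta>' r))" (is "?L \<le> ?D")
proof (rule field_le_epsilon)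
  fix e :: real assume e: "0 < e"
  let ?w = "\<lambda>r. lam * ((u r)^2 * (\<xi> r)^2 + (\<eta> r)^2) * r"
  let ?d = "\<lambda>r. dens r (u r) (v r) (\<xi> r) (\<xi>' r) (\<eta> r) (\<eta>' r)"
  have e3: "0 < e / 3" using e by simp
  obtain a b where ab: "a \<in> dom0 R" "b \<in> dom0 R"
    "\<And>x y. x \<in> dom0 R \<Longrightarrow> y \<in> dom0 R \<Longrightarrow> x \<le> a \<Longrightarrow> b \<le> y \<Longrightarrow> \<bar>?D - (LINT r:{x..y}|lborel. ?d r)\<bar> < e / 3"
    using set_integral_exhaustion[OF dens_integrable[OF h] R e3] by blast
  have x0d: "x0 \<in> dom0 R" using dom0_downward[OF x0(3) x0(1,2)] .
  have "min a x0 \<in> dom0 R" "max b y0 \<in> dom0 R" using ab x0 x0d by (auto simp: min_def max_def)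
  then obtain x y where x: "0 < x" "x \<le> min a x0" "\<bar>bdry \<xi> \<eta> x\<bar> < e / 3"
    and y: "y \<in> dom0 R" "max b y0 \<le> y" "\<bar>bdry \<xi> \<eta> y\<bar> < e / 3"
    using small_bdry_0[OF h e3] small_bdry_end[OF h e3] by blast
  have xd: "x \<in> dom0 R" using x x0d dom0_downward by auto
  have xy: "x \<le> y" using x x0 y by auto
  note m = hatX_measurable[OF h]
  note I = hatX_integrable[OF h R]
  have wd: "(\<xi>' has_integral (\<xi> t - \<xi> x)) {x..t}" "(\<eta>' has_integral (\<eta> t - \<eta> x)) {x..t}"
    if "x \<le> t" "t \<le> y" for t
    using h xd dom0_Icc[OF y(1) x(1) that] that by (auto simp: hatX_def weak_deriv_on_def)
  note wi = weak_deriv_integrable[OF x(1) xy y(1)]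
  have H: "bdry \<xi> \<eta> y - bdry \<xi> \<eta> x + (LINT r:{x..y}|lborel. ?w r) \<le> (LINT r:{x..y}|lborel. ?d r)"
    by (rule hardy_interval(2)[OF x(1) xy y(1) wi[OF m(2) I(1)] wd(1) wi[OF m(4) I(2)] wd(2)])
  have sub: "{x..y} \<subseteq> dom0 R" using dom0_Icc[OF y(1) x(1)] by auto
  have "set_integrable lborel {x..y} ?w"
    using primitive_continuous[OF xy wd(1)] primitive_continuous[OF xy wd(2)]
    by (intro borel_integrable_atLeastAtMost' continuous_intros continuous_on_subset[OF cont_u sub])
  then have "?L \<le> (LINT r:{x..y}|lborel. ?w r)"
    using x x0 y lam_pos by (intro set_integral_mono_superset) auto
  moreover have "\<bar>?D - (LINT r:{x..y}|lborel. ?d r)\<bar> < e / 3" using ab(3)[OF xd y(1)] x y by simp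
  ultimately show "?L \<le> ?D + e"
    using H x(3) y(3) unfolding abs_less_iff by linarith
qed

text \<open>On \<open>{s / 2..s}\<close> the Hardy weight is a continuous nonnegative function, and
  it is positive at \<open>s\<close> because \<open>u s > 0\<close>.\<close>

lemma strict_stability:
  assumes h: "hatX R \<xi> \<xi>' \<eta> \<eta>'" and s: "s \<in> dom0 R" "\<xi> s \<noteq> 0 \<or> \<eta> s \<noteq> 0"
  shows "0 < (LINT r:dom0 R|lborel. dens r (u r) (v r) (\<xi> r) (\<xi>' r) (\<eta> r) (\<eta>' r))"
proof -
  let ?w = "\<lambda>r. lam * ((u r)^2 * (\<xi> r)^2 + (\<eta> r)^2) * r"
  have s0: "0 < s" using s by (simp add: dom0_def)
  define x where "x = s / 2"
  have x: "0 < x" "x < s" using s0 by (auto simp: x_def)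
  have xd: "x \<in> dom0 R" using dom0_downward[OF s(1)] x by simp
  have sub: "{x..s} \<subseteq> dom0 R" using dom0_Icc[OF s(1) x(1)] by auto
  have wd: "(\<xi>' has_integral (\<xi> t - \<xi> x)) {x..t}" "(\<eta>' has_integral (\<eta> t - \<eta> x)) {x..t}"
    if "x \<le> t" "t \<le> s" for t
    using h xd dom0_Icc[OF s(1) x(1) that] that by (auto simp: hatX_def weak_deriv_on_def)
  have c: "continuous_on {x..s} ?w"
    using primitive_continuous[OF _ wd(1)] primitive_continuous[OF _ wd(2)] x
    by (intro continuous_intros continuous_on_subset[OF cont_u sub]) auto
  have nn: "0 \<le> ?w r" if "r \<in> {x..s}" for r using that x lam_pos by auto
  have "0 < (u s)^2 * (\<xi> s)^2 + (\<eta> s)^2"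
    using s(2) upos[OF s(1)] by (auto intro: add_pos_nonneg add_nonneg_pos)
  then have "?w s \<noteq> 0" using lam_pos s0 by simp
  then have "integral {x..s} ?w \<noteq> 0"
    using integral_eq_0_iff[OF c _ nn] x by auto
  moreover have "0 \<le> integral {x..s} ?w"
    using nn by (intro integral_nonneg integrable_continuous_real c) auto
  ultimately have "0 < integral {x..s} ?w" by simp
  also have "\<dots> = (LINT r:{x..s}|lborel. ?w r)"
    using set_borel_integral_eq_integral(2)[OF borel_integrable_atLeastAtMost'[OF c]] by simp
  also have "\<dots> \<le> (LINT r:dom0 R|lborel. dens r (u r) (v r) (\<xi> r) (\<xi>' r) (\<eta> r) (\<eta>' r))"
    using hardy_global[OF h x(1) _ s(1)] x by simp
  finally show ?thesis .
qed

end

section \<open>Uniqueness\<close>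

context gl_params
begin

text \<open>The two requirements met in \<open>hidden_convexity\<close> are
  \<open>mu \<le> C / 2\<close> and \<open>mu * (1 + 32 * q^2) \<le> 2 * B * q\<close>.\<close>

definition mu :: real where "mu = min (C / 2) (2 * B * q / (1 + 32 * q^2))"

lemma mu_pos: "0 < mu"
  unfolding mu_def using B C q by (auto intro!: divide_pos_pos add_pos_nonneg)

text \<open>In the variables \<open>(u\<^sup>2, v\<^sup>2)\<close> the potential is uniformly convex where \<open>- 2 q \<le> v \<le> - q\<close>;
  this is the monotonicity of its gradient.\<close>

lemma hidden_convexity:
  assumes v: "- (2 * q) \<le> v" "v \<le> - q" and z: "- (2 * q) \<le> z" "z \<le> - q" and uw: "0 < u" "0 < w"
  shows "mu * ((u^2 - w^2)^2 + (v - z)^2)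
    \<le> (hh u v / u - hh w z / w) * (u^2 - w^2) + (gg u v / v - gg w z / z) * (v^2 - z^2)" (is "_ \<le> ?M")
proof -
  define y t where "y = - v" and "t = - z"
  have y: "q \<le> y" "y \<le> 2 * q" "0 < y" and t: "q \<le> t" "t \<le> 2 * q" "0 < t"
    using v z q by (auto simp: y_def t_def)
  define U W where "U = u^2" and "W = w^2"
  have UW: "0 < U" "0 < W" using uw by (auto simp: U_def W_def)
  define d D s p where "d = y - t" and "D = U - W" and "s = y + t" and "p = y * t"
  have p0: "0 < p" and s0: "2 * q \<le> s" "s \<le> 4 * q" using y t by (auto simp: p_def s_def)
  \<comment> \<open>\<open>?M\<close> is a quadratic form in \<open>D\<close> and \<open>d\<close>
    with leading coefficient \<open>C\<close> and mixed coefficient \<open>k\<close>;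
    \<open>E\<close> is what remains of \<open>4 * C * ?M\<close> after completing the square in
    \<open>D\<close>.\<close>
  define e k E where "e = 2 * B + B * s^2 / (2 * p)" and "k = 2 * C * s - e"
    and "E = 4 * C * (C * s^2 + B * s + B * s * (U + W) / (2 * p)) - k^2"
  have nz: "u \<noteq> 0" "w \<noteq> 0" "v \<noteq> 0" "z \<noteq> 0" using v z q uw by auto
  have h: "hh u v / u = - A - 2 * B * y + C * (U + y^2)" "hh w z / w = - A - 2 * B * t + C * (W + t^2)"
    using nz by (simp_all add: hh_def U_def W_def y_def t_def)
  have g: "gg u v / v = - A + B * y + C * (U + y^2) - B * U / y" "gg w z / z = - A + B * t + C * (W + t^2) - B * W / t"
    using nz by (simp_all add: gg_def U_def W_def y_def t_def field_simps)
  have sq: "u^2 - w^2 = D" "v^2 - z^2 = s * d" "v - z = - d"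
    by (simp_all add: D_def U_def W_def s_def d_def y_def t_def algebra_simps power2_eq_square)
  have Uy: "U / y - W / t = D * s / (2 * p) - (U + W) * d / (2 * p)"
    using y t by (simp add: D_def s_def d_def p_def field_simps)
  have M: "?M = (- 2 * B * d + C * (D + s * d)) * D + (B * d + C * (D + s * d) - B * (U / y - W / t)) * (s * d)"
    unfolding h g sq by (simp add: d_def D_def s_def algebra_simps power2_eq_square)
  have id: "4 * C * ?M = (2 * C * D + k * d)^2 + E * d^2"
    unfolding M Uy E_def k_def e_def using p0 by (simp add: field_simps power2_eq_square)
  \<comment> \<open>Both \<open>y\<close> and \<open>t\<close> lie between \<open>q\<close> and
    \<open>2 * q\<close>, so their ratio lies between 1/2 and 2; \<open>s^2 / p\<close> is largest
    at these extreme ratios, with value 9/2.\<close>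
  have "s^2 - 9 / 2 * p = (y - 2 * t) * (2 * y - t) / 2"
    by (simp add: s_def p_def field_simps power2_eq_square)
  also have "\<dots> \<le> 0" using y t by (intro divide_nonpos_pos mult_nonpos_nonneg) auto
  finally have "s^2 / (2 * p) \<le> 9 / 4" using p0 by (simp add: field_simps)
  then have "B * (s^2 / (2 * p)) \<le> B * (9 / 4)" using B by (intro mult_left_mono) auto
  then have e1: "e \<le> 17 / 4 * B" by (simp add: e_def)
  have e0: "0 \<le> e" unfolding e_def using B p0 by auto
  have "C * (2 * q) \<le> C * s" "C * s \<le> C * (4 * q)" using s0 C by (auto intro: mult_left_mono)
  then have cs: "2 * (C * q) \<le> C * s" "C * s \<le> 4 * (C * q)" by auto
  have cq: "0 < C * q" using C q by simp
  have e2: "e \<le> 4 * C * s" using e1 cs BC cq by linarith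
  have "0 \<le> e * (4 * C * s - e)" using e0 e2 by (intro mult_nonneg_nonneg) auto
  moreover have "0 \<le> C * (B * s * (U + W) / (2 * p))" using B C UW p0 s0 q by (intro mult_nonneg_nonneg divide_nonneg_pos) auto
  moreover have "E = 4 * B * (C * s) + 4 * (C * (B * s * (U + W) / (2 * p))) + e * (4 * C * s - e)"
    unfolding E_def k_def by (simp add: algebra_simps power2_eq_square)
  moreover have "4 * B * (2 * (C * q)) \<le> 4 * B * (C * s)" using B cs by (intro mult_left_mono) auto
  ultimately have "4 * B * (2 * (C * q)) \<le> E" by linarith
  then have E: "8 * C * B * q \<le> E" by (simp add: mult_ac)
  have "\<bar>k\<bar> \<le> 8 * (C * q)" unfolding k_def using e0 e2 cs by (simp add: abs_le_iff)
  then have "\<bar>k\<bar>^2 \<le> (8 * (C * q))^2" by (intro power_mono) auto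
  then have k2: "k^2 \<le> 64 * C^2 * q^2" by (simp add: power_mult_distrib)
  define Z where "Z = 2 * C * D + k * d"
  have "4 * C^2 * D^2 = (Z - k * d)^2" unfolding Z_def by (simp add: power2_eq_square)
  also have "\<dots> \<le> 2 * Z^2 + 2 * (k^2 * d^2)"
    using zero_le_power2[of "Z + k * d"] by (simp add: power2_eq_square algebra_simps)
  also have "\<dots> \<le> 2 * Z^2 + 2 * ((64 * C^2 * q^2) * d^2)" using mult_right_mono[OF k2 zero_le_power2[of d]] by linarith
  finally have "D^2 \<le> Z^2 / (2 * C^2) + 32 * q^2 * d^2" using C by (simp add: field_simps)
  then have "mu * (D^2 + d^2) \<le> mu * (Z^2 / (2 * C^2) + (1 + 32 * q^2) * d^2)"
    using mu_pos by (intro mult_left_mono) (auto simp: algebra_simps)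
  also have "\<dots> = mu * (Z^2 / (2 * C^2)) + (mu * (1 + 32 * q^2)) * d^2" by (simp add: algebra_simps)
  also have "\<dots> \<le> (C / 2) * (Z^2 / (2 * C^2)) + (2 * B * q) * d^2"
  proof (intro add_mono mult_right_mono)
    have "mu * (1 + 32 * q^2) \<le> (2 * B * q / (1 + 32 * q^2)) * (1 + 32 * q^2)"
      by (intro mult_right_mono) (auto simp: mu_def)
    also have "\<dots> = 2 * B * q" using zero_le_power2[of q] by (simp add: add_nonneg_eq_0_iff)
    finally show "mu * (1 + 32 * q^2) \<le> 2 * B * q" .
  qed (auto simp: mu_def)
  also have "\<dots> = (Z^2 + (8 * C * B * q) * d^2) / (4 * C)" using C by (simp add: field_simps power2_eq_square)
  also have "\<dots> \<le> (Z^2 + E * d^2) / (4 * C)"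
    using C mult_right_mono[OF E zero_le_power2[of d]] by (intro divide_right_mono) auto
  also have "\<dots> = ?M" using id C by (simp add: Z_def field_simps)
  finally show ?thesis unfolding sq by simp
qed

end

context gl_sol
begin

lemma log_deriv_u:
  assumes r: "r \<in> dom0 R"
  shows "((\<lambda>r. r * u1 r / u r) has_real_derivative
      r * ((real n)^2 / r^2 + hh (u r) (v r) / u r) - r * (u1 r / u r)^2) (at r)"
proof -
  have "u r \<noteq> 0" "r \<noteq> 0" using upos[OF r] r by (auto simp: dom0_def)
  then show ?thesis
    by (intro DERIV_cong[OF DERIV_divide[OF flux_u[OF r] du[OF r]]]) (auto simp: field_simps power2_eq_square)
qed

lemma log_deriv_v:
  assumes r: "r \<in> dom0 R"
  shows "((\<lambda>r. r * v1 r / v r) has_real_derivative r * (gg (u r) (v r) / v r) - r * (v1 r / v r)^2) (at r)"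
proof -
  have "v r \<noteq> 0" using vneg[OF r] by auto
  then show ?thesis
    by (intro DERIV_cong[OF DERIV_divide[OF flux_v[OF r] dv[OF r]]]) (auto simp: field_simps power2_eq_square)
qed

text \<open>The flux \<open>F\<close> of the Picone (Brezis-Oswald) identity is nonincreasing and vanishes at the origin.
  For \<open>R = \<infinity>\<close> no decay at infinity is needed: \<open>F\<^sup>2 \<le> c r (- F')\<close> makes \<open>1 / F\<close> grow
  logarithmically, so \<open>F\<close> cannot remain negative.\<close>

lemma solution_unique:
  assumes sol: "gl_sol A B C q n R w w1 z z1" and r: "r \<in> dom0 R"
  shows "w r = u r \<and> z r = v r"
proof -
  interpret S: gl_sol A B C q n R w w1 z z1 by (rule sol)
  \<comment> \<open>On differentiation, the Riccati terms and the derivative of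
    \<open>u^2 - w^2\<close> combine to \<open>- r\<close> times the square of
    \<open>u1 / u - w1 / w\<close> with weight \<open>u^2 + w^2\<close>, and likewise for the second
    component.\<close>
  define F where "F = (\<lambda>r. ((u r)^2 - (w r)^2) * (r * w1 r / w r - r * u1 r / u r)
     + ((v r)^2 - (z r)^2) * (r * z1 r / z r - r * v1 r / v r))"
  define M where "M = (\<lambda>r. (hh (u r) (v r) / u r - hh (w r) (z r) / w r) * ((u r)^2 - (w r)^2)
     + (gg (u r) (v r) / v r - gg (w r) (z r) / z r) * ((v r)^2 - (z r)^2))"
  define F' where "F' = (\<lambda>r. - (r * (((u r)^2 + (w r)^2) * (u1 r / u r - w1 r / w r)^2
     + ((v r)^2 + (z r)^2) * (v1 r / v r - z1 r / z r)^2)) - r * M r)"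
  define \<Delta> where "\<Delta> = (\<lambda>r. ((u r)^2 - (w r)^2)^2 + (v r - z r)^2)"
  have M: "mu * \<Delta> r \<le> M r" if r: "r \<in> dom0 R" for r
    unfolding M_def \<Delta>_def
    using r by (intro hidden_convexity v_ge v_le S.v_ge S.v_le upos S.upos)
  have dF: "(F has_real_derivative F' r) (at r)" if r: "r \<in> dom0 R" for r
  proof -
    have nz: "u r \<noteq> 0" "w r \<noteq> 0" "v r \<noteq> 0" "z r \<noteq> 0"
      using upos[OF r] S.upos[OF r] vneg[OF r] S.vneg[OF r] by auto
    define a b c d where "a = u1 r / u r" and "b = w1 r / w r" and "c = v1 r / v r" and "d = z1 r / z r"
    have e: "u1 r = a * u r" "w1 r = b * w r" "v1 r = c * v r" "z1 r = d * z r"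
      using nz by (simp_all add: a_def b_def c_def d_def)
    have q: "r * w1 r / w r = r * b" "r * u1 r / u r = r * a" "r * z1 r / z r = r * d" "r * v1 r / v r = r * c"
      by (simp_all add: a_def b_def c_def d_def)
    note D = DERIV_add[OF
        DERIV_mult[OF DERIV_diff[OF DERIV_power[OF du[OF r], of 2] DERIV_power[OF S.du[OF r], of 2]]
          DERIV_diff[OF S.log_deriv_u[OF r] log_deriv_u[OF r]]]
        DERIV_mult[OF DERIV_diff[OF DERIV_power[OF dv[OF r], of 2] DERIV_power[OF S.dv[OF r], of 2]]
          DERIV_diff[OF S.log_deriv_v[OF r] log_deriv_v[OF r]]]]
    show ?thesis
      unfolding F_def
      apply (rule DERIV_cong[OF D])
      unfolding F'_def M_def q a_def[symmetric] b_def[symmetric] c_def[symmetric] d_def[symmetric]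
      unfolding e
      apply (simp add: algebra_simps power2_eq_square)
      done
  qed
  have F'_le: "F' r \<le> - (r * (mu * \<Delta> r))" if r: "r \<in> dom0 R" for r
  proof -
    have r0: "0 < r" using r by (simp add: dom0_def)
    have "0 \<le> r * (((u r)^2 + (w r)^2) * (u1 r / u r - w1 r / w r)^2 + ((v r)^2 + (z r)^2) * (v1 r / v r - z1 r / z r)^2)"
      using r0 by (intro mult_nonneg_nonneg add_nonneg_nonneg) auto
    moreover have "r * (mu * \<Delta> r) \<le> r * M r" using M[OF r] r0 by (intro mult_left_mono) auto
    ultimately show ?thesis unfolding F'_def by linarith
  qed
  have \<Delta>0: "0 \<le> \<Delta> r" for r by (simp add: \<Delta>_def)
  have F'_nonpos: "F' r \<le> 0" if r: "r \<in> dom0 R" for r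
  proof -
    have "0 \<le> r * (mu * \<Delta> r)" using \<Delta>0 mu_pos r by (intro mult_nonneg_nonneg) (auto simp: dom0_def less_imp_le)
    then show ?thesis using F'_le[OF r] by linarith
  qed
  have F_mono: "F t \<le> F s" if st: "0 < s" "s \<le> t" "t \<in> dom0 R" for s t
    using dom0_Icc[OF st(3) st(1)] dF F'_nonpos
    by (intro DERIV_nonpos_imp_nonincreasing[OF st(2)]) blast
  have F_lim: "(F \<longlongrightarrow> 0) (at_right 0)"
  proof -
    obtain d1 where d1: "d1 \<in> dom0 R" "\<And>r. 0 < r \<Longrightarrow> r \<le> d1 \<Longrightarrow> 0 \<le> r * u1 r \<and> r * u1 r \<le> (real n + 1) * u r"
      using flux_u_near_0 by blast
    obtain d2 where d2: "d2 \<in> dom0 R" "\<And>r. 0 < r \<Longrightarrow> r \<le> d2 \<Longrightarrow> 0 \<le> r * w1 r \<and> r * w1 r \<le> (real n + 1) * w r"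
      using S.flux_u_near_0 by blast
    define d where "d = min d1 d2"
    have d: "d \<in> dom0 R" "d \<le> d1" "d \<le> d2" using d1 d2 by (auto simp: d_def min_def)
    obtain K1 where K1: "0 < K1" "\<And>r. r \<in> dom0 R \<Longrightarrow> \<bar>v1 r\<bar> \<le> K1 * r" using v1_le_linear by blast
    obtain K2 where K2: "0 < K2" "\<And>r. r \<in> dom0 R \<Longrightarrow> \<bar>z1 r\<bar> \<le> K2 * r" using S.v1_le_linear by blast
    have bound: "\<bar>F r\<bar> \<le> ((u r)^2 + (w r)^2) * (real n + 1) + 4 * q^2 * (r * ((K2 * r) / q) + r * ((K1 * r) / q))"
      if r: "0 < r" "r < d" for r
    proof -
      have rd: "r \<in> dom0 R" using dom0_downward[OF d(1)] r by auto
      have "0 \<le> r * u1 r / u r" "r * u1 r / u r \<le> real n + 1" "0 \<le> r * w1 r / w r" "r * w1 r / w r \<le> real n + 1"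
        using d1(2)[of r] d2(2)[of r] r d upos[OF rd] S.upos[OF rd] by (auto simp: field_simps)
      then have "\<bar>r * w1 r / w r - r * u1 r / u r\<bar> \<le> real n + 1" by linarith
      moreover have "\<bar>(u r)^2 - (w r)^2\<bar> \<le> (u r)^2 + (w r)^2" by (simp add: abs_le_iff)
      ultimately have 1: "\<bar>((u r)^2 - (w r)^2) * (r * w1 r / w r - r * u1 r / u r)\<bar> \<le> ((u r)^2 + (w r)^2) * (real n + 1)"
        unfolding abs_mult by (intro mult_mono) auto
      have "\<bar>v1 r\<bar> / \<bar>v r\<bar> \<le> (K1 * r) / q" using K1(2)[OF rd] v_le[OF rd] q by (intro frac_le) auto
      then have a: "\<bar>r * v1 r / v r\<bar> \<le> r * ((K1 * r) / q)"
        using mult_left_mono[of "\<bar>v1 r\<bar> / \<bar>v r\<bar>" "(K1 * r) / q" r] r by (simp add: abs_mult)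
      have "\<bar>z1 r\<bar> / \<bar>z r\<bar> \<le> (K2 * r) / q" using K2(2)[OF rd] S.v_le[OF rd] q by (intro frac_le) auto
      then have b: "\<bar>r * z1 r / z r\<bar> \<le> r * ((K2 * r) / q)"
        using mult_left_mono[of "\<bar>z1 r\<bar> / \<bar>z r\<bar>" "(K2 * r) / q" r] r by (simp add: abs_mult)
      have "(v r)^2 \<le> 4 * q^2" "(z r)^2 \<le> 4 * q^2"
        using P_le[OF rd] S.P_le[OF rd] zero_le_power2[of "u r"] zero_le_power2[of "w r"] by linarith+
      then have "\<bar>(v r)^2 - (z r)^2\<bar> \<le> 4 * q^2"
        using zero_le_power2[of "v r"] zero_le_power2[of "z r"] unfolding abs_le_iff by linarith
      then have "\<bar>((v r)^2 - (z r)^2) * (r * z1 r / z r - r * v1 r / v r)\<bar> \<le> 4 * q^2 * (r * ((K2 * r) / q) + r * ((K1 * r) / q))"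
        unfolding abs_mult using a b by (intro mult_mono) linarith+
      with 1 show ?thesis unfolding F_def by linarith
    qed
    show ?thesis
    proof (rule Lim_null_comparison)
      show "eventually (\<lambda>r. norm (F r) \<le> ((u r)^2 + (w r)^2) * (real n + 1) + 4 * q^2 * (r * ((K2 * r) / q) + r * ((K1 * r) / q))) (at_right 0)"
        using eventually_dom0_right_0[OF d(1)] by eventually_elim (use bound in auto)
      have "((\<lambda>r. ((u r)^2 + (w r)^2) * (real n + 1) + 4 * q^2 * (r * ((K2 * r) / q) + r * ((K1 * r) / q)))
        \<longlongrightarrow> (0^2 + 0^2) * (real n + 1) + 4 * q^2 * (0 * ((K2 * 0) / q) + 0 * ((K1 * 0) / q))) (at_right 0)"
        using q by (intro tendsto_intros u0 S.u0) auto
      then show "((\<lambda>r. ((u r)^2 + (w r)^2) * (real n + 1) + 4 * q^2 * (r * ((K2 * r) / q) + r * ((K1 * r) / q))) \<longlongrightarrow> 0) (at_right 0)"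
        by simp
    qed
  qed
  have F_nonpos: "F r \<le> 0" if r: "r \<in> dom0 R" for r
  proof (rule tendsto_lowerbound[OF F_lim])
    show "eventually (\<lambda>s. F r \<le> F s) (at_right 0)"
      using eventually_dom0_right_0[OF r] by eventually_elim (use F_mono r in auto)
  qed simp
  have F_zero: "F r = 0" if r: "r \<in> dom0 R" for r
  proof (rule ccontr)
    assume "F r \<noteq> 0"
    then have neg: "F r < 0" using F_nonpos[OF r] by simp
    have r0: "0 < r" using r by (simp add: dom0_def)
    have neg': "F s \<le> F r" if "s \<in> dom0 R" "r \<le> s" for s using F_mono that r0 by blast
    obtain L1 where L1: "0 < L1" "\<And>s. s \<in> dom0 R \<Longrightarrow> r \<le> s \<Longrightarrow> \<bar>u1 s\<bar> \<le> L1 \<and> \<bar>v1 s\<bar> \<le> L1"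
      using deriv_bounded[OF r] by blast
    obtain L2 where L2: "0 < L2" "\<And>s. s \<in> dom0 R \<Longrightarrow> r \<le> s \<Longrightarrow> \<bar>w1 s\<bar> \<le> L2 \<and> \<bar>z1 s\<bar> \<le> L2"
      using S.deriv_bounded[OF r] by blast
    obtain m1 where m1: "0 < m1" "\<And>s. s \<in> dom0 R \<Longrightarrow> r \<le> s \<Longrightarrow> m1 \<le> u s"
      using u_bounded_below[OF r] by blast
    obtain m2 where m2: "0 < m2" "\<And>s. s \<in> dom0 R \<Longrightarrow> r \<le> s \<Longrightarrow> m2 \<le> w s"
      using S.u_bounded_below[OF r] by blast
    \<comment> \<open>From \<open>r\<close> on, the logarithmic derivatives are bounded, so
      \<open>\<bar>F s\<bar> / s\<close> is controlled linearly by the differences of the solutions;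
      the factor \<open>4 * q\<close> comes from
      \<open>v^2 - z^2 = (v - z) * (v + z)\<close>.\<close>
    define k where "k = (L1 / m1 + L2 / m2) + 4 * q * (L1 / q + L2 / q)"
    have k0: "0 < k" unfolding k_def using L1(1) L2(1) m1(1) m2(1) q by (intro add_pos_pos mult_pos_pos divide_pos_pos) auto
    have bound: "\<bar>F s\<bar> \<le> k * s * (\<bar>(u s)^2 - (w s)^2\<bar> + \<bar>v s - z s\<bar>)" if s: "s \<in> dom0 R" "r \<le> s" for s
    proof -
      have s0: "0 < s" using s r0 by simp
      have "\<bar>u1 s / u s\<bar> \<le> L1 / m1" unfolding abs_divide using L1(2)[OF s] m1(1) m1(2)[OF s] by (intro frac_le) auto
      moreover have "\<bar>w1 s / w s\<bar> \<le> L2 / m2" unfolding abs_divide using L2(2)[OF s] m2(1) m2(2)[OF s] by (intro frac_le) auto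
      ultimately have a: "\<bar>w1 s / w s - u1 s / u s\<bar> \<le> L1 / m1 + L2 / m2" by linarith
      have "\<bar>v1 s / v s\<bar> \<le> L1 / q" unfolding abs_divide using L1(2)[OF s] v_le[OF s(1)] q by (intro frac_le) auto
      moreover have "\<bar>z1 s / z s\<bar> \<le> L2 / q" unfolding abs_divide using L2(2)[OF s] S.v_le[OF s(1)] q by (intro frac_le) auto
      ultimately have b: "\<bar>z1 s / z s - v1 s / v s\<bar> \<le> L1 / q + L2 / q" by linarith
      have "\<bar>v s + z s\<bar> \<le> 4 * q" using v_ge[OF s(1)] S.v_ge[OF s(1)] vneg[OF s(1)] S.vneg[OF s(1)] by auto
      then have "\<bar>(v s)^2 - (z s)^2\<bar> \<le> \<bar>v s - z s\<bar> * (4 * q)"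
        unfolding square_diff_square_factored power2_eq_square abs_mult mult.commute[of "\<bar>v s + z s\<bar>"]
        by (intro mult_left_mono) auto
      then have 2: "\<bar>(v s)^2 - (z s)^2\<bar> * \<bar>z1 s / z s - v1 s / v s\<bar> \<le> (\<bar>v s - z s\<bar> * (4 * q)) * (L1 / q + L2 / q)"
        using b q by (intro mult_mono) auto
      have 1: "\<bar>(u s)^2 - (w s)^2\<bar> * \<bar>w1 s / w s - u1 s / u s\<bar> \<le> \<bar>(u s)^2 - (w s)^2\<bar> * (L1 / m1 + L2 / m2)"
        using a by (intro mult_left_mono) auto
      have "F s = s * (((u s)^2 - (w s)^2) * (w1 s / w s - u1 s / u s) + ((v s)^2 - (z s)^2) * (z1 s / z s - v1 s / v s))"
        by (simp add: F_def algebra_simps)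
      then have "\<bar>F s\<bar> = s * \<bar>((u s)^2 - (w s)^2) * (w1 s / w s - u1 s / u s) + ((v s)^2 - (z s)^2) * (z1 s / z s - v1 s / v s)\<bar>"
        using s0 by (simp add: abs_mult)
      also have "\<dots> \<le> s * (\<bar>(u s)^2 - (w s)^2\<bar> * \<bar>w1 s / w s - u1 s / u s\<bar> + \<bar>(v s)^2 - (z s)^2\<bar> * \<bar>z1 s / z s - v1 s / v s\<bar>)"
        using s0 unfolding abs_mult[symmetric] by (intro mult_left_mono abs_triangle_ineq) auto
      also have "\<dots> \<le> s * (\<bar>(u s)^2 - (w s)^2\<bar> * k + \<bar>v s - z s\<bar> * k)"
      proof (rule mult_left_mono[OF add_mono])
        have p: "0 \<le> L1 / m1 + L2 / m2" "0 \<le> 4 * q * (L1 / q + L2 / q)"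
          using L1(1) L2(1) m1(1) m2(1) q by auto
        show "\<bar>(u s)^2 - (w s)^2\<bar> * \<bar>w1 s / w s - u1 s / u s\<bar> \<le> \<bar>(u s)^2 - (w s)^2\<bar> * k"
          by (rule order_trans[OF 1]) (use p in \<open>auto simp: k_def intro!: mult_left_mono\<close>)
        have "(\<bar>v s - z s\<bar> * (4 * q)) * (L1 / q + L2 / q) = \<bar>v s - z s\<bar> * (4 * q * (L1 / q + L2 / q))" by simp
        also have "\<dots> \<le> \<bar>v s - z s\<bar> * k" using p unfolding k_def by (intro mult_left_mono) linarith+
        finally show "\<bar>(v s)^2 - (z s)^2\<bar> * \<bar>z1 s / z s - v1 s / v s\<bar> \<le> \<bar>v s - z s\<bar> * k"
          using 2 by linarith
      qed (use s0 in auto)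
      finally show ?thesis by (simp add: algebra_simps)
    qed
    show False
    proof (cases rule: at_end_cases[OF R])
      case 1
      have dom: "s \<in> dom0 R" if "r \<le> s" for s using that r0 1 by (simp add: dom0_def)
      define c where "c = mu / (2 * k^2)"
      have c0: "0 < c" unfolding c_def using mu_pos k0 by simp
      \<comment> \<open>The linear bound for \<open>F\<close> squared, with (X + Y)^2 \<le> 2 (X^2 +
        Y^2), meets the lower bound \<open>s * mu * \<Delta> s\<close> for \<open>- F'\<close>; this
        fixes \<open>c = mu / (2 * k^2)\<close>.\<close>
      have key: "c * (F s)^2 \<le> s * (- F' s)" if s: "r \<le> s" for s
      proof -
        have s0: "0 < s" using s r0 by simp
        define X Y where "X = \<bar>(u s)^2 - (w s)^2\<bar>" and "Y = \<bar>v s - z s\<bar>"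
        have "\<bar>F s\<bar>^2 \<le> (k * s * (X + Y))^2" unfolding X_def Y_def using bound[OF dom[OF s] s] by (intro power_mono) auto
        also have "\<dots> = (k * s)^2 * (X + Y)^2" by (simp add: power_mult_distrib)
        also have "\<dots> \<le> (k * s)^2 * (2 * (X^2 + Y^2))"
          using zero_le_power2[of "X - Y"] by (intro mult_left_mono) (auto simp: power2_sum power2_diff)
        also have "X^2 + Y^2 = \<Delta> s" by (simp add: X_def Y_def \<Delta>_def)
        finally have "c * (F s)^2 \<le> c * ((k * s)^2 * (2 * \<Delta> s))" using c0 by (intro mult_left_mono) auto
        also have "\<dots> = s * (s * (mu * \<Delta> s))" using k0 by (simp add: c_def field_simps power2_eq_square)
        also have "\<dots> \<le> s * (- F' s)" using F'_le[OF dom[OF s]] s0 by (intro mult_left_mono) auto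
        finally show ?thesis .
      qed
      have mono: "1 / F r - c * ln r \<le> 1 / F s - c * ln s" if s: "r \<le> s" for s
      proof (rule DERIV_nonneg_imp_nondecreasing[OF s])
        fix t assume t: "r \<le> t" "t \<le> s"
        have nz: "F t \<noteq> 0" "t \<noteq> 0" using neg' dom t neg r0 by force+
        have "((\<lambda>s. 1 / F s - c * ln s) has_real_derivative (- F' t / (F t)^2 - c * (1 / t))) (at t)"
          using nz t r0 dF[OF dom[OF t(1)]] by (auto intro!: derivative_eq_intros simp: power2_eq_square)
        moreover have "0 \<le> - F' t / (F t)^2 - c * (1 / t)"
          using key[OF t(1)] nz t r0 by (simp add: field_simps)
        ultimately show "\<exists>y. ((\<lambda>s. 1 / F s - c * ln s) has_real_derivative y) (at t) \<and> 0 \<le> y" by blast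
      qed
      \<comment> \<open>The radius at which \<open>c * ln s - c * ln r\<close> has consumed
        \<open>- 1 / F r\<close>: monotonicity gives \<open>1 / F s \<ge> 0\<close>, although
        \<open>F s < 0\<close>.\<close>
      define s where "s = r * exp (- (1 / F r) / c)"
      have s: "r \<le> s" using r0 neg c0 by (auto simp: s_def mult_le_0_iff)
      have "ln s = ln r - (1 / F r) / c" using r0 by (simp add: s_def ln_mult)
      then have "c * ln s = c * ln r - 1 / F r" using c0 by (simp add: right_diff_distrib)
      then have "0 \<le> 1 / F s" using mono[OF s] by linarith
      moreover have "F s < 0" using neg' dom s neg by force
      ultimately show False by (simp add: field_simps)
    next
      case (2 y)
      \<comment> \<open>For finite \<open>R\<close> both solutions have the same boundary values and
        the radius is bounded, so the linear bound already sends \<open>F\<close> to 0.\<close>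
      have "((\<lambda>s. k * y * (\<bar>(u s)^2 - (w s)^2\<bar> + \<bar>v s - z s\<bar>)) \<longlongrightarrow>
         k * y * (\<bar>(sqrt 3 * q)^2 - (sqrt 3 * q)^2\<bar> + \<bar>- q - (- q)\<bar>)) (at_end R)"
        by (intro tendsto_intros uR vR S.uR S.vR)
      then have "eventually (\<lambda>s. k * y * (\<bar>(u s)^2 - (w s)^2\<bar> + \<bar>v s - z s\<bar>) < - F r) (at_end R)"
        using neg by (intro order_tendstoD(2)) auto
      then have "eventually (\<lambda>s. s \<in> dom0 R \<and> r < s \<and> k * y * (\<bar>(u s)^2 - (w s)^2\<bar> + \<bar>v s - z s\<bar>) < - F r) (at_end R)"
        using eventually_at_end[OF r] by eventually_elim auto
      then obtain s where s: "s \<in> dom0 R" "r < s" "k * y * (\<bar>(u s)^2 - (w s)^2\<bar> + \<bar>v s - z s\<bar>) < - F r"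
        using eventually_happens at_end_neq_bot[OF R] by blast
      have "s \<le> y" using s 2 by (simp add: dom0_def)
      then have "k * s * (\<bar>(u s)^2 - (w s)^2\<bar> + \<bar>v s - z s\<bar>) \<le> k * y * (\<bar>(u s)^2 - (w s)^2\<bar> + \<bar>v s - z s\<bar>)"
        using k0 by (intro mult_right_mono mult_left_mono) auto
      then have "\<bar>F s\<bar> < - F r" using bound[OF s(1)] s by linarith
      then show False using neg'[OF s(1)] s neg by linarith
    qed
  qed
  \<comment> \<open>Since \<open>F\<close> vanishes on the open interval, so does \<open>F'\<close>,
    and \<open>F'_le\<close> then forces \<open>\<Delta> r = 0\<close>.\<close>
  have "((\<lambda>_. 0) has_real_derivative F' r) (at r)"
    by (rule has_field_derivative_transform_within_open[OF dF[OF r] open_dom0 r]) (use F_zero in auto)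
  then have "F' r = 0" using DERIV_unique[OF _ DERIV_const] by blast
  then have "r * (mu * \<Delta> r) \<le> 0" using F'_le[OF r] by simp
  then have "\<Delta> r \<le> 0" using r mu_pos by (auto simp: dom0_def mult_le_0_iff)
  then have "(u r)^2 = (w r)^2" "v r = z r"
    by (auto simp: \<Delta>_def sum_power2_le_zero_iff)
  then show ?thesis using upos[OF r] S.upos[OF r] by (simp add: power2_eq_iff_nonneg)
qed

end

section \<open>A Green operator with elementary kernel\<close>

text \<open>The operator \<open>- \<Delta> + V\<close>, \<open>V = m\<^sup>2/r\<^sup>2 + 4 \<alpha> (m + 1) + 4 \<alpha>\<^sup>2 r\<^sup>2\<close>, annihilates \<open>r\<^sup>m exp (\<alpha> r\<^sup>2)\<close>; the
  mass term is chosen to grow with \<open>r\<close> in order to have this elementary homogeneous solution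
  instead of a Bessel function. \<open>T \<phi>\<close> solves \<open>(- \<Delta> + V) z = V \<phi>\<close>, regular at the origin and with
  zero boundary values at \<open>R\<close>.\<close>

locale radial_green =
  fixes \<alpha> :: real and m :: nat and R :: ereal
  assumes \<alpha>: "0 < \<alpha>" and R: "0 < R"
begin

definition I :: "real \<Rightarrow> real" where "I r = r ^ m * exp (\<alpha> * r^2)"
text \<open>The flux \<open>r * I'\<close> of the homogeneous solution.\<close>

definition N :: "real \<Rightarrow> real" where "N r = I r * (real m + 2 * \<alpha> * r^2)"
definition M :: "real \<Rightarrow> real" where "M r = 4 * \<alpha> * (real m + 1) + 4 * \<alpha>^2 * r^2"
definition V :: "real \<Rightarrow> real" where "V r = (real m)^2 / r^2 + M r"
text \<open>The product \<open>r * V r * I r\<close> written without negative powers, hence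
  continuous also at 0; for \<open>m = 0\<close> the factor \<open>m^2\<close> removes the term with
  the truncated exponent.\<close>

definition ker :: "real \<Rightarrow> real" where
  "ker r = exp (\<alpha> * r^2) * ((real m)^2 * r ^ (m - 1) + r ^ (m + 1) * M r)"
text \<open>Reduction of order: for z = I Z the equation reads (s I^2 Z')' = - s V I \<phi>.
  \<open>J\<close> is the first integration, from the origin, and \<open>Z\<close> the second, from
  the end \<open>R\<close>.\<close>

definition J :: "(real \<Rightarrow> real) \<Rightarrow> real \<Rightarrow> real" where
  "J \<phi> s = (LINT t:{0..s}|lborel. ker t * \<phi> t)"
definition Z :: "(real \<Rightarrow> real) \<Rightarrow> real \<Rightarrow> real" where
  "Z \<phi> r = (LINT s:einterval r R|lborel. J \<phi> s / (s * (I s)^2))"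
definition T :: "(real \<Rightarrow> real) \<Rightarrow> real \<Rightarrow> real" where "T \<phi> r = I r * Z \<phi> r"

lemma I_pos: "0 < r \<Longrightarrow> 0 < I r" by (simp add: I_def)
lemma M_pos: "0 < M r" unfolding M_def using \<alpha> by (intro add_pos_nonneg) auto
lemma V_pos: "0 < V r" unfolding V_def using M_pos by (intro add_nonneg_pos) auto
lemma N_nonneg: "0 \<le> r \<Longrightarrow> 0 \<le> N r" unfolding N_def I_def using \<alpha> by auto
lemma N_0: "N 0 = 0" unfolding N_def I_def by (auto simp: power_0_left)
lemma ker_nonneg: "0 \<le> r \<Longrightarrow> 0 \<le> ker r" unfolding ker_def using M_pos[of r] by auto

lemma ker_eq: "0 < r \<Longrightarrow> ker r = r * V r * I r"
  unfolding ker_def V_def I_def M_def by (cases m) (auto simp: field_simps power2_eq_square)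

lemma DERIV_gauss: "((\<lambda>r. exp (\<alpha> * r^2)) has_real_derivative exp (\<alpha> * r^2) * (2 * \<alpha> * r)) (at r)"
  by (auto intro!: derivative_eq_intros)

lemma DERIV_I:
  assumes "0 < r" shows "(I has_real_derivative N r / r) (at r)"
  unfolding I_def[abs_def] N_def
  by (rule DERIV_cong[OF DERIV_mult[OF DERIV_pow DERIV_gauss]])
    (use assms in \<open>cases m; simp add: field_simps power2_eq_square\<close>)

lemma DERIV_N: "(N has_real_derivative ker r) (at r)"
proof -
  have "((\<lambda>r. real m + 2 * \<alpha> * r^2) has_real_derivative 4 * \<alpha> * r) (at r)"
    by (auto intro!: derivative_eq_intros)
  from DERIV_mult[OF DERIV_mult[OF DERIV_pow DERIV_gauss] this] show ?thesis
    unfolding I_def[abs_def] N_def[abs_def] ker_def M_def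
    by (rule DERIV_cong) (cases m; simp add: algebra_simps power2_eq_square)
qed

lemma continuous_I: "continuous_on S I" unfolding I_def[abs_def] by (intro continuous_intros)
lemma continuous_ker: "continuous_on S ker" unfolding ker_def[abs_def] M_def by (intro continuous_intros)
lemma continuous_M: "continuous_on S M" unfolding M_def[abs_def] by (intro continuous_intros)

lemma N_tendsto_0: "(N \<longlongrightarrow> 0) (at_right 0)"
proof -
  have "isCont N 0" using DERIV_N by (rule DERIV_isCont)
  then show ?thesis unfolding continuous_at N_0 by (rule tendsto_within_subset) auto
qed

lemma DERIV_inverse_I:
  assumes "0 < r" shows "((\<lambda>r. - (1 / I r)) has_real_derivative N r / (r * (I r)^2)) (at r)"
proof -
  have "I r \<noteq> 0" using I_pos[OF assms] by simp
  then show ?thesis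
    by (auto intro!: derivative_eq_intros DERIV_I[OF assms] simp: power2_eq_square)
qed

lemma ker_integral:
  assumes "s \<le> t"
  shows "set_integrable lborel {s..t} ker" "(LINT x:{s..t}|lborel. ker x) = N t - N s"
  by (rule set_integral_FTC[OF assms DERIV_N continuous_ker])+

definition \<iota> :: real where "\<iota> = (if R = \<infinity> then 0 else 1 / I (real_of_ereal R))"

lemma \<iota>_nonneg: "0 \<le> \<iota>"
  unfolding \<iota>_def using R I_pos by (cases R) (auto simp: less_imp_le)

lemma inverse_I_tendsto: "((\<lambda>r. 1 / I r) \<longlongrightarrow> \<iota>) (at_end R)"
proof (cases rule: at_end_cases[OF R])
  case 1
  have "filterlim I at_top at_top"
  proof (rule filterlim_at_top_mono)
    show "filterlim (\<lambda>r. \<alpha> * r) at_top at_top"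
      using \<alpha> by (intro filterlim_tendsto_pos_mult_at_top[OF tendsto_const] filterlim_ident)
    show "eventually (\<lambda>r. \<alpha> * r \<le> I r) at_top"
      using eventually_ge_at_top[of 1]
    proof eventually_elim
      case (elim r)
      have "\<alpha> * r \<le> \<alpha> * r^2" using elim \<alpha> by (intro mult_left_mono) (auto simp: power2_eq_square)
      also have "\<dots> \<le> exp (\<alpha> * r^2)" using exp_ge_add_one_self[of "\<alpha> * r^2"] by linarith
      also have "\<dots> \<le> I r" using one_le_power[of r m] elim by (simp add: I_def mult_le_cancel_right1)
      finally show ?case .
    qed
  qed
  then have "((\<lambda>r. inverse (I r)) \<longlongrightarrow> 0) at_top" by (rule tendsto_inverse_0_at_top)
  moreover have "\<iota> = 0" unfolding \<iota>_def using 1 by simp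
  ultimately show ?thesis by (simp only: 1(2) inverse_eq_divide)
next
  case (2 y)
  have "isCont (\<lambda>r. - (1 / I r)) y" using DERIV_isCont[OF DERIV_inverse_I[OF 2(2)]] .
  then have "isCont (\<lambda>r. - (- (1 / I r))) y" by (rule isCont_minus)
  then have "((\<lambda>r. 1 / I r) \<longlongrightarrow> 1 / I y) (at y)" unfolding continuous_at by simp
  then have "((\<lambda>r. 1 / I r) \<longlongrightarrow> 1 / I y) (at_left y)" by (rule tendsto_within_subset) auto
  moreover have "\<iota> = 1 / I y" unfolding \<iota>_def using 2 by simp
  ultimately show ?thesis by (simp only: 2(3))
qed

lemma einterval_dom0: "r \<in> dom0 R \<Longrightarrow> s \<in> einterval r R \<Longrightarrow> s \<in> dom0 R \<and> r < s \<and> 0 < s"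
  by (auto simp: einterval_def dom0_def)

text \<open>The case \<phi> = 1, in which \<open>J\<close> is \<open>N\<close> and the outer
  integrand is the derivative of \<open>- (1 / I)\<close>. It serves as majorant for every bounded
  source.\<close>

lemma outer_weight:
  assumes r: "r \<in> dom0 R"
  shows "set_integrable lborel (einterval r R) (\<lambda>s. N s / (s * (I s)^2))"
    "(LINT s:einterval r R|lborel. N s / (s * (I s)^2)) = 1 / I r - \<iota>"
proof -
  have r0: "0 < r" "ereal r < R" using r by (auto simp: dom0_def)
  have pos: "0 < x" if "ereal r < ereal x" for x using that r0 by simp
  have A: "(((\<lambda>r. - (1 / I r)) \<circ> real_of_ereal) \<longlongrightarrow> - (1 / I r)) (at_right (ereal r))"
  proof -
    have "((\<lambda>r. - (1 / I r)) \<longlongrightarrow> - (1 / I r)) (at_right r)"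
      using DERIV_isCont[OF DERIV_inverse_I[OF r0(1)]] unfolding continuous_at by (rule tendsto_within_subset) auto
    then show ?thesis by (simp add: ereal_tendsto_simps1)
  qed
  have B: "(((\<lambda>r. - (1 / I r)) \<circ> real_of_ereal) \<longlongrightarrow> - \<iota>) (at_left R)"
    using tendsto_minus[OF inverse_I_tendsto]
    by (cases rule: at_end_cases[OF R]) (simp_all add: ereal_tendsto_simps1)
  have C: "isCont (\<lambda>s. N s / (s * (I s)^2)) x" if "0 < x" for x
    using that I_pos[OF that] DERIV_isCont[OF DERIV_N] DERIV_isCont[OF DERIV_I[OF that]]
    by (intro continuous_intros) auto
  have nn: "AE x in lborel. ereal r < ereal x \<longrightarrow> ereal x < R \<longrightarrow> 0 \<le> N x / (x * (I x)^2)"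
    by (rule AE_I2) (use r0 N_nonneg in auto)
  note FTC = interval_integral_FTC_nonneg[OF r0(2) DERIV_inverse_I[OF pos] C[OF pos] nn A B]
  show "set_integrable lborel (einterval r R) (\<lambda>s. N s / (s * (I s)^2))" using FTC(1) by simp
  show "(LINT s:einterval r R|lborel. N s / (s * (I s)^2)) = 1 / I r - \<iota>"
    using FTC(2) r0 by (simp add: interval_lebesgue_integral_def less_imp_le)
qed

lemma tail_integral_deriv:
  fixes f :: "real \<Rightarrow> real"
  assumes f: "continuous_on (dom0 R) f" and i: "\<And>r. r \<in> dom0 R \<Longrightarrow> set_integrable lborel (einterval r R) f"
    and r: "r \<in> dom0 R"
  shows "((\<lambda>r. LINT s:einterval r R|lborel. f s) has_real_derivative - f r) (at r)"
proof -
  have r0: "0 < r" "ereal r < R" using r by (auto simp: dom0_def)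
  obtain b where b: "b \<in> dom0 R" "r < b"
    using ereal_dense2[OF r0(2)] r0 by (auto simp: dom0_def)
  define a where "a = r / 2"
  have a: "0 < a" "a < r" using r0 by (auto simp: a_def)
  have ad: "a \<in> dom0 R" using dom0_downward[OF r] a by simp
  have sub: "{a..b} \<subseteq> dom0 R" using dom0_Icc[OF b(1) a(1)] by auto
  have cf: "continuous_on {a..b} f" by (rule continuous_on_subset[OF f sub])
  have split: "(LINT s:einterval x R|lborel. f s) = (LINT s:einterval a R|lborel. f s) - integral {a..x} f"
    if x: "a \<le> x" "x \<le> b" for x
  proof -
    have xd: "x \<in> dom0 R" using sub x by auto
    have "ereal x < R" using xd by (simp add: dom0_def)
    then have un: "einterval a R = {a<..x} \<union> einterval x R"
      using x by (auto simp: einterval_def) (metis ereal_less_eq(3) le_less_trans)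
    have ix: "set_integrable lborel {a..x} f"
      using x by (intro borel_integrable_atLeastAtMost' continuous_on_subset[OF cf]) auto
    have ix': "set_integrable lborel {a<..x} f" by (rule set_integrable_subset[OF ix]) auto
    have "(LINT s:einterval a R|lborel. f s) = (LINT s:{a<..x}|lborel. f s) + (LINT s:einterval x R|lborel. f s)"
      unfolding un by (rule set_integral_Un[OF _ ix' i[OF xd]]) (auto simp: einterval_def)
    also have "(LINT s:{a<..x}|lborel. f s) = (LINT s:{a..x}|lborel. f s)"
    proof (rule set_integral_cong_set)
      show "set_borel_measurable lborel {a<..x} f" "set_borel_measurable lborel {a..x} f"
        using ix ix' unfolding set_integrable_def set_borel_measurable_def by (auto intro: borel_measurable_integrable)
      show "AE s in lborel. (s \<in> {a..x}) = (s \<in> {a<..x})"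
        using AE_lborel_singleton[of a] by eventually_elim auto
    qed
    also have "\<dots> = integral {a..x} f" by (rule set_borel_integral_eq_integral(2)[OF ix])
    finally show ?thesis by simp
  qed
  have "((\<lambda>x. integral {a..x} f) has_real_derivative f r) (at r within {a..b})"
    by (rule integral_has_real_derivative[OF cf]) (use a b in auto)
  then have "((\<lambda>x. integral {a..x} f) has_real_derivative f r) (at r)"
    using a b by (simp add: at_within_Icc_at)
  then have "((\<lambda>x. (LINT s:einterval a R|lborel. f s) - integral {a..x} f) has_real_derivative - f r) (at r)"
    by (auto intro!: derivative_eq_intros)
  then show ?thesis
  proof (rule has_field_derivative_transform_within_open[of _ _ _ "{a<..<b}"])
    show "(LINT s:einterval a R|lborel. f s) - integral {a..x} f = (LINT s:einterval x R|lborel. f s)"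
      if "x \<in> {a<..<b}" for x using split[of x] that by simp
  qed (use a b in auto)
qed

text \<open>Sources are only bounded and measurable here, because the monotone limit of the
  iteration is not known to be continuous before it is recognised as a value of
  \<open>T\<close>.\<close>

context
  fixes \<phi> :: "real \<Rightarrow> real" and K :: real
  assumes \<phi>_meas: "\<phi> \<in> borel_measurable borel" and \<phi>_bounds: "\<And>t. 0 \<le> \<phi> t \<and> \<phi> t \<le> K"
begin

lemma ker_phi_integrable: "0 \<le> s \<Longrightarrow> s \<le> t \<Longrightarrow> set_integrable lborel {s..t} (\<lambda>x. ker x * \<phi> x)"
proof (rule set_integrable_bound[where f = "\<lambda>x. ker x * K"])
  assume st: "0 \<le> s" "s \<le> t"
  show "set_integrable lborel {s..t} (\<lambda>x. ker x * K)" using ker_integral(1)[OF st(2)] by simp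
  have [measurable]: "\<phi> \<in> borel_measurable borel" "ker \<in> borel_measurable borel"
    using \<phi>_meas continuous_ker by (auto intro: borel_measurable_continuous_onI)
  show "set_borel_measurable lborel {s..t} (\<lambda>x. ker x * \<phi> x)"
    unfolding set_borel_measurable_def by measurable
  show "AE x in lborel. x \<in> {s..t} \<longrightarrow> norm (ker x * \<phi> x) \<le> norm (ker x * K)"
  proof (intro AE_I2 impI)
    fix x assume "x \<in> {s..t}"
    show "norm (ker x * \<phi> x) \<le> norm (ker x * K)"
      unfolding norm_mult using \<phi>_bounds[of x] by (intro mult_left_mono) auto
  qed
qed

lemma J_eq_integral: "0 \<le> s \<Longrightarrow> J \<phi> s = integral {0..s} (\<lambda>x. ker x * \<phi> x)"
  unfolding J_def by (rule set_borel_integral_eq_integral(2)[OF ker_phi_integrable]) auto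

lemma J_diff: 
  assumes "0 \<le> s" "s \<le> t"
  shows "J \<phi> t - J \<phi> s = integral {s..t} (\<lambda>x. ker x * \<phi> x)"
proof -
  have "(\<lambda>x. ker x * \<phi> x) integrable_on {0..t}"
    using set_borel_integral_eq_integral(1)[OF ker_phi_integrable] assms by auto
  from Henstock_Kurzweil_Integration.integral_combine[OF assms this] show ?thesis using assms by (simp add: J_eq_integral)
qed

lemma J_increment: 
  assumes "0 \<le> s" "s \<le> t"
  shows "0 \<le> J \<phi> t - J \<phi> s" "J \<phi> t - J \<phi> s \<le> K * (N t - N s)"
proof -
  have i: "(\<lambda>x. ker x * \<phi> x) integrable_on {s..t}"
    using set_borel_integral_eq_integral(1)[OF ker_phi_integrable] assms by auto
  show "0 \<le> J \<phi> t - J \<phi> s" unfolding J_diff[OF assms]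
    using assms ker_nonneg \<phi>_bounds by (intro integral_nonneg[OF i]) auto
  have k: "(ker has_integral (N t - N s)) {s..t}"
    by (rule fundamental_theorem_of_calculus[OF assms(2)])
      (use DERIV_N in \<open>auto simp flip: has_real_derivative_iff_has_vector_derivative intro: has_field_derivative_at_within\<close>)
  have "integral {s..t} (\<lambda>x. ker x * \<phi> x) \<le> K * (N t - N s)"
    using assms ker_nonneg \<phi>_bounds
    by (intro has_integral_le[OF integrable_integral[OF i] has_integral_mult_right[OF k, of K]])
      (simp add: mult.commute[of K] mult_left_mono)
  then show "J \<phi> t - J \<phi> s \<le> K * (N t - N s)" unfolding J_diff[OF assms] .
qed

lemma J_0: "J \<phi> 0 = 0" by (simp add: J_eq_integral)

lemma J_bounds: "0 \<le> s \<Longrightarrow> 0 \<le> J \<phi> s \<and> J \<phi> s \<le> K * N s"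
  using J_increment[of 0 s] by (simp add: J_0 N_0)

lemma continuous_J: "continuous_on {0<..} (J \<phi>)"
proof (intro continuous_at_imp_continuous_on ballI)
  fix s :: real assume s: "s \<in> {0<..}"
  have K0: "0 \<le> K" using \<phi>_bounds[of 0] by simp
  have "((\<lambda>t. J \<phi> t - J \<phi> s) \<longlongrightarrow> 0) (at s)"
  proof (rule Lim_null_comparison)
    have "eventually (\<lambda>t. t \<in> {0<..}) (at s)" using s by (intro eventually_at_in_open') auto
    then show "eventually (\<lambda>t. norm (J \<phi> t - J \<phi> s) \<le> K * \<bar>N t - N s\<bar>) (at s)"
    proof eventually_elim
      case (elim t)
      have ab: "K * (N t - N s) \<le> K * \<bar>N t - N s\<bar>" "K * (N s - N t) \<le> K * \<bar>N t - N s\<bar>"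
        using K0 by (auto intro: mult_left_mono)
      show ?case
      proof (cases "s \<le> t")
        case True
        then show ?thesis using J_increment[of s t] s ab by auto
      next
        case False
        then show ?thesis using J_increment[of t s] elim ab by auto
      qed
    qed
    have "(N \<longlongrightarrow> N s) (at s)" using DERIV_isCont[OF DERIV_N] unfolding continuous_at .
    then have "((\<lambda>t. K * \<bar>N t - N s\<bar>) \<longlongrightarrow> K * \<bar>N s - N s\<bar>) (at s)" by (intro tendsto_intros)
    then show "((\<lambda>t. K * \<bar>N t - N s\<bar>) \<longlongrightarrow> 0) (at s)" by simp
  qed
  then show "isCont (J \<phi>) s" unfolding continuous_at by (rule LIM_zero_cancel)
qed

lemma DERIV_J:
  assumes c: "continuous_on (dom0 R) \<phi>" and r: "r \<in> dom0 R"
  shows "(J \<phi> has_real_derivative ker r * \<phi> r) (at r)"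
proof -
  have r0: "0 < r" "ereal r < R" using r by (auto simp: dom0_def)
  obtain b where b: "b \<in> dom0 R" "r < b"
    using ereal_dense2[OF r0(2)] r0 by (auto simp: dom0_def)
  define a where "a = r / 2"
  have a: "0 < a" "a < r" using r0 by (auto simp: a_def)
  have sub: "{a..b} \<subseteq> dom0 R" using dom0_Icc[OF b(1) a(1)] by auto
  have cf: "continuous_on {a..b} (\<lambda>x. ker x * \<phi> x)"
    by (intro continuous_intros continuous_ker continuous_on_subset[OF c sub])
  have "((\<lambda>x. integral {a..x} (\<lambda>x. ker x * \<phi> x)) has_real_derivative ker r * \<phi> r) (at r within {a..b})"
    by (rule integral_has_real_derivative[OF cf]) (use a b in auto)
  then have "((\<lambda>x. J \<phi> a + integral {a..x} (\<lambda>x. ker x * \<phi> x)) has_real_derivative ker r * \<phi> r) (at r)"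
    using a b by (auto simp: at_within_Icc_at intro!: derivative_eq_intros)
  then show ?thesis
  proof (rule has_field_derivative_transform_within_open[of _ _ _ "{a<..<b}"])
    show "J \<phi> a + integral {a..x} (\<lambda>x. ker x * \<phi> x) = J \<phi> x" if "x \<in> {a<..<b}" for x
      using J_diff[of a x] that a by simp
  qed (use a b in auto)
qed

lemma outer_continuous: "continuous_on {0<..} (\<lambda>s. J \<phi> s / (s * (I s)^2))"
  by (intro continuous_intros continuous_J continuous_I) (auto dest: I_pos)

lemma outer_integrable:
  assumes r: "r \<in> dom0 R"
  shows "set_integrable lborel (einterval r R) (\<lambda>s. J \<phi> s / (s * (I s)^2))"
proof (rule set_integrable_bound)
  show "set_integrable lborel (einterval r R) (\<lambda>s. K * (N s / (s * (I s)^2)))"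
    by (rule set_integrable_mult_right) (rule outer_weight(1)[OF r])
  have "continuous_on (einterval r R) (\<lambda>s. J \<phi> s / (s * (I s)^2))"
    using einterval_dom0[OF r] by (intro continuous_on_subset[OF outer_continuous]) auto
  then show "set_borel_measurable lborel (einterval r R) (\<lambda>s. J \<phi> s / (s * (I s)^2))"
    unfolding set_borel_measurable_def by (simp add: borel_measurable_continuous_on_indicator del: real_scaleR_def)
  show "AE s in lborel. s \<in> einterval r R \<longrightarrow> norm (J \<phi> s / (s * (I s)^2)) \<le> norm (K * (N s / (s * (I s)^2)))"
  proof (intro AE_I2 impI)
    fix s assume "s \<in> einterval r R"
    then have s: "0 < s" using einterval_dom0[OF r] by blast
    have "J \<phi> s / (s * (I s)^2) \<le> K * N s / (s * (I s)^2)"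
      using J_bounds[of s] s by (intro divide_right_mono) auto
    moreover have "0 \<le> J \<phi> s / (s * (I s)^2)" using J_bounds[of s] s by auto
    ultimately show "norm (J \<phi> s / (s * (I s)^2)) \<le> norm (K * (N s / (s * (I s)^2)))"
      unfolding real_norm_def times_divide_eq_right by linarith
  qed
qed

lemma Z_bounds:
  assumes r: "r \<in> dom0 R"
  shows "0 \<le> Z \<phi> r" "Z \<phi> r \<le> K * (1 / I r - \<iota>)"
proof -
  have p: "0 \<le> J \<phi> s / (s * (I s)^2) \<and> J \<phi> s / (s * (I s)^2) \<le> K * (N s / (s * (I s)^2))" if "s \<in> einterval r R" for s
  proof -
    have s: "0 < s" using that einterval_dom0[OF r] by blast
    have "J \<phi> s / (s * (I s)^2) \<le> K * N s / (s * (I s)^2)"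
      using J_bounds[of s] s by (intro divide_right_mono) auto
    then show ?thesis using J_bounds[of s] s by auto
  qed
  show "0 \<le> Z \<phi> r" unfolding Z_def set_lebesgue_integral_def
    using p by (intro Bochner_Integration.integral_nonneg) (auto split: split_indicator)
  have "Z \<phi> r \<le> (LINT s:einterval r R|lborel. K * (N s / (s * (I s)^2)))"
    unfolding Z_def using p
    by (intro set_integral_mono outer_integrable[OF r] set_integrable_mult_right outer_weight(1)[OF r]) auto
  also have "\<dots> = K * (1 / I r - \<iota>)" by (simp only: set_integral_mult_right outer_weight(2)[OF r])
  finally show "Z \<phi> r \<le> K * (1 / I r - \<iota>)" .
qed

lemma Z_tendsto_0: "(Z \<phi> \<longlongrightarrow> 0) (at_end R)"
proof (rule tendsto_sandwich[OF _ _ tendsto_const])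
  obtain x where x: "x \<in> dom0 R" using dom0_nonempty[OF R] by blast
  show "eventually (\<lambda>r. 0 \<le> Z \<phi> r) (at_end R)" "eventually (\<lambda>r. Z \<phi> r \<le> K * (1 / I r - \<iota>)) (at_end R)"
    using eventually_at_end[OF x] Z_bounds by (auto elim: eventually_mono)
  have "((\<lambda>r. K * (1 / I r - \<iota>)) \<longlongrightarrow> K * (\<iota> - \<iota>)) (at_end R)"
    by (intro tendsto_intros inverse_I_tendsto)
  then show "((\<lambda>r. K * (1 / I r - \<iota>)) \<longlongrightarrow> 0) (at_end R)" by simp
qed

lemma DERIV_Z:
  assumes r: "r \<in> dom0 R"
  shows "(Z \<phi> has_real_derivative - (J \<phi> r / (r * (I r)^2))) (at r)"
  unfolding Z_def[abs_def]
  by (rule tail_integral_deriv[OF continuous_on_subset[OF outer_continuous] outer_integrable r]) (auto simp: dom0_def)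

definition T1 :: "real \<Rightarrow> real" where "T1 r = (N r * Z \<phi> r - J \<phi> r / I r) / r"

lemma DERIV_T:
  assumes r: "r \<in> dom0 R"
  shows "(T \<phi> has_real_derivative T1 r) (at r)"
proof -
  have r0: "0 < r" using r by (simp add: dom0_def)
  show ?thesis unfolding T_def[abs_def]
    by (rule DERIV_cong[OF DERIV_mult[OF DERIV_I[OF r0] DERIV_Z[OF r]]])
      (use r0 I_pos[OF r0] in \<open>simp add: T1_def field_simps power2_eq_square\<close>)
qed

text \<open>The flux of \<open>T \<phi>\<close> is \<open>N * Z - J / I\<close>; on differentiation
  the two terms \<open>N * J / (r * I^2)\<close> cancel.\<close>

lemma T_flux:
  assumes c: "continuous_on (dom0 R) \<phi>" and r: "r \<in> dom0 R"
  shows "((\<lambda>s. s * T1 s) has_real_derivative r * (V r * (T \<phi> r - \<phi> r))) (at r)"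
proof -
  have r0: "0 < r" using r by (simp add: dom0_def)
  have I0: "I r \<noteq> 0" using I_pos[OF r0] by simp
  have "((\<lambda>s. N s * Z \<phi> s - J \<phi> s / I s) has_real_derivative r * (V r * (T \<phi> r - \<phi> r))) (at r)"
    by (rule DERIV_cong[OF DERIV_diff[OF DERIV_mult[OF DERIV_N DERIV_Z[OF r]] DERIV_divide[OF DERIV_J[OF c r] DERIV_I[OF r0] I0]]])
      (use r0 I0 in \<open>simp add: T_def ker_eq field_simps power2_eq_square\<close>)
  then show ?thesis
    by (rule has_field_derivative_transform_within_open[of _ _ _ "{0<..}"]) (use r0 in \<open>auto simp: T1_def\<close>)
qed

lemma T_nonneg: "r \<in> dom0 R \<Longrightarrow> 0 \<le> T \<phi> r"
  using Z_bounds(1) I_pos by (auto simp: T_def dom0_def less_imp_le)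

lemma T_le:
  assumes r: "r \<in> dom0 R" shows "T \<phi> r \<le> K"
proof -
  have r0: "0 < r" using r by (simp add: dom0_def)
  have K0: "0 \<le> K" using \<phi>_bounds[of 0] by simp
  have "T \<phi> r \<le> I r * (K * (1 / I r - \<iota>))" unfolding T_def
    using Z_bounds(2)[OF r] I_pos[OF r0] by (intro mult_left_mono) auto
  also have "\<dots> = K - K * (\<iota> * I r)" using I_pos[OF r0] by (simp add: field_simps)
  also have "\<dots> \<le> K" using K0 \<iota>_nonneg I_pos[OF r0] by simp
  finally show ?thesis .
qed

lemma continuous_T: "continuous_on (dom0 R) (T \<phi>)"
  by (intro continuous_at_imp_continuous_on ballI DERIV_isCont[OF DERIV_T])

text \<open>Comparison by integrating twice. \<open>X\<close>, a Wronskian of \<open>W\<close> and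
  \<open>I\<close> minus \<open>J\<close>, is nondecreasing by the supersolution inequality and
  starts from 0. Hence \<open>D = W / I - Z\<close> is nonincreasing, and at the end it cannot be
  negative because \<open>W \<ge> 0\<close> and \<open>Z\<close> tends to 0.\<close>

lemma T_le_supersolution:
  assumes c: "continuous_on (dom0 R) \<phi>"
    and W: "\<And>r. r \<in> dom0 R \<Longrightarrow> 0 \<le> W r"
    and dW: "\<And>r. r \<in> dom0 R \<Longrightarrow> (W has_real_derivative W1 r) (at r)"
    and ddW: "\<And>r. r \<in> dom0 R \<Longrightarrow> ((\<lambda>s. s * W1 s) has_real_derivative r * L r) (at r)"
    and super: "\<And>r. r \<in> dom0 R \<Longrightarrow> V r * \<phi> r \<le> V r * W r - L r"
    and lim: "((\<lambda>r. N r * W r - I r * (r * W1 r)) \<longlongrightarrow> 0) (at_right 0)"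
    and r: "r \<in> dom0 R"
  shows "T \<phi> r \<le> W r"
proof -
  define X where "X = (\<lambda>r. N r * W r - I r * (r * W1 r) - J \<phi> r)"
  have X_mono: "X s \<le> X t" if st: "0 < s" "s \<le> t" "t \<in> dom0 R" for s t
  proof (rule DERIV_nonneg_imp_nondecreasing[OF st(2)])
    fix x assume x: "s \<le> x" "x \<le> t"
    then have xd: "x \<in> dom0 R" and x0: "0 < x" using dom0_Icc[OF st(3) st(1)] st by auto
    have "(X has_real_derivative x * I x * (V x * W x - L x - V x * \<phi> x)) (at x)"
      unfolding X_def
      by (rule DERIV_cong[OF DERIV_diff[OF DERIV_diff[OF DERIV_mult[OF DERIV_N dW[OF xd]] DERIV_mult[OF DERIV_I[OF x0] ddW[OF xd]]] DERIV_J[OF c xd]]])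
        (use x0 in \<open>simp add: ker_eq algebra_simps\<close>)
    moreover have "0 \<le> x * I x * (V x * W x - L x - V x * \<phi> x)"
      using super[OF xd] I_pos[OF x0] x0 by (intro mult_nonneg_nonneg) auto
    ultimately show "\<exists>y. (X has_real_derivative y) (at x) \<and> 0 \<le> y" by blast
  qed
  have X_lim: "(X \<longlongrightarrow> 0) (at_right 0)"
  proof -
    have "(J \<phi> \<longlongrightarrow> 0) (at_right 0)"
    proof (rule tendsto_sandwich[OF _ _ tendsto_const])
      show "((\<lambda>s. K * N s) \<longlongrightarrow> 0) (at_right 0)" using tendsto_mult_right_zero[OF N_tendsto_0] .
      show "eventually (\<lambda>s. 0 \<le> J \<phi> s) (at_right 0)" "eventually (\<lambda>s. J \<phi> s \<le> K * N s) (at_right 0)"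
        by (rule eventually_mono[OF eventually_dom0_right_0[OF r]]; use J_bounds in force)+
    qed
    then show ?thesis unfolding X_def using tendsto_diff[OF lim] by force
  qed
  have X_nonneg: "0 \<le> X s" if s: "s \<in> dom0 R" for s
  proof (rule tendsto_upperbound[OF X_lim])
    show "eventually (\<lambda>t. X t \<le> X s) (at_right 0)"
      using eventually_dom0_right_0[OF s] by eventually_elim (use X_mono s in auto)
  qed simp
  define D where "D = (\<lambda>r. W r / I r - Z \<phi> r)"
  have D_mono: "D t \<le> D s" if st: "0 < s" "s \<le> t" "t \<in> dom0 R" for s t
  proof (rule DERIV_nonpos_imp_nonincreasing[OF st(2)])
    fix x assume x: "s \<le> x" "x \<le> t"
    then have xd: "x \<in> dom0 R" and x0: "0 < x" using dom0_Icc[OF st(3) st(1)] st by auto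
    have I0: "I x \<noteq> 0" using I_pos[OF x0] by simp
    have "(D has_real_derivative - (X x / (x * (I x)^2))) (at x)"
      unfolding D_def
      by (rule DERIV_cong[OF DERIV_diff[OF DERIV_divide[OF dW[OF xd] DERIV_I[OF x0] I0] DERIV_Z[OF xd]]])
        (use x0 I0 in \<open>simp add: X_def field_simps power2_eq_square\<close>)
    moreover have "- (X x / (x * (I x)^2)) \<le> 0" using X_nonneg[OF xd] x0 by simp
    ultimately show "\<exists>y. (D has_real_derivative y) (at x) \<and> y \<le> 0" by blast
  qed
  have r0: "0 < r" using r by (simp add: dom0_def)
  have "0 \<le> D r"
  proof (rule tendsto_upperbound)
    show "((\<lambda>s. - Z \<phi> s) \<longlongrightarrow> 0) (at_end R)" using tendsto_minus[OF Z_tendsto_0] by simp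
    show "eventually (\<lambda>s. - Z \<phi> s \<le> D r) (at_end R)"
      using eventually_at_end[OF r]
    proof eventually_elim
      case (elim s)
      then have "0 \<le> W s / I s" using W I_pos by (auto simp: dom0_def less_imp_le)
      then show ?case using D_mono[of r s] elim r0 by (simp add: D_def)
    qed
  qed (rule at_end_neq_bot[OF R])
  then show ?thesis using I_pos[OF r0] by (simp add: D_def T_def field_simps)
qed

end

lemma T_mono:
  assumes \<phi>: "\<phi> \<in> borel_measurable borel" "\<And>t. 0 \<le> \<phi> t \<and> \<phi> t \<le> K"
    and \<psi>: "\<psi> \<in> borel_measurable borel" "\<And>t. 0 \<le> \<psi> t \<and> \<psi> t \<le> K"
    and le: "\<And>t. \<phi> t \<le> \<psi> t" and r: "r \<in> dom0 R"
  shows "T \<phi> r \<le> T \<psi> r"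
proof -
  have J: "J \<phi> s \<le> J \<psi> s" if "0 \<le> s" for s
    unfolding J_def using that ker_nonneg le
    by (intro set_integral_mono ker_phi_integrable[OF \<phi>] ker_phi_integrable[OF \<psi>] mult_left_mono) auto
  have "Z \<phi> r \<le> Z \<psi> r"
    unfolding Z_def
    by (intro set_integral_mono outer_integrable[OF \<phi> r] outer_integrable[OF \<psi> r] divide_right_mono)
      (use J einterval_dom0[OF r] in \<open>auto simp: less_imp_le\<close>)
  then show ?thesis unfolding T_def using I_pos r by (intro mult_left_mono) (auto simp: dom0_def less_imp_le)
qed

lemma T_dominated_convergence:
  assumes \<phi>: "\<And>j. \<phi> j \<in> borel_measurable borel" "\<And>j t. 0 \<le> \<phi> j t \<and> \<phi> j t \<le> K"
    and lim: "\<And>t. (\<lambda>j. \<phi> j t) \<longlonglongrightarrow> \<psi> t" and r: "r \<in> dom0 R"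
  shows "(\<lambda>j. T (\<phi> j) r) \<longlonglongrightarrow> T \<psi> r"
proof -
  have m\<psi>: "\<psi> \<in> borel_measurable borel" by (rule borel_measurable_LIMSEQ_real[OF lim \<phi>(1)])
  have b\<psi>: "0 \<le> \<psi> t \<and> \<psi> t \<le> K" for t
    using LIMSEQ_le_const[OF lim] LIMSEQ_le_const2[OF lim] \<phi>(2) by blast
  have [measurable]: "ker \<in> borel_measurable borel" "\<psi> \<in> borel_measurable borel" "\<And>j. \<phi> j \<in> borel_measurable borel"
    using continuous_ker m\<psi> \<phi>(1) by (auto intro: borel_measurable_continuous_onI)
  have J: "(\<lambda>j. J (\<phi> j) s) \<longlonglongrightarrow> J \<psi> s" if s: "0 \<le> s" for s
    unfolding J_def set_lebesgue_integral_def
  proof (rule integral_dominated_convergence[where w = "\<lambda>t. indicator {0..s} t *\<^sub>R (ker t * K)"])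
    show "integrable lborel (\<lambda>t. indicator {0..s} t *\<^sub>R (ker t * K))"
      using ker_integral(1)[OF s] by (simp add: set_integrable_def flip: mult.assoc)
    show "AE t in lborel. (\<lambda>j. indicator {0..s} t *\<^sub>R (ker t * \<phi> j t)) \<longlonglongrightarrow> indicator {0..s} t *\<^sub>R (ker t * \<psi> t)"
      by (intro AE_I2 tendsto_intros lim)
    show "AE t in lborel. norm (indicator {0..s} t *\<^sub>R (ker t * \<phi> j t)) \<le> indicator {0..s} t *\<^sub>R (ker t * K)" for j
      by (rule AE_I2) (use \<phi>(2) ker_nonneg in \<open>auto simp: abs_mult intro!: mult_left_mono split: split_indicator\<close>)
  qed measurable
  have "(\<lambda>j. Z (\<phi> j) r) \<longlonglongrightarrow> Z \<psi> r"
    unfolding Z_def set_lebesgue_integral_def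
  proof (rule integral_dominated_convergence[where w = "\<lambda>s. indicator (einterval r R) s *\<^sub>R (K * (N s / (s * (I s)^2)))"])
    show "integrable lborel (\<lambda>s. indicator (einterval r R) s *\<^sub>R (K * (N s / (s * (I s)^2))))"
      using set_integrable_mult_right[OF outer_weight(1)[OF r], of K] by (simp add: set_integrable_def)
    show "(\<lambda>s. indicator (einterval r R) s *\<^sub>R (J \<psi> s / (s * (I s)^2))) \<in> borel_measurable lborel"
      using outer_integrable[OF m\<psi> b\<psi> r] unfolding set_integrable_def by (rule borel_measurable_integrable)
    show "(\<lambda>s. indicator (einterval r R) s *\<^sub>R (J (\<phi> j) s / (s * (I s)^2))) \<in> borel_measurable lborel" for j
      using outer_integrable[OF \<phi>(1,2) r] unfolding set_integrable_def by (rule borel_measurable_integrable)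
    show "AE s in lborel. (\<lambda>j. indicator (einterval r R) s *\<^sub>R (J (\<phi> j) s / (s * (I s)^2))) \<longlonglongrightarrow> indicator (einterval r R) s *\<^sub>R (J \<psi> s / (s * (I s)^2))"
    proof (rule AE_I2)
      fix s
      show "(\<lambda>j. indicator (einterval r R) s *\<^sub>R (J (\<phi> j) s / (s * (I s)^2))) \<longlonglongrightarrow> indicator (einterval r R) s *\<^sub>R (J \<psi> s / (s * (I s)^2))"
      proof (cases "s \<in> einterval r R")
        case True
        then have s: "0 < s" using einterval_dom0[OF r] by blast
        then have "s * (I s)^2 \<noteq> 0" using I_pos[OF s] by simp
        then show ?thesis using s by (intro tendsto_intros J) auto
      qed simp
    qed
    show "AE s in lborel. norm (indicator (einterval r R) s *\<^sub>R (J (\<phi> j) s / (s * (I s)^2))) \<le> indicator (einterval r R) s *\<^sub>R (K * (N s / (s * (I s)^2)))" for j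
    proof (rule AE_I2)
      fix s
      show "norm (indicator (einterval r R) s *\<^sub>R (J (\<phi> j) s / (s * (I s)^2))) \<le> indicator (einterval r R) s *\<^sub>R (K * (N s / (s * (I s)^2)))"
      proof (cases "s \<in> einterval r R")
        case True
        then have s: "0 < s" using einterval_dom0[OF r] by blast
        have "J (\<phi> j) s / (s * (I s)^2) \<le> K * N s / (s * (I s)^2)"
          using J_bounds[OF \<phi>(1,2), of s] s by (intro divide_right_mono) auto
        then show ?thesis using True J_bounds[OF \<phi>(1,2), of s j] s by simp
      qed simp
    qed
  qed
  then show ?thesis unfolding T_def by (intro tendsto_intros)
qed

end

section \<open>Existence\<close>

text \<open>Powers of the positive part with exponent at least 2 are differentiable at the kink; the
  barrier is continued by a constant with such a cut-off.\<close>

lemma DERIV_max_0_power: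
  fixes y :: real
  shows "((\<lambda>y. (max 0 y) ^ Suc (Suc k)) has_real_derivative real (Suc (Suc k)) * (max 0 y) ^ Suc k) (at y)"
proof -
  consider "y < 0" | "y = 0" | "0 < y" by linarith
  then show ?thesis
  proof cases
    case 1
    have "((\<lambda>y. 0) has_real_derivative real (Suc (Suc k)) * (max 0 y) ^ Suc k) (at y)" using 1 by simp
    then show ?thesis
      by (rule has_field_derivative_transform_within_open[of _ _ _ "{..<0}"]) (use 1 in auto)
  next
    case 2
    have "((\<lambda>h. (max 0 h) ^ Suc (Suc k) / h) \<longlongrightarrow> 0) (at (0::real))"
    proof (rule Lim_null_comparison)
      show "eventually (\<lambda>h. norm ((max 0 h) ^ Suc (Suc k) / h) \<le> \<bar>h\<bar> ^ Suc k) (at (0::real))"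
      proof (intro always_eventually allI)
        fix h :: real
        show "norm ((max 0 h) ^ Suc (Suc k) / h) \<le> \<bar>h\<bar> ^ Suc k" by (cases "h \<le> 0") (simp_all add: max_def mult_nonpos_nonneg)
      qed
      have "((\<lambda>h::real. \<bar>h\<bar> ^ Suc k) \<longlongrightarrow> \<bar>0\<bar> ^ Suc k) (at 0)" by (intro tendsto_intros)
      then show "((\<lambda>h::real. \<bar>h\<bar> ^ Suc k) \<longlongrightarrow> 0) (at 0)" by simp
    qed
    then show ?thesis using 2 by (simp add: DERIV_def)
  next
    case 3
    have "((\<lambda>y. y ^ Suc (Suc k)) has_real_derivative real (Suc (Suc k)) * (max 0 y) ^ Suc k) (at y)"
      using 3 DERIV_pow[of "Suc (Suc k)" y] by (simp add: max_def)
    then show ?thesis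
      by (rule has_field_derivative_transform_within_open[of _ _ _ "{0<..}"]) (use 3 in auto)
  qed
qed

section \<open>The barrier that identifies the limit at infinity\<close>

context gl_params
begin

text \<open>On the circle of radius 2 q, \<open>C * (u^2 + v^2) - A\<close> collapses to
  \<open>2 * B * q\<close>.\<close>

lemma hh_circle: "X^2 + c^2 = 1 \<Longrightarrow> hh (2 * q * X) (- (2 * q * c)) = - (2 * q) * (4 * B * q) * X * (c - 1 / 2)"
  using A unfolding hh_def by algebra

lemma gg_circle: "X^2 + c^2 = 1 \<Longrightarrow> gg (2 * q * X) (- (2 * q * c)) = - (2 * q) * (4 * B * q) * ((c - 1 / 2) * (1 + c))"
  using A unfolding gg_def by algebra

text \<open>A subsolution on the circle \<open>u\<^sup>2 + v\<^sup>2 = 4 q\<^sup>2\<close>, on which \<open>hh < 0\<close> and \<open>gg < 0\<close> strictly between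
  the points \<open>(0, - 2 q)\<close> and \<open>(sqrt 3 q, - q)\<close>. It is expressed through the defects
  \<open>p = sqrt 3 q - u\<close> and \<open>w = - q - v\<close>.\<close>

lemma barrier:
  "\<exists>pb wb pb1 wb1 Lp Lw :: real \<Rightarrow> real.
     (\<forall>r>0. 0 \<le> pb r \<and> pb r \<le> sqrt 3 * q \<and> 0 \<le> wb r \<and> wb r \<le> q
        \<and> (pb has_real_derivative pb1 r) (at r) \<and> ((\<lambda>s. s * pb1 s) has_real_derivative r * Lp r) (at r)
        \<and> (wb has_real_derivative wb1 r) (at r) \<and> ((\<lambda>s. s * wb1 s) has_real_derivative r * Lw r) (at r)
        \<and> (real n)^2 * (sqrt 3 * q) / r^2 + hh (sqrt 3 * q - pb r) (- q - wb r) \<le> (real n)^2 / r^2 * pb r - Lp r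
        \<and> gg (sqrt 3 * q - pb r) (- q - wb r) \<le> - Lw r)
     \<and> (\<exists>K>0. \<forall>r. 0 < r \<longrightarrow> r < K \<longrightarrow> pb1 r = 0 \<and> wb1 r = 0 \<and> pb r = sqrt 3 * q \<and> wb r = q)
     \<and> (pb \<longlongrightarrow> 0) at_top \<and> (wb \<longlongrightarrow> 0) at_top"
proof -
  define k where "k = 4 * B * q"
  have k0: "0 < k" using B q by (simp add: k_def)
  \<comment> \<open>The scale satisfies \<open>k * K2 / 2 = n^2 + 3\<close>: the part
    \<open>n^2\<close> balances the centrifugal term, and the surplus 3 makes the remaining
    quadratic polynomial in \<open>K2 / r^2\<close> a sum of squares.\<close>
  define K2 where "K2 = 2 * ((real n)^2 + 3) / k"
  have K20: "0 < K2" unfolding K2_def using k0 by (intro divide_pos_pos mult_pos_pos add_nonneg_pos) auto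
  \<comment> \<open>The cut-off enters \<open>X\<close> in the third power, so that
    \<open>X1\<close>, which contains its square, is still differentiable.\<close>
  define m where "m = (\<lambda>r::real. max 0 (1 - K2 / r^2))"
  define X where "X = (\<lambda>r. sqrt 3 / 2 * m r ^ 3)"
  define X1 where "X1 = (\<lambda>r. 3 * sqrt 3 * K2 * (m r)^2 / r^3)"
  define LX where "LX = (\<lambda>r. 6 * sqrt 3 * m r * K2 / r^4 * (2 * K2 / r^2 - m r))"
  define c where "c = (\<lambda>r. sqrt (1 - (X r)^2))"
  define c1 where "c1 = (\<lambda>r. - (X r * X1 r) / c r)"
  define Lc where "Lc = (\<lambda>r. - ((X1 r)^2 / c r) - X r * LX r / c r - (X r)^2 * (X1 r)^2 / (c r)^3)"
  have s3: "sqrt 3 * sqrt 3 = (3::real)" by simp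
  have m01: "0 \<le> m r" "m r \<le> 1" for r using K20 by (auto simp: m_def)
  have X2: "(X r)^2 = 3 / 4 * (m r)^6" for r
    unfolding X_def by (simp add: power_mult_distrib power_divide flip: power_mult)
  have m6: "(m r)^6 \<le> 1" for r using m01 by (intro power_le_one)
  have X_nonneg: "0 \<le> X r" for r using m01 by (simp add: X_def)
  have X2_le: "(X r)^2 \<le> 3 / 4" for r using X2 m6[of r] by simp
  have c2: "(c r)^2 = 1 - (X r)^2" for r using X2_le[of r] by (simp add: c_def)
  have Xc: "(X r)^2 + (c r)^2 = 1" for r using c2 by simp
  have c_nonneg: "0 \<le> c r" for r using X2_le[of r] by (simp add: c_def)
  \<comment> \<open>Interpolation that is exact at m = 0 and m = 1; after squaring it amounts to m^6
    \<le> m^3. It yields \<open>c - 1 / 2 \<ge> (1 - m) / 2\<close>, the room that absorbs the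
    Laplacian of the barrier.\<close>
  have c_low: "1 - (m r)^3 / 2 \<le> c r" for r
  proof (rule power2_le_imp_le[OF _ c_nonneg])
    have "(m r)^3 * (m r)^3 \<le> (m r)^3 * 1" using m01[of r] by (intro mult_left_mono power_le_one) auto
    moreover have m6': "(m r)^6 = (m r)^3 * (m r)^3" using power_add[of "m r" 3 3] by simp
    ultimately have "(m r)^6 \<le> (m r)^3" by linarith
    moreover have "(1 - (m r)^3 / 2)^2 = 1 - (m r)^3 + (m r)^6 / 4"
      unfolding m6' by (simp add: power2_eq_square algebra_simps)
    ultimately show "(1 - (m r)^3 / 2)^2 \<le> (c r)^2" unfolding c2 X2 by simp
  qed
  have m3: "(m r)^3 \<le> m r" for r using power_decreasing[of 1 3 "m r"] m01[of r] by simp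
  have c_half: "1 / 2 \<le> c r" for r using c_low[of r] m3[of r] m01[of r] by linarith
  have c_le: "c r \<le> 1" for r using c_nonneg X2 by (simp add: c_def)
  have c_pos: "0 < c r" for r using c_half[of r] by linarith
  have dm: "((\<lambda>r. (m r) ^ Suc (Suc j)) has_real_derivative real (Suc (Suc j)) * (m r) ^ Suc j * (2 * K2 / r^3)) (at r)" if "0 < r" for r j
  proof -
    have "((\<lambda>r. 1 - K2 / r^2) has_real_derivative 2 * K2 / r^3) (at r)"
      using that by (auto intro!: derivative_eq_intros simp: field_simps power2_eq_square power3_eq_cube)
    from DERIV_chain2[OF DERIV_max_0_power this] show ?thesis unfolding m_def .
  qed
  have dX: "(X has_real_derivative X1 r) (at r)" if r: "0 < r" for r
  proof -
    have "((\<lambda>r. (m r)^3) has_real_derivative 3 * (m r)^2 * (2 * K2 / r^3)) (at r)"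
      using dm[OF r, of 1] by (simp add: eval_nat_numeral)
    from DERIV_cmult[OF this, of "sqrt 3 / 2"] show ?thesis
      unfolding X_def X1_def by (rule DERIV_cong) simp
  qed
  have dX1: "((\<lambda>s. s * X1 s) has_real_derivative r * LX r) (at r)" if r: "0 < r" for r
  proof -
    have d1: "((\<lambda>r. (m r)^2) has_real_derivative 2 * m r * (2 * K2 / r^3)) (at r)"
      using dm[OF r, of 0] by (simp add: power2_eq_square)
    have d2: "((\<lambda>r. 1 / r^2) has_real_derivative - 2 / r^3) (at r)"
      using r by (auto intro!: derivative_eq_intros simp: field_simps power2_eq_square power3_eq_cube)
    have "((\<lambda>s. 3 * sqrt 3 * K2 * ((m s)^2 * (1 / s^2))) has_real_derivative r * LX r) (at r)"
      by (rule DERIV_cong[OF DERIV_cmult[OF DERIV_mult[OF d1 d2]]])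
        (use r in \<open>simp add: LX_def field_simps power2_eq_square power3_eq_cube power4_eq_xxxx\<close>)
    then show ?thesis
      by (rule has_field_derivative_transform_within_open[of _ _ _ "{0<..}"])
        (use r in \<open>auto simp: X1_def power2_eq_square power3_eq_cube\<close>)
  qed
  have dc: "(c has_real_derivative c1 r) (at r)" if r: "0 < r" for r
  proof -
    have p: "0 < 1 - (X r)^2" using X2_le[of r] by simp
    have "((\<lambda>r. 1 - (X r)^2) has_real_derivative - 2 * X r * X1 r) (at r)"
      by (rule DERIV_cong[OF DERIV_diff[OF DERIV_const DERIV_power[OF dX[OF r], of 2]]]) simp
    from DERIV_chain2[OF DERIV_real_sqrt[OF p] this] show ?thesis
      unfolding c_def[symmetric] by (rule DERIV_cong) (use c_pos[of r] in \<open>simp add: c1_def c_def field_simps\<close>)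
  qed
  have dc1: "((\<lambda>s. s * c1 s) has_real_derivative r * Lc r) (at r)" if r: "0 < r" for r
  proof -
    have nz: "c r \<noteq> 0" using c_pos[of r] by simp
    have "((\<lambda>s. - (X s * (s * X1 s)) / c s) has_real_derivative r * Lc r) (at r)"
      by (rule DERIV_cong[OF DERIV_divide[OF DERIV_minus[OF DERIV_mult[OF dX[OF r] dX1[OF r]]] dc[OF r] nz]])
        (use nz in \<open>simp add: Lc_def c1_def field_simps power2_eq_square power3_eq_cube\<close>)
    then show ?thesis by (simp add: c1_def mult_ac)
  qed
  have key: "(real n)^2 / r^2 * X r - LX r \<le> k * X r * (c r - 1 / 2)" if r: "0 < r" for r
  proof (cases "m r = 0")
    case False
    define z where "z = K2 / r^2"
    have mz: "m r = 1 - z" and z1: "z \<le> 1" using False by (auto simp: m_def z_def max_def split: if_splits)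
    have z0: "0 < z" unfolding z_def using K20 r by simp
    have r2: "1 / r^2 = z / K2" using K20 r by (simp add: z_def)
    have "z / 2 \<le> c r - 1 / 2" using c_low[of r] m3[of r] mz by linarith
    then have "k * X r * (z / 2) \<le> k * X r * (c r - 1 / 2)"
      using k0 X_nonneg[of r] by (intro mult_left_mono) auto
    moreover have "0 \<le> k * X r * (z / 2) + LX r - (real n)^2 / r^2 * X r"
    proof -
      have kK: "k * K2 / 2 = (real n)^2 + 3" unfolding K2_def using k0 by (simp add: field_simps)
      have e1: "LX r = 6 * sqrt 3 * m r * (K2 / r^2) * (1 / r^2) * (2 * (K2 / r^2) - m r)"
        unfolding LX_def using r by (simp add: field_simps power2_eq_square power4_eq_xxxx)
      have e2: "(real n)^2 / r^2 * X r = (real n)^2 * (1 / r^2) * X r" by simp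
      have k': "k = 2 * ((real n)^2 + 3) / K2" using kK K20 by (simp add: field_simps)
      have "k * X r * (z / 2) + LX r - (real n)^2 / r^2 * X r
         = sqrt 3 / 2 * m r * z / K2 * (((real n)^2 + 3) * (m r)^2 + 12 * z * (2 * z - m r) - (real n)^2 * (m r)^2)"
        unfolding e1 e2 unfolding r2 unfolding z_def[symmetric] X_def k' using K20
        by (simp add: field_simps power2_eq_square power3_eq_cube)
      also have "((real n)^2 + 3) * (m r)^2 + 12 * z * (2 * z - m r) - (real n)^2 * (m r)^2 = 3 * ((2 * z)^2 + (3 * z - 1)^2)"
        unfolding mz by (simp add: power2_eq_square algebra_simps)
      also have "0 \<le> sqrt 3 / 2 * m r * z / K2 * (3 * ((2 * z)^2 + (3 * z - 1)^2))"
        using m01[of r] z0 K20 by (intro mult_nonneg_nonneg divide_nonneg_pos) auto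
      finally show ?thesis by simp
    qed
    ultimately show ?thesis by linarith
  qed (simp add: X_def LX_def)
  \<comment> \<open>Nearly a consequence of \<open>key\<close>: as \<open>c^2 = 1 - X^2\<close>, the
    Laplacian of \<open>c\<close> is \<open>- X * LX / c\<close> minus nonnegative squares. It
    remains that \<open>X^2 / c \<le> 1 + c\<close>, which is where \<open>c \<ge> 1 / 2\<close>
    enters.\<close>
  have key_c: "Lc r \<le> k * ((c r - 1 / 2) * (1 + c r))" if r: "0 < r" for r
  proof -
    have "0 \<le> (X1 r)^2 / c r" "0 \<le> (X r)^2 * (X1 r)^2 / (c r)^3" using c_nonneg[of r] by simp_all
    then have "Lc r \<le> X r * (- LX r) / c r" unfolding Lc_def mult_minus_right minus_divide_left[symmetric] by linarith
    also have "\<dots> \<le> X r * (k * X r * (c r - 1 / 2)) / c r"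
    proof (intro divide_right_mono mult_left_mono)
      have "0 \<le> (real n)^2 / r^2 * X r" using X_nonneg[of r] by simp
      then show "- LX r \<le> k * X r * (c r - 1 / 2)" using key[OF r] by linarith
    qed (use X_nonneg[of r] c_nonneg[of r] in auto)
    also have "\<dots> = k * ((c r - 1 / 2) * ((X r)^2 / c r))" by (simp add: power2_eq_square)
    also have "\<dots> \<le> k * ((c r - 1 / 2) * (1 + c r))"
    proof -
      have "(X r)^2 = (1 - c r) * (1 + c r)" using Xc[of r] by (simp add: power2_eq_square algebra_simps)
      also have "\<dots> \<le> c r * (1 + c r)" using c_half[of r] by (intro mult_right_mono) auto
      finally have "(X r)^2 / c r \<le> 1 + c r" using c_pos[of r] by (simp add: field_simps)
      then show ?thesis using k0 c_half[of r] by (intro mult_left_mono) auto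
    qed
    finally show ?thesis .
  qed
  define pb where "pb = (\<lambda>r. sqrt 3 * q - 2 * q * X r)"
  define wb where "wb = (\<lambda>r. - q + 2 * q * c r)"
  have X_le: "X r \<le> sqrt 3 / 2" for r using m01[of r] power_le_one[of "m r" 3] by (simp add: X_def)
  have arg: "sqrt 3 * q - pb r = 2 * q * X r" "- q - wb r = - (2 * q * c r)" for r by (simp_all add: pb_def wb_def)
  have main: "0 \<le> pb r \<and> pb r \<le> sqrt 3 * q \<and> 0 \<le> wb r \<and> wb r \<le> q
        \<and> (pb has_real_derivative - (2 * q * X1 r)) (at r) \<and> ((\<lambda>s. s * - (2 * q * X1 s)) has_real_derivative r * - (2 * q * LX r)) (at r)
        \<and> (wb has_real_derivative 2 * q * c1 r) (at r) \<and> ((\<lambda>s. s * (2 * q * c1 s)) has_real_derivative r * (2 * q * Lc r)) (at r)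
        \<and> (real n)^2 * (sqrt 3 * q) / r^2 + hh (sqrt 3 * q - pb r) (- q - wb r) \<le> (real n)^2 / r^2 * pb r - - (2 * q * LX r)
        \<and> gg (sqrt 3 * q - pb r) (- q - wb r) \<le> - (2 * q * Lc r)" if r: "0 < r" for r
  proof (intro conjI)
    show "0 \<le> pb r" using mult_left_mono[OF X_le[of r], of "2 * q"] q by (simp add: pb_def)
    show "pb r \<le> sqrt 3 * q" using X_nonneg[of r] q by (simp add: pb_def)
    show "0 \<le> wb r" using mult_left_mono[OF c_half[of r], of "2 * q"] q by (simp add: wb_def)
    show "wb r \<le> q" using mult_left_mono[OF c_le[of r], of "2 * q"] q by (simp add: wb_def)
    show "(pb has_real_derivative - (2 * q * X1 r)) (at r)"
      unfolding pb_def by (rule DERIV_cong[OF DERIV_diff[OF DERIV_const DERIV_cmult[OF dX[OF r]]]]) simp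
    show "(wb has_real_derivative 2 * q * c1 r) (at r)"
      unfolding wb_def by (rule DERIV_cong[OF DERIV_add[OF DERIV_const DERIV_cmult[OF dc[OF r]]]]) simp
    show "((\<lambda>s. s * - (2 * q * X1 s)) has_real_derivative r * - (2 * q * LX r)) (at r)"
      using DERIV_cmult[OF dX1[OF r], of "- (2 * q)"] by (simp add: mult_ac)
    show "((\<lambda>s. s * (2 * q * c1 s)) has_real_derivative r * (2 * q * Lc r)) (at r)"
      using DERIV_cmult[OF dc1[OF r], of "2 * q"] by (simp add: mult_ac)
    have "2 * q * ((real n)^2 / r^2 * X r - LX r) \<le> 2 * q * (k * X r * (c r - 1 / 2))"
      using q key[OF r] by (intro mult_left_mono) auto
    then show "(real n)^2 * (sqrt 3 * q) / r^2 + hh (sqrt 3 * q - pb r) (- q - wb r) \<le> (real n)^2 / r^2 * pb r - - (2 * q * LX r)"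
      unfolding arg unfolding hh_circle[OF Xc] k_def pb_def by (simp add: algebra_simps)
    have "2 * q * Lc r \<le> 2 * q * (k * ((c r - 1 / 2) * (1 + c r)))"
      using q key_c[OF r] by (intro mult_left_mono) auto
    then show "gg (sqrt 3 * q - pb r) (- q - wb r) \<le> - (2 * q * Lc r)"
      unfolding arg unfolding gg_circle[OF Xc] k_def by (simp only: mult.assoc mult_minus_left neg_le_iff_le)
  qed
  \<comment> \<open>Up to \<open>sqrt K2\<close> the barrier rests at the point (0, - 2 q), so its
    flux vanishes near the origin.\<close>
  have near: "m r = 0" if "0 < r" "r < sqrt K2" for r
  proof -
    have "r^2 < (sqrt K2)^2" using that by (intro power_strict_mono) auto
    then have "r^2 < K2" using K20 by simp
    then show ?thesis using that by (simp add: m_def max_def field_simps)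
  qed
  have near': "\<exists>K>0. \<forall>r. 0 < r \<longrightarrow> r < K \<longrightarrow> - (2 * q * X1 r) = 0 \<and> 2 * q * c1 r = 0 \<and> pb r = sqrt 3 * q \<and> wb r = q"
    using near K20 by (intro exI[of _ "sqrt K2"]) (auto simp: X1_def X_def c1_def c_def pb_def wb_def)
  have "filterlim (\<lambda>r::real. r^2) at_top at_top"
    by (intro filterlim_pow_at_top filterlim_ident) auto
  then have "((\<lambda>r. K2 / r^2) \<longlongrightarrow> 0) at_top"
    by (intro real_tendsto_divide_at_top[OF tendsto_const])
  then have "((\<lambda>r. max 0 (1 - K2 / r^2)) \<longlongrightarrow> max 0 (1 - 0)) at_top" by (intro tendsto_intros)
  then have mlim: "(m \<longlongrightarrow> 1) at_top" unfolding m_def by simp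
  have Xlim: "(X \<longlongrightarrow> sqrt 3 / 2 * 1 ^ 3) at_top" unfolding X_def by (intro tendsto_intros mlim)
  have "(c \<longlongrightarrow> sqrt (1 - (sqrt 3 / 2 * 1 ^ 3)^2)) at_top" unfolding c_def by (intro tendsto_intros Xlim)
  moreover have "sqrt (1 - (sqrt 3 / 2 * 1 ^ 3)^2) = (1 / 2 :: real)"
    by (rule real_sqrt_unique) (auto simp: power_divide)
  ultimately have clim: "(c \<longlongrightarrow> 1 / 2) at_top" by (simp only:)
  have "(pb \<longlongrightarrow> sqrt 3 * q - 2 * q * (sqrt 3 / 2 * 1 ^ 3)) at_top" unfolding pb_def by (intro tendsto_intros Xlim)
  then have pl: "(pb \<longlongrightarrow> 0) at_top" by simp
  have "(wb \<longlongrightarrow> - q + 2 * q * (1 / 2)) at_top" unfolding wb_def by (intro tendsto_intros clim)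
  then have wl: "(wb \<longlongrightarrow> 0) at_top" by simp
  show ?thesis
    by (rule exI[of _ pb], rule exI[of _ wb], rule exI[of _ "\<lambda>r. - (2 * q * X1 r)"], rule exI[of _ "\<lambda>r. 2 * q * c1 r"],
        rule exI[of _ "\<lambda>r. - (2 * q * LX r)"], rule exI[of _ "\<lambda>r. 2 * q * Lc r"])
      (use main near' pl wl in blast)
qed

end

section \<open>Cooperativity and one-sided Lipschitz constants\<close>

context gl_params
begin

text \<open>The mass term of the Green operators is at least \<open>4 * al = 20 * C * q^2\<close>.
  The coefficients to be dominated are at most 13 C q^2 for \<open>hh\<close> and 15 C q^2 + 4 C q^2
  for \<open>gg\<close>.\<close>

definition al :: real where "al = 5 * C * q^2"

lemma al_pos: "0 < al" using C q by (simp add: al_def)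

lemma A_nonneg: "0 \<le> A"
proof -
  have "B * q \<le> C * q * q" using BC q by (intro mult_right_mono) auto
  moreover have "0 \<le> C * q * q" using C q by simp
  ultimately show ?thesis unfolding A by (simp add: power2_eq_square)
qed

text \<open>Adding the mass term to both sides of the equation thus makes the right-hand side
  monotone in its own unknown.\<close>

lemma hh_lipschitz_u:
  assumes "0 \<le> u'" "u' \<le> u" "u \<le> sqrt 3 * q" "- (2 * q) \<le> v" "v \<le> - q"
  shows "hh u v - hh u' v \<le> 4 * al * (u - u')"
proof -
  have u: "u^2 \<le> 3 * q^2" using power_mono[of u "sqrt 3 * q" 2] assms by (simp add: power_mult_distrib)
  have u': "u'^2 \<le> u^2" "u * u' \<le> u^2" 
    using power_mono[OF assms(2,1), of 2] mult_left_mono[OF assms(2), of u] assms(1,2) by (simp_all add: power2_eq_square)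
  have v: "v^2 \<le> 4 * q^2" using power_mono[of "- v" "2 * q" 2] assms q by (simp add: power_mult_distrib)
  have "v^2 + (u^2 + u * u' + u'^2) \<le> 20 * q^2" using u u' v zero_le_power2[of q] by linarith
  then have "C * (v^2 + (u^2 + u * u' + u'^2)) \<le> C * (20 * q^2)" using C by (intro mult_left_mono) auto
  moreover have "B * v \<le> 0" using B assms q by (intro mult_nonneg_nonpos) auto
  ultimately have "- A + 2 * B * v + C * (v^2 + (u^2 + u * u' + u'^2)) \<le> 4 * al"
    using A_nonneg by (simp add: al_def)
  then have "(u - u') * (- A + 2 * B * v + C * (v^2 + (u^2 + u * u' + u'^2))) \<le> (u - u') * (4 * al)"
    using assms by (intro mult_left_mono) auto
  moreover have "hh u v - hh u' v = (u - u') * (- A + 2 * B * v + C * (v^2 + (u^2 + u * u' + u'^2)))"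
    unfolding hh_def by (simp add: algebra_simps power2_eq_square)
  ultimately show ?thesis by (simp add: mult_ac)
qed

text \<open>Monotonicity in the other unknown is cooperativity:
  \<open>2 * B + C * (v + v') \<le> 0\<close> because both arguments are at most \<open>- q\<close>
  and \<open>B \<le> C * q\<close>.\<close>

lemma hh_antimono_v:
  assumes "0 \<le> u" "v' \<le> v" "v \<le> - q"
  shows "hh u v \<le> hh u v'"
proof -
  have "C * (v + v') \<le> C * (- (2 * q))" using assms C by (intro mult_left_mono) auto
  then have "2 * B + C * (v + v') \<le> 0" using BC by simp
  then have "u * (v - v') * (2 * B + C * (v + v')) \<le> 0" using assms by (intro mult_nonneg_nonpos) auto
  moreover have "hh u v - hh u v' = u * (v - v') * (2 * B + C * (v + v'))"
    unfolding hh_def by (simp add: algebra_simps power2_eq_square)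
  ultimately show ?thesis by simp
qed

lemma gg_antimono_u:
  assumes "0 \<le> u'" "u' \<le> u" "v \<le> - q"
  shows "gg u v \<le> gg u' v"
proof -
  have "C * v \<le> C * (- q)" using assms C by (intro mult_left_mono) auto
  then have "C * v + B \<le> 0" using BC by simp
  moreover have "0 \<le> u^2 - u'^2" using assms by (simp add: power_mono)
  ultimately have "(u^2 - u'^2) * (C * v + B) \<le> 0" by (intro mult_nonneg_nonpos) auto
  moreover have "gg u v - gg u' v = (u^2 - u'^2) * (C * v + B)"
    unfolding gg_def by (simp add: algebra_simps power2_eq_square)
  ultimately show ?thesis by simp
qed

lemma gg_lipschitz_v:
  assumes "0 \<le> u" "u \<le> sqrt 3 * q" "- (2 * q) \<le> v'" "v' \<le> v" "v \<le> - q"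
  shows "gg u v - gg u v' \<le> 4 * al * (v - v')"
proof -
  have u: "u^2 \<le> 3 * q^2" using power_mono[of u "sqrt 3 * q" 2] assms by (simp add: power_mult_distrib)
  have v': "v'^2 \<le> 4 * q^2" using power_mono[of "- v'" "2 * q" 2] assms q by (simp add: power_mult_distrib)
  have v: "v^2 \<le> v'^2" "v * v' \<le> v'^2"
    using power_mono[of "- v" "- v'" 2] mult_right_mono[of "- v" "- v'" "- v'"] assms q
    by (simp_all add: power2_eq_square)
  have "u^2 + (v^2 + v * v' + v'^2) \<le> 15 * q^2" using u v v' by linarith
  then have 1: "C * (u^2 + (v^2 + v * v' + v'^2)) \<le> C * (15 * q^2)" using C by (intro mult_left_mono) auto
  have "B * (- (v + v')) \<le> B * (4 * q)" using assms B by (intro mult_left_mono) auto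
  moreover have "B * q \<le> C * q * q" using BC q by (intro mult_right_mono) auto
  ultimately have "- (B * (v + v')) \<le> 4 * (C * q * q)" by (simp add: algebra_simps)
  moreover have "0 \<le> C * q * q" using C q by simp
  moreover have "C * (15 * q^2) = 15 * (C * q * q)" "4 * al = 20 * (C * q * q)"
    by (simp_all add: al_def power2_eq_square)
  ultimately have "- A - B * (v + v') + C * (u^2 + (v^2 + v * v' + v'^2)) \<le> 4 * al"
    using 1 A_nonneg by linarith
  then have "(v - v') * (- A - B * (v + v') + C * (u^2 + (v^2 + v * v' + v'^2))) \<le> (v - v') * (4 * al)"
    using assms by (intro mult_left_mono) auto
  moreover have "gg u v - gg u v' = (v - v') * (- A - B * (v + v') + C * (u^2 + (v^2 + v * v' + v'^2)))"
    unfolding gg_def by (simp add: algebra_simps power2_eq_square)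
  ultimately show ?thesis by (simp add: mult_ac)
qed

lemma hh_equilibrium: "hh (sqrt 3 * q) (- q) = 0"
proof -
  have "(sqrt 3 * q)^2 = 3 * q^2" by (simp add: power_mult_distrib)
  then show ?thesis unfolding hh_def by (subst A) (simp add: algebra_simps power2_eq_square)
qed

lemma gg_equilibrium: "gg (sqrt 3 * q) (- q) = 0"
proof -
  have "(sqrt 3 * q)^2 = 3 * q^2" by (simp add: power_mult_distrib)
  then show ?thesis unfolding gg_def by (subst A) (simp add: algebra_simps power2_eq_square)
qed

lemma gg_at_minus_2q: "gg 0 (- (2 * q)) \<le> 0"
proof -
  have "gg 0 (- (2 * q)) = - 8 * (B * (q * q))"
    unfolding gg_def by (subst A) (simp add: algebra_simps power2_eq_square)
  also have "\<dots> \<le> 0" using B q by simp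
  finally show ?thesis .
qed

end

section \<open>Monotone iteration\<close>

locale gl_existence = gl_params +
  fixes R :: ereal
  assumes R: "0 < R"
begin

text \<open>Two Green operators with the same \<open>al\<close>: \<open>G\<close> contains the
  centrifugal term of the first equation, \<open>G0\<close> serves the second equation, which has
  none.\<close>

sublocale G: radial_green al n R by standard (use al_pos R in auto)
sublocale G0: radial_green al 0 R by standard (use al_pos R in auto)

text \<open>For the defect p = sqrt 3 q - u the first equation reads (- \<Delta> + V) p = V \<Phi>,
  and similarly for w = - q - v. Division by \<open>V\<close> matches the normalisation of
  \<open>T\<close> and keeps \<Phi> in the range of \<open>p\<close>, although the centrifugal
  source is singular at the origin.\<close>

definition \<Phi> :: "real \<Rightarrow> real \<Rightarrow> real \<Rightarrow> real" where
  "\<Phi> p w r = (if r \<in> dom0 R then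
     (G.M r * p + (real n)^2 * (sqrt 3 * q) / r^2 + hh (sqrt 3 * q - p) (- q - w)) / G.V r else 0)"

definition \<Psi> :: "real \<Rightarrow> real \<Rightarrow> real \<Rightarrow> real" where
  "\<Psi> p w r = (if r \<in> dom0 R then (G0.M r * w + gg (sqrt 3 * q - p) (- q - w)) / G0.V r else 0)"

lemma G0_V: "G0.V r = G0.M r" by (simp add: G0.V_def)

lemma M_ge: "4 * al \<le> G.M r" "4 * al \<le> G0.M r"
  unfolding G.M_def G0.M_def using al_pos by (auto simp: algebra_simps)

lemma \<Phi>_mono:
  assumes "0 \<le> p" "p \<le> p'" "p' \<le> sqrt 3 * q" "0 \<le> w" "w \<le> w'" "w' \<le> q"
  shows "\<Phi> p w r \<le> \<Phi> p' w' r"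
proof (cases "r \<in> dom0 R")
  case True
  have "hh (sqrt 3 * q - p) (- q - w) - hh (sqrt 3 * q - p') (- q - w) \<le> 4 * al * ((sqrt 3 * q - p) - (sqrt 3 * q - p'))"
    using assms by (intro hh_lipschitz_u) auto
  also have "\<dots> \<le> G.M r * ((sqrt 3 * q - p) - (sqrt 3 * q - p'))"
    using assms M_ge by (intro mult_right_mono) auto
  also have "\<dots> = G.M r * p' - G.M r * p" by (simp add: algebra_simps)
  finally have 1: "hh (sqrt 3 * q - p) (- q - w) - hh (sqrt 3 * q - p') (- q - w) \<le> G.M r * p' - G.M r * p" .
  have "hh (sqrt 3 * q - p') (- q - w) \<le> hh (sqrt 3 * q - p') (- q - w')"
    using assms by (intro hh_antimono_v) auto
  with 1 have "G.M r * p + (real n)^2 * (sqrt 3 * q) / r^2 + hh (sqrt 3 * q - p) (- q - w)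
    \<le> G.M r * p' + (real n)^2 * (sqrt 3 * q) / r^2 + hh (sqrt 3 * q - p') (- q - w')" by linarith
  then show ?thesis unfolding \<Phi>_def using True G.V_pos[of r] by (auto intro: divide_right_mono)
qed (simp add: \<Phi>_def)

lemma \<Psi>_mono:
  assumes "0 \<le> p" "p \<le> p'" "p' \<le> sqrt 3 * q" "0 \<le> w" "w \<le> w'" "w' \<le> q"
  shows "\<Psi> p w r \<le> \<Psi> p' w' r"
proof (cases "r \<in> dom0 R")
  case True
  have "gg (sqrt 3 * q - p') (- q - w) - gg (sqrt 3 * q - p') (- q - w') \<le> 4 * al * ((- q - w) - (- q - w'))"
    using assms by (intro gg_lipschitz_v) auto
  also have "\<dots> \<le> G0.M r * ((- q - w) - (- q - w'))"
    using assms M_ge by (intro mult_right_mono) auto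
  also have "\<dots> = G0.M r * w' - G0.M r * w" by (simp add: algebra_simps)
  finally have 1: "gg (sqrt 3 * q - p') (- q - w) - gg (sqrt 3 * q - p') (- q - w') \<le> G0.M r * w' - G0.M r * w" .
  have "gg (sqrt 3 * q - p) (- q - w) \<le> gg (sqrt 3 * q - p') (- q - w)"
    using assms by (intro gg_antimono_u) auto
  with 1 have "G0.M r * w + gg (sqrt 3 * q - p) (- q - w) \<le> G0.M r * w' + gg (sqrt 3 * q - p') (- q - w')" by linarith
  then show ?thesis unfolding \<Psi>_def using True G0.V_pos[of r] by (auto intro: divide_right_mono)
qed (simp add: \<Psi>_def)

text \<open>Monotonicity leaves the extreme arguments: at \<open>p = w = 0\<close> the force
  vanishes, since (sqrt 3 q, - q) is an equilibrium; at \<open>p = sqrt 3 * q\<close>, that is u =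
  0, it vanishes again and \<Phi> equals \<open>sqrt 3 * q\<close>.\<close>

lemma \<Phi>_bounds:
  assumes "0 \<le> p" "p \<le> sqrt 3 * q" "0 \<le> w" "w \<le> q"
  shows "0 \<le> \<Phi> p w r \<and> \<Phi> p w r \<le> sqrt 3 * q"
proof
  have "0 \<le> \<Phi> 0 0 r" unfolding \<Phi>_def using hh_equilibrium q G.V_pos[of r] by auto
  also have "\<dots> \<le> \<Phi> p w r" using assms by (intro \<Phi>_mono) auto
  finally show "0 \<le> \<Phi> p w r" .
  have "\<Phi> p w r \<le> \<Phi> (sqrt 3 * q) q r" using assms by (intro \<Phi>_mono) auto
  also have "\<dots> \<le> sqrt 3 * q"
  proof (cases "r \<in> dom0 R")
    case True
    have "\<Phi> (sqrt 3 * q) q r = G.V r * (sqrt 3 * q) / G.V r"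
      using True unfolding \<Phi>_def by (simp add: hh_def G.V_def algebra_simps)
    then show ?thesis using G.V_pos[of r] by simp
  qed (use q in \<open>simp add: \<Phi>_def\<close>)
  finally show "\<Phi> p w r \<le> sqrt 3 * q" .
qed

lemma \<Psi>_bounds:
  assumes "0 \<le> p" "p \<le> sqrt 3 * q" "0 \<le> w" "w \<le> q"
  shows "0 \<le> \<Psi> p w r \<and> \<Psi> p w r \<le> q"
proof
  have "0 \<le> \<Psi> 0 0 r" unfolding \<Psi>_def using gg_equilibrium by auto
  also have "\<dots> \<le> \<Psi> p w r" using assms by (intro \<Psi>_mono) auto
  finally show "0 \<le> \<Psi> p w r" .
  have "\<Psi> p w r \<le> \<Psi> (sqrt 3 * q) q r" using assms by (intro \<Psi>_mono) auto
  also have "\<dots> \<le> q"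
  proof (cases "r \<in> dom0 R")
    case True
    have "G0.M r * q + gg 0 (- q - q) \<le> G0.M r * q" using gg_at_minus_2q by simp
    then have "(G0.M r * q + gg 0 (- q - q)) / G0.M r \<le> G0.M r * q / G0.M r"
      using G0.M_pos[of r] by (intro divide_right_mono) auto
    then show ?thesis using True G0.M_pos[of r] unfolding \<Psi>_def G0_V by simp
  qed (use q in \<open>simp add: \<Psi>_def\<close>)
  finally show "\<Psi> p w r \<le> q" .
qed

lemma continuous_\<Phi>:
  assumes "continuous_on (dom0 R) P" "continuous_on (dom0 R) W"
  shows "continuous_on (dom0 R) (\<lambda>r. \<Phi> (P r) (W r) r)"
proof -
  have "continuous_on (dom0 R) (\<lambda>r. (G.M r * P r + (real n)^2 * (sqrt 3 * q) / r^2 + hh (sqrt 3 * q - P r) (- q - W r)) / G.V r)"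
    unfolding hh_def G.V_def
    by (intro continuous_intros assms G.continuous_M) (use G.V_pos in \<open>auto simp: dom0_def G.V_def less_imp_neq[symmetric]\<close>)
  then show ?thesis by (rule continuous_on_eq) (simp add: \<Phi>_def)
qed

lemma continuous_\<Psi>:
  assumes "continuous_on (dom0 R) P" "continuous_on (dom0 R) W"
  shows "continuous_on (dom0 R) (\<lambda>r. \<Psi> (P r) (W r) r)"
proof -
  have "continuous_on (dom0 R) (\<lambda>r. (G0.M r * W r + gg (sqrt 3 * q - P r) (- q - W r)) / G0.M r)"
    unfolding gg_def
    by (intro continuous_intros assms G0.continuous_M) (use G0.M_pos in \<open>auto simp: less_imp_neq[symmetric]\<close>)
  then show ?thesis by (rule continuous_on_eq) (simp add: \<Psi>_def G0_V)
qed

lemma measurable_\<Phi>: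
  assumes "continuous_on (dom0 R) P" "continuous_on (dom0 R) W"
  shows "(\<lambda>r. \<Phi> (P r) (W r) r) \<in> borel_measurable borel"
proof -
  have "(\<lambda>r. indicator (dom0 R) r *\<^sub>R \<Phi> (P r) (W r) r) \<in> borel_measurable borel"
    using open_dom0 by (intro borel_measurable_continuous_on_indicator continuous_\<Phi> assms) auto
  moreover have "(\<lambda>r. indicator (dom0 R) r *\<^sub>R \<Phi> (P r) (W r) r) = (\<lambda>r. \<Phi> (P r) (W r) r)"
    by (auto simp: \<Phi>_def fun_eq_iff)
  ultimately show ?thesis by simp
qed

lemma measurable_\<Psi>:
  assumes "continuous_on (dom0 R) P" "continuous_on (dom0 R) W"
  shows "(\<lambda>r. \<Psi> (P r) (W r) r) \<in> borel_measurable borel"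
proof -
  have "(\<lambda>r. indicator (dom0 R) r *\<^sub>R \<Psi> (P r) (W r) r) \<in> borel_measurable borel"
    using open_dom0 by (intro borel_measurable_continuous_on_indicator continuous_\<Psi> assms) auto
  moreover have "(\<lambda>r. indicator (dom0 R) r *\<^sub>R \<Psi> (P r) (W r) r) = (\<lambda>r. \<Psi> (P r) (W r) r)"
    by (auto simp: \<Psi>_def fun_eq_iff)
  ultimately show ?thesis by simp
qed

fun iterate :: "nat \<Rightarrow> (real \<Rightarrow> real) \<times> (real \<Rightarrow> real)" where
  "iterate 0 = ((\<lambda>r. 0), (\<lambda>r. 0))"
| "iterate (Suc j) = ((\<lambda>r. if r \<in> dom0 R then G.T (\<lambda>r. \<Phi> (fst (iterate j) r) (snd (iterate j) r) r) r else 0),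
                 (\<lambda>r. if r \<in> dom0 R then G0.T (\<lambda>r. \<Psi> (fst (iterate j) r) (snd (iterate j) r) r) r else 0))"

definition P :: "nat \<Rightarrow> real \<Rightarrow> real" where "P j = fst (iterate j)"
definition W :: "nat \<Rightarrow> real \<Rightarrow> real" where "W j = snd (iterate j)"

lemma P_0: "P 0 r = 0" and W_0: "W 0 r = 0" by (simp_all add: P_def W_def)

lemma P_Suc: "P (Suc j) r = (if r \<in> dom0 R then G.T (\<lambda>r. \<Phi> (P j r) (W j r) r) r else 0)"
  and W_Suc: "W (Suc j) r = (if r \<in> dom0 R then G0.T (\<lambda>r. \<Psi> (P j r) (W j r) r) r else 0)"
  by (simp_all add: P_def W_def)

lemma iterate_invariant:
  "continuous_on (dom0 R) (P j) \<and> continuous_on (dom0 R) (W j)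
    \<and> (\<forall>r. 0 \<le> P j r \<and> P j r \<le> sqrt 3 * q \<and> 0 \<le> W j r \<and> W j r \<le> q)"
proof (induction j)
  case 0
  then show ?case using q by (simp add: P_0 W_0)
next
  case (Suc j)
  let ?a = "\<lambda>r. \<Phi> (P j r) (W j r) r" and ?b = "\<lambda>r. \<Psi> (P j r) (W j r) r"
  have a: "?a \<in> borel_measurable borel" "\<And>t. 0 \<le> ?a t \<and> ?a t \<le> sqrt 3 * q"
    using Suc by (blast intro: measurable_\<Phi>) (rule \<Phi>_bounds; use Suc in blast)
  have b: "?b \<in> borel_measurable borel" "\<And>t. 0 \<le> ?b t \<and> ?b t \<le> q"
    using Suc by (blast intro: measurable_\<Psi>) (rule \<Psi>_bounds; use Suc in blast)
  have "continuous_on (dom0 R) (P (Suc j))"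
    by (rule continuous_on_eq[OF G.continuous_T[OF a]]) (simp add: P_Suc)
  moreover have "continuous_on (dom0 R) (W (Suc j))"
    by (rule continuous_on_eq[OF G0.continuous_T[OF b]]) (simp add: W_Suc)
  moreover have "0 \<le> P (Suc j) r \<and> P (Suc j) r \<le> sqrt 3 * q \<and> 0 \<le> W (Suc j) r \<and> W (Suc j) r \<le> q" for r
    using G.T_nonneg[OF a] G.T_le[OF a] G0.T_nonneg[OF b] G0.T_le[OF b] q by (simp add: P_Suc W_Suc)
  ultimately show ?case by blast
qed

lemma P_cont: "continuous_on (dom0 R) (P j)" and W_cont: "continuous_on (dom0 R) (W j)"
  and P_nonneg: "0 \<le> P j r" and P_le: "P j r \<le> sqrt 3 * q" and W_nonneg: "0 \<le> W j r" and W_le: "W j r \<le> q"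
  using iterate_invariant[of j] by blast+

lemma Phi_adm: "(\<lambda>r. \<Phi> (P j r) (W j r) r) \<in> borel_measurable borel"
  "0 \<le> \<Phi> (P j t) (W j t) t \<and> \<Phi> (P j t) (W j t) t \<le> sqrt 3 * q"
  by (intro measurable_\<Phi> P_cont W_cont, intro \<Phi>_bounds P_nonneg P_le W_nonneg W_le)

lemma Psi_adm: "(\<lambda>r. \<Psi> (P j r) (W j r) r) \<in> borel_measurable borel"
  "0 \<le> \<Psi> (P j t) (W j t) t \<and> \<Psi> (P j t) (W j t) t \<le> q"
  by (intro measurable_\<Psi> P_cont W_cont, intro \<Psi>_bounds P_nonneg P_le W_nonneg W_le)

lemma iterate_increasing: "P j r \<le> P (Suc j) r \<and> W j r \<le> W (Suc j) r"
proof (induction j arbitrary: r)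
  case 0
  then show ?case using P_nonneg[of "Suc 0" r] W_nonneg[of "Suc 0" r] by (simp add: P_0 W_0)
next
  case (Suc j)
  have "P (Suc j) r \<le> P (Suc (Suc j)) r"
  proof (cases "r \<in> dom0 R")
    case True
    have "G.T (\<lambda>r. \<Phi> (P j r) (W j r) r) r \<le> G.T (\<lambda>r. \<Phi> (P (Suc j) r) (W (Suc j) r) r) r"
      using Suc by (intro G.T_mono[OF Phi_adm Phi_adm _ True] \<Phi>_mono P_nonneg P_le W_nonneg W_le) auto
    then show ?thesis using True by (simp only: P_Suc if_True)
  qed (simp add: P_Suc)
  moreover have "W (Suc j) r \<le> W (Suc (Suc j)) r"
  proof (cases "r \<in> dom0 R")
    case True
    have "G0.T (\<lambda>r. \<Psi> (P j r) (W j r) r) r \<le> G0.T (\<lambda>r. \<Psi> (P (Suc j) r) (W (Suc j) r) r) r"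
      using Suc by (intro G0.T_mono[OF Psi_adm Psi_adm _ True] \<Psi>_mono P_nonneg P_le W_nonneg W_le) auto
    then show ?thesis using True by (simp only: W_Suc if_True)
  qed (simp add: W_Suc)
  ultimately show ?case ..
qed

text \<open>By monotonicity of \<Phi> and \<Psi> the barrier defects are supersolutions for each
  step, so comparison passes the bound on. Near the origin they are constant, and the flux condition
  of \<open>T_le_supersolution\<close> reduces to the vanishing of \<open>N\<close>.\<close>

lemma iterate_barrier:
  "\<exists>pb wb. (pb \<longlongrightarrow> 0) at_top \<and> (wb \<longlongrightarrow> 0) at_top \<and> (\<forall>j. \<forall>r\<in>dom0 R. P j r \<le> pb r \<and> W j r \<le> wb r)"
proof -
  obtain pb wb pb1 wb1 Lp Lw K where b:
     "\<forall>r>0. 0 \<le> pb r \<and> pb r \<le> sqrt 3 * q \<and> 0 \<le> wb r \<and> wb r \<le> q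
        \<and> (pb has_real_derivative pb1 r) (at r) \<and> ((\<lambda>s. s * pb1 s) has_real_derivative r * Lp r) (at r)
        \<and> (wb has_real_derivative wb1 r) (at r) \<and> ((\<lambda>s. s * wb1 s) has_real_derivative r * Lw r) (at r)
        \<and> (real n)^2 * (sqrt 3 * q) / r^2 + hh (sqrt 3 * q - pb r) (- q - wb r) \<le> (real n)^2 / r^2 * pb r - Lp r
        \<and> gg (sqrt 3 * q - pb r) (- q - wb r) \<le> - Lw r"
    and K: "0 < K" "\<forall>r. 0 < r \<longrightarrow> r < K \<longrightarrow> pb1 r = 0 \<and> wb1 r = 0 \<and> pb r = sqrt 3 * q \<and> wb r = q"
    and lims: "(pb \<longlongrightarrow> 0) at_top" "(wb \<longlongrightarrow> 0) at_top"
    using barrier by blast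
  have ev: "eventually (\<lambda>r. 0 < r \<and> r < K) (at_right 0)"
    using K(1) by (auto simp: eventually_at_right[of 0 K])
  have limp: "((\<lambda>r. G.N r * pb r - G.I r * (r * pb1 r)) \<longlongrightarrow> 0) (at_right 0)"
  proof (rule Lim_transform_eventually)
    show "((\<lambda>r. G.N r * (sqrt 3 * q)) \<longlongrightarrow> 0) (at_right 0)" using tendsto_mult_left_zero[OF G.N_tendsto_0] .
    show "eventually (\<lambda>r. G.N r * (sqrt 3 * q) = G.N r * pb r - G.I r * (r * pb1 r)) (at_right 0)"
      using ev by eventually_elim (use K in auto)
  qed
  have limw: "((\<lambda>r. G0.N r * wb r - G0.I r * (r * wb1 r)) \<longlongrightarrow> 0) (at_right 0)"
  proof (rule Lim_transform_eventually)
    show "((\<lambda>r. G0.N r * q) \<longlongrightarrow> 0) (at_right 0)" using tendsto_mult_left_zero[OF G0.N_tendsto_0] .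
    show "eventually (\<lambda>r. G0.N r * q = G0.N r * wb r - G0.I r * (r * wb1 r)) (at_right 0)"
      using ev by eventually_elim (use K in auto)
  qed
  have dpos: "0 < r" if "r \<in> dom0 R" for r using that by (simp add: dom0_def)
  have "P j r \<le> pb r \<and> W j r \<le> wb r" if "r \<in> dom0 R" for j r
    using that
  proof (induction j arbitrary: r)
    case 0
    then show ?case using b dpos[OF 0] by (simp add: P_0 W_0)
  next
    case (Suc j)
    have "G.T (\<lambda>r. \<Phi> (P j r) (W j r) r) r \<le> pb r"
    proof (rule G.T_le_supersolution[OF Phi_adm _ _ _ _ _ limp Suc.prems])
      show "continuous_on (dom0 R) (\<lambda>r. \<Phi> (P j r) (W j r) r)" by (intro continuous_\<Phi> P_cont W_cont)
      fix r assume r: "r \<in> dom0 R"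
      note br = b[rule_format, OF dpos[OF r]]
      show "0 \<le> pb r" "(pb has_real_derivative pb1 r) (at r)" "((\<lambda>s. s * pb1 s) has_real_derivative r * Lp r) (at r)"
        using br by blast+
      have "\<Phi> (P j r) (W j r) r \<le> \<Phi> (pb r) (wb r) r"
        using br Suc.IH[OF r] by (intro \<Phi>_mono P_nonneg W_nonneg) auto
      then have "G.V r * \<Phi> (P j r) (W j r) r \<le> G.V r * \<Phi> (pb r) (wb r) r"
        using G.V_pos[of r] by (intro mult_left_mono) auto
      also have "\<dots> = G.M r * pb r + (real n)^2 * (sqrt 3 * q) / r^2 + hh (sqrt 3 * q - pb r) (- q - wb r)"
        unfolding \<Phi>_def using r G.V_pos[of r] by simp
      also have "\<dots> \<le> G.M r * pb r + ((real n)^2 / r^2 * pb r - Lp r)" using br by linarith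
      also have "\<dots> = G.V r * pb r - Lp r" by (simp add: G.V_def algebra_simps)
      finally show "G.V r * \<Phi> (P j r) (W j r) r \<le> G.V r * pb r - Lp r" .
    qed
    moreover have "G0.T (\<lambda>r. \<Psi> (P j r) (W j r) r) r \<le> wb r"
    proof (rule G0.T_le_supersolution[OF Psi_adm _ _ _ _ _ limw Suc.prems])
      show "continuous_on (dom0 R) (\<lambda>r. \<Psi> (P j r) (W j r) r)" by (intro continuous_\<Psi> P_cont W_cont)
      fix r assume r: "r \<in> dom0 R"
      note br = b[rule_format, OF dpos[OF r]]
      show "0 \<le> wb r" "(wb has_real_derivative wb1 r) (at r)" "((\<lambda>s. s * wb1 s) has_real_derivative r * Lw r) (at r)"
        using br by blast+
      have "\<Psi> (P j r) (W j r) r \<le> \<Psi> (pb r) (wb r) r"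
        using br Suc.IH[OF r] by (intro \<Psi>_mono P_nonneg W_nonneg) auto
      then have "G0.V r * \<Psi> (P j r) (W j r) r \<le> G0.V r * \<Psi> (pb r) (wb r) r"
        using G0.V_pos[of r] by (intro mult_left_mono) auto
      also have "\<dots> = G0.M r * wb r + gg (sqrt 3 * q - pb r) (- q - wb r)"
        unfolding \<Psi>_def using r G0.V_pos[of r] by simp
      also have "\<dots> \<le> G0.V r * wb r - Lw r" unfolding G0_V using br by linarith
      finally show "G0.V r * \<Psi> (P j r) (W j r) r \<le> G0.V r * wb r - Lw r" .
    qed
    ultimately show ?case using Suc.prems by (simp add: P_Suc W_Suc)
  qed
  then show ?thesis using lims by blast
qed

end

lemma quotient_flux_deriv:
  assumes "0 < r" "((\<lambda>s. s * f s) has_real_derivative r * y) (at r)"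
  shows "(f has_real_derivative y - f r / r) (at r)"
proof -
  have "((\<lambda>s. (s * f s) / s) has_real_derivative y - f r / r) (at r)"
    by (rule DERIV_cong[OF DERIV_divide[OF assms(2) DERIV_ident]])
      (use assms(1) in \<open>simp_all add: field_simps power2_eq_square\<close>)
  then show ?thesis
    by (rule has_field_derivative_transform_within_open[of _ _ _ "{0<..}"]) (use assms(1) in auto)
qed

section \<open>The limit of the iteration solves the system\<close>

context gl_existence
begin

definition Pl :: "real \<Rightarrow> real" where "Pl r = (SUP j. P j r)"
definition Wl :: "real \<Rightarrow> real" where "Wl r = (SUP j. W j r)"

lemma P_lim: "(\<lambda>j. P j r) \<longlonglongrightarrow> Pl r"
  unfolding Pl_def
proof (rule LIMSEQ_incseq_SUP)
  show "bdd_above (range (\<lambda>j. P j r))" by (rule bdd_aboveI2[of _ _ "sqrt 3 * q"]) (rule P_le)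
  show "incseq (\<lambda>j. P j r)" using iterate_increasing by (intro incseq_SucI) blast
qed

lemma W_lim: "(\<lambda>j. W j r) \<longlonglongrightarrow> Wl r"
  unfolding Wl_def
proof (rule LIMSEQ_incseq_SUP)
  show "bdd_above (range (\<lambda>j. W j r))" by (rule bdd_aboveI2[of _ _ "q"]) (rule W_le)
  show "incseq (\<lambda>j. W j r)" using iterate_increasing by (intro incseq_SucI) blast
qed

lemma Pl_bounds: "0 \<le> Pl r \<and> Pl r \<le> sqrt 3 * q"
  using LIMSEQ_le_const[OF P_lim] LIMSEQ_le_const2[OF P_lim] P_nonneg P_le by blast

lemma Wl_bounds: "0 \<le> Wl r \<and> Wl r \<le> q"
  using LIMSEQ_le_const[OF W_lim] LIMSEQ_le_const2[OF W_lim] W_nonneg W_le by blast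

definition \<phi> :: "real \<Rightarrow> real" where "\<phi> r = \<Phi> (Pl r) (Wl r) r"
definition \<psi> :: "real \<Rightarrow> real" where "\<psi> r = \<Psi> (Pl r) (Wl r) r"

lemma \<phi>_lim: "(\<lambda>j. \<Phi> (P j r) (W j r) r) \<longlonglongrightarrow> \<phi> r"
proof (cases "r \<in> dom0 R")
  case True
  have "G.V r \<noteq> 0" using G.V_pos[of r] by simp
  then have "(\<lambda>j. (G.M r * P j r + (real n)^2 * (sqrt 3 * q) / r^2 + hh (sqrt 3 * q - P j r) (- q - W j r)) / G.V r)
    \<longlonglongrightarrow> (G.M r * Pl r + (real n)^2 * (sqrt 3 * q) / r^2 + hh (sqrt 3 * q - Pl r) (- q - Wl r)) / G.V r"
    unfolding hh_def by (intro tendsto_intros P_lim W_lim)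
  then show ?thesis using True by (simp add: \<phi>_def \<Phi>_def)
qed (simp add: \<phi>_def \<Phi>_def)

lemma \<psi>_lim: "(\<lambda>j. \<Psi> (P j r) (W j r) r) \<longlonglongrightarrow> \<psi> r"
proof (cases "r \<in> dom0 R")
  case True
  have "G0.V r \<noteq> 0" using G0.V_pos[of r] by simp
  then have "(\<lambda>j. (G0.M r * W j r + gg (sqrt 3 * q - P j r) (- q - W j r)) / G0.V r)
    \<longlonglongrightarrow> (G0.M r * Wl r + gg (sqrt 3 * q - Pl r) (- q - Wl r)) / G0.V r"
    unfolding gg_def by (intro tendsto_intros P_lim W_lim)
  then show ?thesis using True by (simp add: \<psi>_def \<Psi>_def)
qed (simp add: \<psi>_def \<Psi>_def)

lemma \<phi>_adm: "\<phi> \<in> borel_measurable borel" "0 \<le> \<phi> t \<and> \<phi> t \<le> sqrt 3 * q"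
proof -
  show "\<phi> \<in> borel_measurable borel" by (rule borel_measurable_LIMSEQ_real[OF \<phi>_lim Phi_adm(1)])
  show "0 \<le> \<phi> t \<and> \<phi> t \<le> sqrt 3 * q" unfolding \<phi>_def using Pl_bounds Wl_bounds by (intro \<Phi>_bounds) blast+
qed

lemma \<psi>_adm: "\<psi> \<in> borel_measurable borel" "0 \<le> \<psi> t \<and> \<psi> t \<le> q"
proof -
  show "\<psi> \<in> borel_measurable borel" by (rule borel_measurable_LIMSEQ_real[OF \<psi>_lim Psi_adm(1)])
  show "0 \<le> \<psi> t \<and> \<psi> t \<le> q" unfolding \<psi>_def using Pl_bounds Wl_bounds by (intro \<Psi>_bounds) blast+
qed

lemma Pl_fixpoint:
  assumes r: "r \<in> dom0 R" shows "G.T \<phi> r = Pl r"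
proof -
  have "(\<lambda>j. P (Suc j) r) \<longlonglongrightarrow> G.T \<phi> r"
    using G.T_dominated_convergence[OF Phi_adm \<phi>_lim r] r by (simp add: P_Suc)
  then show ?thesis using LIMSEQ_Suc[OF P_lim] LIMSEQ_unique by blast
qed

lemma Wl_fixpoint:
  assumes r: "r \<in> dom0 R" shows "G0.T \<psi> r = Wl r"
proof -
  have "(\<lambda>j. W (Suc j) r) \<longlonglongrightarrow> G0.T \<psi> r"
    using G0.T_dominated_convergence[OF Psi_adm \<psi>_lim r] r by (simp add: W_Suc)
  then show ?thesis using LIMSEQ_Suc[OF W_lim] LIMSEQ_unique by blast
qed

text \<open>A pointwise supremum need not be continuous; regularity comes from the fixed point
  equations, because \<open>T\<close> produces continuous functions from bounded measurable
  ones.\<close>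

lemma continuous_limits: "continuous_on (dom0 R) \<phi>" "continuous_on (dom0 R) \<psi>"
proof -
  have c: "continuous_on (dom0 R) Pl" "continuous_on (dom0 R) Wl"
    by (rule continuous_on_eq[OF G.continuous_T[OF \<phi>_adm] Pl_fixpoint], assumption)
      (rule continuous_on_eq[OF G0.continuous_T[OF \<psi>_adm] Wl_fixpoint], assumption)
  show "continuous_on (dom0 R) \<phi>" "continuous_on (dom0 R) \<psi>"
    unfolding \<phi>_def[abs_def] \<psi>_def[abs_def] by (intro continuous_\<Phi> continuous_\<Psi> c)+
qed

text \<open>Written with \<open>G.T \<phi>\<close> instead of \<open>Pl\<close>, with which it
  agrees on \<open>dom0 R\<close>, so that the derivative formulas of the Green operator apply
  directly.\<close>

definition us :: "real \<Rightarrow> real" where "us r = sqrt 3 * q - G.T \<phi> r"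
definition us1 :: "real \<Rightarrow> real" where "us1 r = - G.T1 \<phi> r"
definition vs :: "real \<Rightarrow> real" where "vs r = - q - G0.T \<psi> r"
definition vs1 :: "real \<Rightarrow> real" where "vs1 r = - G0.T1 \<psi> r"

lemma us_deriv: "r \<in> dom0 R \<Longrightarrow> (us has_real_derivative us1 r) (at r)"
  unfolding us_def[abs_def] us1_def
  by (rule DERIV_cong[OF DERIV_diff[OF DERIV_const G.DERIV_T[OF \<phi>_adm]]]) auto

lemma vs_deriv: "r \<in> dom0 R \<Longrightarrow> (vs has_real_derivative vs1 r) (at r)"
  unfolding vs_def[abs_def] vs1_def
  by (rule DERIV_cong[OF DERIV_diff[OF DERIV_const G0.DERIV_T[OF \<psi>_adm]]]) auto

lemma us1_deriv:
  assumes r: "r \<in> dom0 R"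
  shows "(us1 has_real_derivative ((real n)^2 * us r / r^2 + hh (us r) (vs r) - us1 r / r)) (at r)"
proof -
  have r0: "0 < r" using r by (simp add: dom0_def)
  have "(G.T1 \<phi> has_real_derivative G.V r * (G.T \<phi> r - \<phi> r) - G.T1 \<phi> r / r) (at r)"
    by (rule quotient_flux_deriv[OF r0 G.T_flux[OF \<phi>_adm continuous_limits(1) r]])
  moreover have "G.V r * (G.T \<phi> r - \<phi> r) = - ((real n)^2 * us r / r^2 + hh (us r) (vs r))"
  proof -
    have "G.V r * \<phi> r = G.M r * G.T \<phi> r + (real n)^2 * (sqrt 3 * q) / r^2 + hh (us r) (vs r)"
      using r G.V_pos[of r] Pl_fixpoint[OF r] Wl_fixpoint[OF r] by (simp add: \<phi>_def \<Phi>_def us_def vs_def)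
    then have "G.V r * (G.T \<phi> r - \<phi> r) = G.V r * G.T \<phi> r - (G.M r * G.T \<phi> r + (real n)^2 * (sqrt 3 * q) / r^2 + hh (us r) (vs r))"
      by (simp add: right_diff_distrib)
    also have "\<dots> = - ((real n)^2 * us r / r^2 + hh (us r) (vs r))"
      using r0 by (simp add: G.V_def us_def field_simps)
    finally show ?thesis .
  qed
  ultimately have "(G.T1 \<phi> has_real_derivative - ((real n)^2 * us r / r^2 + hh (us r) (vs r)) - G.T1 \<phi> r / r) (at r)" by simp
  then show ?thesis unfolding us1_def[abs_def] by (rule DERIV_cong[OF DERIV_minus]) simp
qed

lemma vs1_deriv:
  assumes r: "r \<in> dom0 R"
  shows "(vs1 has_real_derivative (gg (us r) (vs r) - vs1 r / r)) (at r)"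
proof -
  have r0: "0 < r" using r by (simp add: dom0_def)
  have "(G0.T1 \<psi> has_real_derivative G0.V r * (G0.T \<psi> r - \<psi> r) - G0.T1 \<psi> r / r) (at r)"
    by (rule quotient_flux_deriv[OF r0 G0.T_flux[OF \<psi>_adm continuous_limits(2) r]])
  moreover have "G0.V r * (G0.T \<psi> r - \<psi> r) = - gg (us r) (vs r)"
  proof -
    have "G0.V r * \<psi> r = G0.M r * G0.T \<psi> r + gg (us r) (vs r)"
      using r G0.V_pos[of r] Pl_fixpoint[OF r] Wl_fixpoint[OF r] by (simp add: \<psi>_def \<Psi>_def us_def vs_def)
    then show ?thesis by (simp add: right_diff_distrib G0_V)
  qed
  ultimately have "(G0.T1 \<psi> has_real_derivative - gg (us r) (vs r) - G0.T1 \<psi> r / r) (at r)" by simp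
  then show ?thesis unfolding vs1_def[abs_def] by (rule DERIV_cong[OF DERIV_minus]) simp
qed

lemma vs_neg: "r \<in> dom0 R \<Longrightarrow> vs r < 0"
  using G0.T_nonneg[OF \<psi>_adm] q by (force simp: vs_def)

text \<open>For finite \<open>R\<close> the factor \<open>I\<close> stays bounded and
  \<open>Z\<close> tends to 0. For R = \<infinity> the factor \<open>I\<close> is unbounded and the
  decay of \<open>Z\<close> decides nothing, so the barrier is used.\<close>

lemma T_at_end:
  "((\<lambda>r. G.T \<phi> r) \<longlongrightarrow> 0) (at_end R) \<and> ((\<lambda>r. G0.T \<psi> r) \<longlongrightarrow> 0) (at_end R)"
proof (cases rule: at_end_cases[OF R])
  case 1
  obtain pb wb where pw: "(pb \<longlongrightarrow> 0) at_top" "(wb \<longlongrightarrow> 0) at_top"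
    "\<And>j r. r \<in> dom0 R \<Longrightarrow> P j r \<le> pb r \<and> W j r \<le> wb r"
    using iterate_barrier by blast
  have ev: "eventually (\<lambda>r. r \<in> dom0 R) (at_end R)"
    using eventually_at_end dom0_nonempty[OF R] by (blast intro: eventually_mono)
  have le: "G.T \<phi> r \<le> pb r" "G0.T \<psi> r \<le> wb r" if "r \<in> dom0 R" for r
    using LIMSEQ_le_const2[OF P_lim, of r "pb r"] LIMSEQ_le_const2[OF W_lim, of r "wb r"] pw(3)[OF that]
    by (auto simp: Pl_fixpoint[OF that] Wl_fixpoint[OF that])
  have "((\<lambda>r. G.T \<phi> r) \<longlongrightarrow> 0) (at_end R)"
    by (rule tendsto_sandwich[OF _ _ tendsto_const pw(1)[folded 1(2)]])
      (use ev le G.T_nonneg[OF \<phi>_adm] in \<open>auto elim: eventually_mono\<close>)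
  moreover have "((\<lambda>r. G0.T \<psi> r) \<longlongrightarrow> 0) (at_end R)"
    by (rule tendsto_sandwich[OF _ _ tendsto_const pw(2)[folded 1(2)]])
      (use ev le G0.T_nonneg[OF \<psi>_adm] in \<open>auto elim: eventually_mono\<close>)
  ultimately show ?thesis ..
next
  case (2 y)
  have "(G.I \<longlongrightarrow> G.I y) (at_left y)" "(G0.I \<longlongrightarrow> G0.I y) (at_left y)"
    using DERIV_isCont[OF G.DERIV_I[OF 2(2)]] DERIV_isCont[OF G0.DERIV_I[OF 2(2)]]
    unfolding continuous_at by (auto intro: tendsto_within_subset)
  then have l: "(G.I \<longlongrightarrow> G.I y) (at_end R)" "(G0.I \<longlongrightarrow> G0.I y) (at_end R)" by (simp_all only: 2(3))
  show ?thesis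
    unfolding G.T_def G0.T_def
    using tendsto_mult[OF l(1) G.Z_tendsto_0[OF \<phi>_adm]] tendsto_mult[OF l(2) G0.Z_tendsto_0[OF \<psi>_adm]] by simp
qed

lemma us_at_end: "(us \<longlongrightarrow> sqrt 3 * q) (at_end R)"
  unfolding us_def[abs_def] using tendsto_diff[OF tendsto_const conjunct1[OF T_at_end]] by force

lemma vs_at_end: "(vs \<longlongrightarrow> - q) (at_end R)"
  unfolding vs_def[abs_def] using tendsto_diff[OF tendsto_const conjunct2[OF T_at_end]] by force

lemma us_div_I: 
  assumes "r \<in> dom0 R"
  shows "us r / G.I r = sqrt 3 * q / G.I r - G.Z \<phi> r"
proof -
  have "0 < G.I r" using assms by (intro G.I_pos) (simp add: dom0_def)
  then show ?thesis by (simp add: us_def G.T_def field_simps)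
qed

lemma us_div_I_deriv:
  assumes r: "r \<in> dom0 R"
  shows "((\<lambda>r. sqrt 3 * q / G.I r - G.Z \<phi> r) has_real_derivative
      - ((sqrt 3 * q * G.N r - G.J \<phi> r) / (r * (G.I r)^2))) (at r)"
proof -
  have r0: "0 < r" using r by (simp add: dom0_def)
  have I0: "G.I r \<noteq> 0" using G.I_pos[OF r0] by simp
  show ?thesis
    by (rule DERIV_cong[OF DERIV_diff[OF DERIV_divide[OF DERIV_const G.DERIV_I[OF r0] I0] G.DERIV_Z[OF \<phi>_adm r]]])
      (use r0 I0 in \<open>simp add: field_simps power2_eq_square\<close>)
qed

text \<open>Since \<open>J \<le> sqrt 3 * q * N\<close>, the quotient \<open>us / I\<close> is
  nonincreasing; it is positive near the end, hence everywhere.\<close>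

lemma us_pos:
  assumes r: "r \<in> dom0 R" shows "0 < us r"
proof -
  have r0: "0 < r" using r by (simp add: dom0_def)
  have "0 < sqrt 3 * q" using q by simp
  then have "eventually (\<lambda>s. 0 < us s) (at_end R)" using order_tendstoD(1)[OF us_at_end] by blast
  then have "eventually (\<lambda>s. s \<in> dom0 R \<and> r < s \<and> 0 < us s) (at_end R)"
    using eventually_at_end[OF r] by eventually_elim auto
  then obtain s where s: "s \<in> dom0 R" "r < s" "0 < us s"
    using eventually_happens at_end_neq_bot[OF R] by blast
  have "sqrt 3 * q / G.I s - G.Z \<phi> s \<le> sqrt 3 * q / G.I r - G.Z \<phi> r"
  proof (rule DERIV_nonpos_imp_nonincreasing[OF less_imp_le[OF s(2)]])
    fix t assume t: "r \<le> t" "t \<le> s"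
    then have td: "t \<in> dom0 R" and t0: "0 < t" using dom0_Icc[OF s(1) r0] r0 by auto
    have "0 \<le> (sqrt 3 * q * G.N t - G.J \<phi> t) / (t * (G.I t)^2)"
      using G.J_bounds[OF \<phi>_adm, of t] t0 by (intro divide_nonneg_nonneg) auto
    then have "- ((sqrt 3 * q * G.N t - G.J \<phi> t) / (t * (G.I t)^2)) \<le> 0" by simp
    then show "\<exists>y. ((\<lambda>r. sqrt 3 * q / G.I r - G.Z \<phi> r) has_real_derivative y) (at t) \<and> y \<le> 0"
      using us_div_I_deriv[OF td] by blast
  qed
  then have "us s / G.I s \<le> us r / G.I r" using us_div_I s(1) r by simp
  moreover have "0 < us s / G.I s" using s r0 G.I_pos[of s] by simp
  ultimately have "0 < us r / G.I r" by linarith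
  then show ?thesis using G.I_pos[OF r0] by (simp add: zero_less_divide_iff)
qed

lemma us_le: "r \<in> dom0 R \<Longrightarrow> us r \<le> sqrt 3 * q"
  using G.T_nonneg[OF \<phi>_adm] by (simp add: us_def)

text \<open>Near the origin \<open>\<phi> = sqrt 3 q - O(r\<^sup>2)\<close>, because the singular term dominates \<open>V\<close>; the
  averages \<open>T \<phi>\<close> then tend to \<open>sqrt 3 q\<close> as well.\<close>

lemma us_tendsto_0: "(us \<longlongrightarrow> 0) (at_right 0)"
proof (rule order_tendstoI)
  let ?s = "sqrt 3 * q"
  obtain x where x: "x \<in> dom0 R" using dom0_nonempty[OF R] by blast
  show "eventually (\<lambda>r. y < us r) (at_right 0)" if "y < 0" for y
    using eventually_dom0_right_0[OF x] by eventually_elim (use that us_pos in \<open>auto intro: less_trans\<close>)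
  have s0: "0 \<le> ?s" using q by simp
  \<comment> \<open>Bounds \<open>V * (sqrt 3 * q - \<phi>) = M * us - hh us vs\<close> for radii up
    to 1. As \<open>V \<ge> 1 / r^2\<close>, the defect of \<phi> is at most
    \<open>H * r^2\<close>.\<close>
  define H where "H = G.M 1 * ?s + ?s * (A + 4 * B * q) + 1"
  have H0: "0 < H" unfolding H_def using G.M_pos[of 1] s0 A_nonneg B q
    by (intro add_nonneg_pos add_nonneg_nonneg mult_nonneg_nonneg) auto
  have a_near: "?s - \<phi> r \<le> H * r^2" if r: "r \<in> dom0 R" "r \<le> 1" for r
  proof -
    have r0: "0 < r" using r by (simp add: dom0_def)
    have eq: "G.V r * (?s - \<phi> r) = G.M r * us r - hh (us r) (vs r)"
    proof -
      have "G.V r * \<phi> r = G.M r * (?s - us r) + (real n)^2 * ?s / r^2 + hh (us r) (vs r)"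
        using r G.V_pos[of r] Pl_fixpoint[OF r(1)] Wl_fixpoint[OF r(1)] by (simp add: \<phi>_def \<Phi>_def us_def vs_def)
      then show ?thesis by (simp add: right_diff_distrib G.V_def algebra_simps)
    qed
    have u: "0 \<le> us r" "us r \<le> ?s" using us_pos[OF r(1)] us_le[OF r(1)] by auto
    have v: "- (2 * q) \<le> vs r" "vs r \<le> - q"
      using G0.T_nonneg[OF \<psi>_adm r(1)] G0.T_le[OF \<psi>_adm r(1)] by (auto simp: vs_def)
    have "r^2 \<le> 1^2" using r r0 by (intro power_mono) auto
    then have "G.M r \<le> G.M 1" unfolding G.M_def by (intro add_left_mono mult_left_mono) auto
    then have 1: "G.M r * us r \<le> G.M 1 * ?s" using u G.M_pos[of 1] by (intro mult_mono) (auto simp: less_imp_le)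
    have "- hh (us r) (vs r) = us r * (A - 2 * B * vs r - C * ((us r)^2 + (vs r)^2))"
      unfolding hh_def by (simp add: algebra_simps)
    also have "\<dots> \<le> us r * (A + 4 * B * q)"
    proof (rule mult_left_mono[OF _ u(1)])
      have "B * (- vs r) \<le> B * (2 * q)" using v B by (intro mult_left_mono) auto
      moreover have "0 \<le> C * ((us r)^2 + (vs r)^2)" using C by simp
      ultimately show "A - 2 * B * vs r - C * ((us r)^2 + (vs r)^2) \<le> A + 4 * B * q" by linarith
    qed
    also have "\<dots> \<le> ?s * (A + 4 * B * q)" using u A_nonneg B q by (intro mult_right_mono) auto
    finally have "G.V r * (?s - \<phi> r) \<le> H" unfolding eq H_def using 1 by linarith
    moreover have "1 / r^2 * (?s - \<phi> r) \<le> G.V r * (?s - \<phi> r)"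
    proof (rule mult_right_mono)
      have "1 \<le> (real n)^2" using n by simp
      then have "1 / r^2 \<le> (real n)^2 / r^2" by (intro divide_right_mono) auto
      then show "1 / r^2 \<le> G.V r" unfolding G.V_def using G.M_pos[of r] by linarith
    qed (use \<phi>_adm(2) in auto)
    ultimately have "1 / r^2 * (?s - \<phi> r) \<le> H" by linarith
    then show ?thesis using r0 by (simp add: field_simps)
  qed
  show "eventually (\<lambda>r. us r < e) (at_right 0)" if e: "0 < e" for e
  proof -
    define d where "d = min (min x 1) (sqrt (e / 2 / H))"
    have x0: "0 < x" using x by (simp add: dom0_def)
    have d: "0 < d" "d \<le> x" "d \<le> 1" "d \<le> sqrt (e / 2 / H)" using x0 e H0 by (auto simp: d_def)
    have dd: "d \<in> dom0 R" using d by (intro dom0_downward[OF x])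
    have near: "?s - \<phi> r \<le> e / 2" if r: "0 < r" "r \<le> d" for r
    proof -
      have "r^2 \<le> (sqrt (e / 2 / H))^2" using r d by (intro power_mono) auto
      then have "H * r^2 \<le> H * (e / 2 / H)" using e H0 by (intro mult_left_mono) auto
      then show ?thesis using a_near[of r] dom0_downward[OF dd r] r d H0 by auto
    qed
    have J_low: "?s * G.N r - G.J \<phi> r \<le> e / 2 * G.N r" if r: "0 < r" "r \<le> d" for r
    proof -
      let ?f = "\<lambda>r. e / 2 * G.N r - (?s * G.N r - G.J \<phi> r)"
      have mono: "?f t \<le> ?f r" if t: "0 < t" "t \<le> r" for t
      proof (rule DERIV_nonneg_imp_nondecreasing[OF t(2)])
        fix y assume y: "t \<le> y" "y \<le> r"
        then have y': "0 < y" "y \<le> d" using t r by auto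
        have yd: "y \<in> dom0 R" using dom0_downward[OF dd y'] .
        have "(?f has_real_derivative G.ker y * (e / 2 - (?s - \<phi> y))) (at y)"
          by (rule DERIV_cong[OF DERIV_diff[OF DERIV_cmult[OF G.DERIV_N] DERIV_diff[OF DERIV_cmult[OF G.DERIV_N] G.DERIV_J[OF \<phi>_adm continuous_limits(1) yd]]]])
            (simp add: algebra_simps)
        moreover have "0 \<le> G.ker y * (e / 2 - (?s - \<phi> y))"
          using near[OF y'] G.ker_nonneg[of y] y' by (intro mult_nonneg_nonneg) auto
        ultimately show "\<exists>z. (?f has_real_derivative z) (at y) \<and> 0 \<le> z" by blast
      qed
      have "0 \<le> ?f r"
      proof (rule tendsto_upperbound)
        show "((\<lambda>t. (e / 2 - ?s) * G.N t) \<longlongrightarrow> 0) (at_right 0)" using tendsto_mult_right_zero[OF G.N_tendsto_0] .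
        show "eventually (\<lambda>t. (e / 2 - ?s) * G.N t \<le> ?f r) (at_right 0)"
          using eventually_dom0_right_0[OF dom0_downward[OF dd r]]
        proof eventually_elim
          case (elim t)
          have "(e / 2 - ?s) * G.N t \<le> ?f t" using G.J_bounds[OF \<phi>_adm, of t] elim by (simp add: algebra_simps)
          also have "\<dots> \<le> ?f r" using mono elim by auto
          finally show ?case .
        qed
      qed simp
      then show ?thesis by simp
    qed
    let ?D = "?s / G.I d - G.Z \<phi> d"
    \<comment> \<open>By \<open>J_low\<close> the quotient \<open>(us - e / 2) / I\<close> is
      nondecreasing on (0,d], hence at most its value at \<open>d\<close>; multiplied by
      \<open>I\<close> this contribution vanishes at the origin, since
      \<open>n \<ge> 1\<close>.\<close>
    have bound: "us r \<le> e / 2 + G.I r * (?D - e / 2 / G.I d)" if r: "0 < r" "r \<le> d" for r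
    proof -
      let ?g = "\<lambda>r. ?s / G.I r - G.Z \<phi> r - e / 2 / G.I r"
      have "?g r \<le> ?g d"
      proof (rule DERIV_nonneg_imp_nondecreasing[OF r(2)])
        fix y assume y: "r \<le> y" "y \<le> d"
        then have y': "0 < y" "y \<le> d" using r by auto
        have yd: "y \<in> dom0 R" using dom0_downward[OF dd y'] .
        have I0: "G.I y \<noteq> 0" using G.I_pos[OF y'(1)] by simp
        have "(?g has_real_derivative (e / 2 * G.N y - (?s * G.N y - G.J \<phi> y)) / (y * (G.I y)^2)) (at y)"
          by (rule DERIV_cong[OF DERIV_diff[OF us_div_I_deriv[OF yd] DERIV_divide[OF DERIV_const G.DERIV_I[OF y'(1)] I0]]])
            (use y' I0 in \<open>simp add: field_simps power2_eq_square\<close>)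
        moreover have "0 \<le> (e / 2 * G.N y - (?s * G.N y - G.J \<phi> y)) / (y * (G.I y)^2)"
          using J_low[OF y'] y' by (intro divide_nonneg_nonneg) auto
        ultimately show "\<exists>z. (?g has_real_derivative z) (at y) \<and> 0 \<le> z" by blast
      qed
      then have "us r / G.I r - e / 2 / G.I r \<le> ?D - e / 2 / G.I d"
        using us_div_I[OF dom0_downward[OF dd r]] by simp
      then have "G.I r * (us r / G.I r - e / 2 / G.I r) \<le> G.I r * (?D - e / 2 / G.I d)"
        using G.I_pos[OF r(1)] by (intro mult_left_mono) auto
      moreover have "G.I r * (us r / G.I r - e / 2 / G.I r) = us r - e / 2"
        using G.I_pos[OF r(1)] by (simp add: field_simps)
      ultimately show ?thesis by linarith
    qed
    have "(G.I \<longlongrightarrow> G.I 0) (at_right 0)"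
      using G.continuous_I[of UNIV] by (auto simp: continuous_on_def intro: tendsto_within_subset)
    moreover have "G.I 0 = 0" using n by (simp add: G.I_def)
    ultimately have "((\<lambda>r. e / 2 + G.I r * (?D - e / 2 / G.I d)) \<longlongrightarrow> e / 2 + 0 * (?D - e / 2 / G.I d)) (at_right 0)"
      by (intro tendsto_intros) simp
    then have "eventually (\<lambda>r. e / 2 + G.I r * (?D - e / 2 / G.I d) < e) (at_right 0)"
      by (rule order_tendstoD(2)) (use e in simp)
    then show ?thesis
      using eventually_dom0_right_0[OF dd]
    proof eventually_elim
      case (elim r)
      then show ?case using bound[of r] by linarith
    qed
  qed
qed

text \<open>For \<open>m = 0\<close> one has \<open>N = 2 * al * r^2 * I\<close> and
  \<open>J \<le> q * N\<close>, so both terms of the derivative are of order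
  \<open>r\<close>.\<close>

lemma vs1_tendsto_0: "(vs1 \<longlongrightarrow> 0) (at_right 0)"
proof (rule Lim_null_comparison)
  obtain x where x: "x \<in> dom0 R" using dom0_nonempty[OF R] by blast
  show "eventually (\<lambda>r. norm (vs1 r) \<le> 2 * al * q * r) (at_right 0)"
    using eventually_dom0_right_0[OF x]
  proof eventually_elim
    case (elim r)
    then have r: "r \<in> dom0 R" "0 < r" by auto
    have I: "0 < G0.I r" using G0.I_pos[OF r(2)] .
    have N: "G0.N r = G0.I r * (2 * al * r^2)" by (simp add: G0.N_def)
    have e: "G0.T1 \<psi> r = 2 * al * r * G0.T \<psi> r - G0.J \<psi> r / G0.I r / r"
      using r I by (simp add: G0.T1_def[OF \<psi>_adm] N G0.T_def field_simps power2_eq_square)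
    have "0 \<le> 2 * al * r * G0.T \<psi> r" "2 * al * r * G0.T \<psi> r \<le> 2 * al * r * q"
      using G0.T_nonneg[OF \<psi>_adm r(1)] G0.T_le[OF \<psi>_adm r(1)] al_pos r by (auto intro!: mult_left_mono)
    moreover have "0 \<le> G0.J \<psi> r / G0.I r / r" "G0.J \<psi> r / G0.I r / r \<le> 2 * al * r * q"
    proof -
      show "0 \<le> G0.J \<psi> r / G0.I r / r" using G0.J_bounds[OF \<psi>_adm, of r] I r by simp
      have "G0.J \<psi> r / G0.I r / r \<le> q * G0.N r / G0.I r / r"
        using G0.J_bounds[OF \<psi>_adm, of r] I r by (intro divide_right_mono) auto
      also have "\<dots> = 2 * al * r * q" using I r by (simp add: N power2_eq_square)
      finally show "G0.J \<psi> r / G0.I r / r \<le> 2 * al * r * q" .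
    qed
    ultimately show ?case unfolding vs1_def e by (simp add: abs_le_iff mult_ac)
  qed
  have "((\<lambda>r. 2 * al * q * r) \<longlongrightarrow> 2 * al * q * 0) (at_right 0)" by (intro tendsto_intros)
  then show "((\<lambda>r. 2 * al * q * r) \<longlongrightarrow> 0) (at_right 0)" by simp
qed

lemma solution_exists: "gl_sol A B C q n R us us1 vs vs1"
  by unfold_locales
    (use R us_deriv us1_deriv vs_deriv vs1_deriv us_pos vs_neg us_tendsto_0 vs1_tendsto_0 us_at_end vs_at_end in blast)+

end

section \<open>Local minimality\<close>

lemma test_fun_DERIV:
  assumes "test_fun R' \<phi>"
  shows "(\<phi> has_real_derivative deriv \<phi> x) (at x)" "continuous_on S \<phi>" "continuous_on S (deriv \<phi>)"
proof -
  have d: "\<phi> differentiable (at x)" "deriv \<phi> differentiable (at x)" for x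
    using assms[unfolded test_fun_def, THEN conjunct1, rule_format, of 0 x]
      assms[unfolded test_fun_def, THEN conjunct1, rule_format, of 1 x] by simp_all
  show "(\<phi> has_real_derivative deriv \<phi> x) (at x)"
    using d(1) by (simp add: DERIV_deriv_iff_real_differentiable)
  show "continuous_on S \<phi>" "continuous_on S (deriv \<phi>)"
    using d by (auto intro!: continuous_at_imp_continuous_on differentiable_imp_continuous_within)
qed

text \<open>The endpoints lie outside the support and the derivatives vanish off it as well, so no
  boundary terms arise and the perturbed energy density is unchanged outside
  \<open>{x0..y0}\<close>.\<close>

lemma test_fun_support:
  assumes t: "test_fun R' \<phi>" and R': "0 < R'"
  shows "\<exists>x0 y0. 0 < x0 \<and> x0 < y0 \<and> y0 < R' \<and> (\<forall>x. x \<le> x0 \<or> y0 \<le> x \<longrightarrow> \<phi> x = 0 \<and> deriv \<phi> x = 0)"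
proof -
  obtain K where K: "compact K" "K \<subseteq> {0<..<R'}" "\<forall>x. x \<notin> K \<longrightarrow> \<phi> x = 0"
    using t by (auto simp: test_fun_def)
  have zero: "\<phi> x = 0 \<and> deriv \<phi> x = 0" if x: "x \<notin> K" for x
  proof -
    have "((\<lambda>_. 0) has_real_derivative deriv \<phi> x) (at x)"
      by (rule has_field_derivative_transform_within_open[OF test_fun_DERIV(1)[OF t], of "- K"])
        (use K x compact_imp_closed in auto)
    then show ?thesis using K(3) x DERIV_unique[OF _ DERIV_const] by blast
  qed
  show ?thesis
  proof (cases "K = {}")
    case True
    then show ?thesis using R' zero by (intro exI[of _ "R' / 3"] exI[of _ "R' / 2"]) auto
  next
    case False
    obtain i where i: "i \<in> K" "\<forall>x\<in>K. i \<le> x" using compact_attains_inf[OF K(1) False] by blast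
    obtain s where s: "s \<in> K" "\<forall>x\<in>K. x \<le> s" using compact_attains_sup[OF K(1) False] by blast
    have ib: "0 < i" "i \<le> s" "s < R'" using i s K by auto
    have "\<phi> x = 0 \<and> deriv \<phi> x = 0" if "x \<le> i / 2 \<or> (s + R') / 2 \<le> x" for x
    proof (rule zero)
      show "x \<notin> K" using that i(2) s(2) ib by force
    qed
    then show ?thesis using ib by (intro exI[of _ "i / 2"] exI[of _ "(s + R') / 2"]) auto
  qed
qed

text \<open>A real supremum is informative only for a bounded set; boundedness comes from the
  compact support.\<close>

lemma test_fun_le_SUP:
  assumes t: "test_fun R' \<phi>" and R': "0 < R'"
  shows "\<bar>\<phi> x\<bar> \<le> (SUP x. \<bar>\<phi> x\<bar>)"
proof (rule cSUP_upper)
  obtain x0 y0 where xy: "0 < x0" "x0 < y0" "\<And>x. x \<le> x0 \<or> y0 \<le> x \<Longrightarrow> \<phi> x = 0"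
    using test_fun_support[OF t R'] by blast
  have "bounded (\<phi> ` {x0..y0})"
    by (intro compact_imp_bounded compact_continuous_image test_fun_DERIV(2)[OF t]) auto
  then obtain M where M: "\<forall>x\<in>{x0..y0}. \<bar>\<phi> x\<bar> \<le> M" unfolding bounded_iff by auto
  have "\<bar>\<phi> x\<bar> \<le> \<bar>M\<bar>" for x
    using M xy(3)[of x] by (cases "x \<in> {x0..y0}") force+
  then show "bdd_above (range (\<lambda>x. \<bar>\<phi> x\<bar>))" by (rule bdd_aboveI2)
qed simp

context gl_params
begin

definition ff :: "real \<Rightarrow> real \<Rightarrow> real" where
  "ff u v = - (A / 2) * (u^2 + v^2) + (C / 4) * (u^2 + v^2)^2 - B / 3 * v * (v^2 - 3 * u^2)"

definition edens :: "real \<Rightarrow> real \<Rightarrow> real \<Rightarrow> real \<Rightarrow> real \<Rightarrow> real" where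
  "edens r u v u' v' = (1 / 2 * (u'^2 + v'^2 + (real n)^2 / r^2 * u^2) + ff u v) * r"

text \<open>The terms of order three and four of \<open>ff (u + x) (v + y)\<close> in
  \<open>x\<close> and \<open>y\<close>.\<close>

definition remainder :: "real \<Rightarrow> real \<Rightarrow> real \<Rightarrow> real \<Rightarrow> real" where
  "remainder u v x y = C * ((x^2 + y^2)^2 / 4 + (u * x + v * y) * (x^2 + y^2)) - B / 3 * (y^3 - 3 * x^2 * y)"

lemma edens_expansion:
  "edens r (u + x) (v + y) (u' + x') (v' + y') - edens r u v u' v' =
     (u' * x' + v' * y' + (real n)^2 / r^2 * u * x + hh u v * x + gg u v * y) * r
     + (1 / 2 * dens r u v x x' y y' + remainder u v x y * r)"
  unfolding edens_def ff_def dens_def remainder_def hh_def gg_def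
  by (simp add: field_simps power2_eq_square power3_eq_cube)

text \<open>The quartic part is nonnegative and dropped. Each cubic part is at most
  \<open>x^2 + y^2\<close> times a linear factor: \<open>4 * q * d\<close> from
  \<open>u * x + v * y\<close> and \<open>3 * d\<close> from the angular cubic.\<close>

lemma remainder_lower:
  assumes u: "\<bar>u\<bar> \<le> 2 * q" and v: "\<bar>v\<bar> \<le> 2 * q" and x: "\<bar>x\<bar> \<le> d" and y: "\<bar>y\<bar> \<le> d"
  shows "- ((4 * C * q + B) * d * (x^2 + y^2)) \<le> remainder u v x y"
proof -
  define t where "t = x^2 + y^2"
  have t0: "0 \<le> t" by (simp add: t_def)
  have "\<bar>u * x\<bar> \<le> 2 * q * d" "\<bar>v * y\<bar> \<le> 2 * q * d"
    unfolding abs_mult using u v x y q by (auto intro!: mult_mono)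
  then have "- (4 * q * d) \<le> u * x + v * y" by linarith
  then have "- (4 * q * d) * t \<le> (u * x + v * y) * t" using t0 by (rule mult_right_mono)
  moreover have "0 \<le> t^2 / 4" by simp
  ultimately have "- (4 * q * d) * t \<le> t^2 / 4 + (u * x + v * y) * t" by linarith
  then have 1: "C * (- (4 * q * d) * t) \<le> C * (t^2 / 4 + (u * x + v * y) * t)" using C by (intro mult_left_mono) auto
  have "y^3 - 3 * x^2 * y = y * (y^2 - 3 * x^2)" by (simp add: power2_eq_square power3_eq_cube algebra_simps)
  also have "\<dots> \<le> \<bar>y\<bar> * \<bar>y^2 - 3 * x^2\<bar>" unfolding abs_mult[symmetric] by simp
  also have "\<dots> \<le> d * (3 * t)"
  proof (rule mult_mono)
    show "\<bar>y^2 - 3 * x^2\<bar> \<le> 3 * t"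
      unfolding t_def abs_le_iff using zero_le_power2[of x] zero_le_power2[of y] by auto
  qed (use y in auto)
  finally have "B / 3 * (y^3 - 3 * x^2 * y) \<le> B / 3 * (d * (3 * t))" using B by (intro mult_left_mono) auto
  with 1 show ?thesis unfolding remainder_def t_def[symmetric] by (simp add: algebra_simps)
qed

end

context gl_sol
begin

text \<open>The Hardy bound degenerates with \<open>u\<close> at the origin, and the bound of
  \<open>dens_lower\<close> can be negative away from it. A small share \<open>t\<close> of the
  latter repairs the former.\<close>

lemma coercive:
  "\<exists>\<kappa>>0. \<exists>t. 0 \<le> t \<and> t \<le> 1 \<and> (\<forall>r\<in>dom0 R. \<forall>x y. \<kappa> * (x^2 + y^2) \<le>
     (1 - t) * (lam * ((u r)^2 * x^2 + y^2)) + t * (((real n)^2 / r^2 - coeff_bound) * x^2 - coeff_bound * y^2))"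
proof -
  obtain x0 where x0: "x0 \<in> dom0 R" using dom0_nonempty[OF R] by blast
  note cb = coeff_bound_pos
  \<comment> \<open>Below \<open>d\<close> the centrifugal term is at least
    \<open>coeff_bound + 1\<close>.\<close>
  define d where "d = min x0 (1 / sqrt (coeff_bound + 1))"
  have d0: "0 < d" using x0 cb by (auto simp: d_def dom0_def)
  have dd: "d \<in> dom0 R" using d0 by (intro dom0_downward[OF x0]) (auto simp: d_def)
  obtain m where m: "0 < m" "\<And>r. r \<in> dom0 R \<Longrightarrow> d \<le> r \<Longrightarrow> m \<le> u r" using u_bounded_below[OF dd] by blast
  \<comment> \<open>The loss \<open>t * coeff_bound\<close> may use at most half of what the share
    \<open>1 - t \<ge> 1 / 2\<close> of the Hardy bound provides: \<open>lam * m^2 / 4\<close> of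
    \<open>lam * m^2 / 2\<close>, and \<open>lam / 4\<close> of \<open>lam / 2\<close>.\<close>
  define t where "t = min (1 / 2) (min (lam * m^2 / (4 * coeff_bound)) (lam / (4 * coeff_bound)))"
  have t: "0 < t" "t \<le> 1 / 2" unfolding t_def using lam_pos m cb by auto
  have "t \<le> lam * m^2 / (4 * coeff_bound)" "t \<le> lam / (4 * coeff_bound)" by (auto simp: t_def)
  then have tc: "t * coeff_bound \<le> lam * m^2 / 4" "t * coeff_bound \<le> lam / 4" using cb by (simp_all add: field_simps)
  define \<kappa> where "\<kappa> = min t (min (lam * m^2 / 4) (lam / 4))"
  have \<kappa>: "0 < \<kappa>" unfolding \<kappa>_def using t lam_pos m by auto
  have "\<kappa> * (x^2 + y^2) \<le> (1 - t) * (lam * ((u r)^2 * x^2 + y^2)) + t * (((real n)^2 / r^2 - coeff_bound) * x^2 - coeff_bound * y^2)"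
    if r: "r \<in> dom0 R" for r x y
  proof -
    have r0: "0 < r" using r by (simp add: dom0_def)
    have t1: "1 / 2 \<le> 1 - t" using t by simp
    have X: "\<kappa> \<le> (1 - t) * (lam * (u r)^2) + t * ((real n)^2 / r^2 - coeff_bound)"
    proof (cases "d \<le> r")
      case True
      have "m^2 \<le> (u r)^2" using m(2)[OF r True] m(1) by (intro power_mono) auto
      then have "1 / 2 * (lam * m^2) \<le> (1 - t) * (lam * (u r)^2)" using t1 lam_pos by (intro mult_mono) auto
      moreover have "0 \<le> t * ((real n)^2 / r^2)" using t by simp
      moreover have "\<kappa> \<le> lam * m^2 / 4" by (simp add: \<kappa>_def)
      ultimately show ?thesis using tc(1) unfolding right_diff_distrib[of t] by linarith
    next
      case False
      have "r \<le> 1 / sqrt (coeff_bound + 1)" using False by (simp add: d_def)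
      then have "r^2 \<le> (1 / sqrt (coeff_bound + 1))^2" using r0 by (intro power_mono) auto
      then have "r^2 \<le> 1 / (coeff_bound + 1)" using cb by (simp add: power_divide)
      then have "coeff_bound + 1 \<le> 1 / r^2" using r0 cb by (simp add: field_simps)
      also have "\<dots> \<le> (real n)^2 / r^2" using n by (intro divide_right_mono) auto
      finally have "t * 1 \<le> t * ((real n)^2 / r^2 - coeff_bound)" using t by (intro mult_left_mono) auto
      moreover have "0 \<le> (1 - t) * (lam * (u r)^2)" using t1 lam_pos by simp
      moreover have "\<kappa> \<le> t" by (simp add: \<kappa>_def)
      ultimately show ?thesis by linarith
    qed
    have "1 / 2 * lam \<le> (1 - t) * lam" using t1 lam_pos by (intro mult_right_mono) auto
    moreover have "\<kappa> \<le> lam / 4" by (simp add: \<kappa>_def)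
    ultimately have Y: "\<kappa> \<le> (1 - t) * lam - t * coeff_bound" using tc(2) by linarith
    have "\<kappa> * (x^2 + y^2) \<le> ((1 - t) * (lam * (u r)^2) + t * ((real n)^2 / r^2 - coeff_bound)) * x^2 + ((1 - t) * lam - t * coeff_bound) * y^2"
      unfolding distrib_left using X Y by (intro add_mono mult_right_mono) auto
    also have "\<dots> = (1 - t) * (lam * ((u r)^2 * x^2 + y^2)) + t * (((real n)^2 / r^2 - coeff_bound) * x^2 - coeff_bound * y^2)"
      by (simp add: algebra_simps)
    finally show ?thesis .
  qed
  then show ?thesis using \<kappa> t by (intro exI[of _ \<kappa>] exI[of _ t] conjI) auto
qed

text \<open>The density is bounded on the whole interval. Near the origin
  \<open>u2_le_linear\<close> controls \<open>u^2 / r\<close>, and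
  \<open>r * u1 \<le> (n + 1) * u\<close> reduces the gradient term to it; beyond \<open>d\<close>
  the derivatives are bounded.\<close>

lemma energy_integrable:
  assumes R': "0 < R'" "ereal R' \<le> R"
  shows "set_integrable lborel {0<..<R'} (\<lambda>r. edens r (u r) (v r) (u1 r) (v1 r))"
proof -
  have sub: "{0<..<R'} \<subseteq> dom0 R" using R' by (auto simp: dom0_def intro: less_le_trans[of _ "ereal R'"])
  obtain d1 where d1: "d1 \<in> dom0 R" "\<And>r. 0 < r \<Longrightarrow> r \<le> d1 \<Longrightarrow> 0 \<le> r * u1 r \<and> r * u1 r \<le> (real n + 1) * u r"
    using flux_u_near_0 by blast
  obtain d2 K where d2: "d2 \<in> dom0 R" "\<And>r. 0 < r \<Longrightarrow> r \<le> d2 \<Longrightarrow> (u r)^2 \<le> K * r" using u2_le_linear by blast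
  obtain K1 where K1: "0 < K1" "\<And>r. r \<in> dom0 R \<Longrightarrow> \<bar>v1 r\<bar> \<le> K1 * r" using v1_le_linear by blast
  define d where "d = min d1 d2"
  have d: "d \<in> dom0 R" "d \<le> d1" "d \<le> d2" "0 < d" using d1 d2 by (auto simp: d_def min_def dom0_def)
  obtain L where L: "0 < L" "\<And>r. r \<in> dom0 R \<Longrightarrow> d \<le> r \<Longrightarrow> \<bar>u1 r\<bar> \<le> L \<and> \<bar>v1 r\<bar> \<le> L"
    using deriv_bounded[OF d(1)] by blast
  define F where "F = \<bar>A\<bar> / 2 * (4 * q^2) + C / 4 * (4 * q^2)^2 + B / 3 * (2 * q) * (12 * q^2)"
  have ff: "\<bar>ff (u r) (v r)\<bar> \<le> F" if r: "r \<in> dom0 R" for r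
  proof -
    have P: "(u r)^2 + (v r)^2 \<le> 4 * q^2" using P_le[OF r] .
    have P0: "0 \<le> (u r)^2 + (v r)^2" by simp
    have a: "\<bar>- (A / 2) * ((u r)^2 + (v r)^2)\<bar> \<le> \<bar>A\<bar> / 2 * (4 * q^2)"
      unfolding abs_mult using P by (intro mult_mono) auto
    have b: "\<bar>C / 4 * ((u r)^2 + (v r)^2)^2\<bar> \<le> C / 4 * (4 * q^2)^2"
      using power_mono[OF P P0, of 2] C unfolding abs_mult by (intro mult_mono) auto
    have "\<bar>(v r)^2 - 3 * (u r)^2\<bar> \<le> 12 * q^2"
      unfolding abs_le_iff using P zero_le_power2[of "u r"] zero_le_power2[of "v r"] by linarith
    moreover have "\<bar>v r\<bar> \<le> 2 * q" using v_ge[OF r] vneg[OF r] by auto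
    ultimately have c: "\<bar>B / 3 * v r * ((v r)^2 - 3 * (u r)^2)\<bar> \<le> B / 3 * (2 * q) * (12 * q^2)"
      unfolding abs_mult using B q by (intro mult_mono) auto
    show ?thesis unfolding ff_def F_def using a b c by linarith
  qed
  have F0: "0 \<le> F" using ff[OF d(1)] by linarith
  define Y where "Y = (real n + 1)^2 * \<bar>K\<bar> + (K1 * R')^2 * R' + (real n)^2 * \<bar>K\<bar> + L^2 * R' + L^2 * R' + (real n)^2 * (4 * q^2) / d"
  define M where "M = 1 / 2 * Y + F * R'"
  have bound: "\<bar>edens r (u r) (v r) (u1 r) (v1 r)\<bar> \<le> M" if r: "r \<in> {0<..<R'}" for r
  proof -
    have rd: "r \<in> dom0 R" and r0: "0 < r" "r < R'" using r sub by auto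
    have f: "\<bar>ff (u r) (v r) * r\<bar> \<le> F * R'" unfolding abs_mult using ff[OF rd] r0 F0 by (intro mult_mono) auto
    have nn: "0 \<le> (real n + 1)^2 * \<bar>K\<bar>" "0 \<le> (K1 * R')^2 * R'" "0 \<le> (real n)^2 * \<bar>K\<bar>" "0 \<le> L^2 * R'" "0 \<le> (real n)^2 * (4 * q^2) / d"
      using R' d(4) by auto
    have k: "(u1 r)^2 * r + (v1 r)^2 * r + (real n)^2 * ((u r)^2 / r)
      \<le> Y"
    proof (cases "r \<le> d")
      case True
      have "K * r \<le> \<bar>K\<bar> * r" using r0 by (intro mult_right_mono) auto
      then have "(u r)^2 \<le> \<bar>K\<bar> * r" using d2(2)[of r] r0(1) True d(3) by linarith
      then have K: "(u r)^2 / r \<le> \<bar>K\<bar>" using r0 by (simp add: field_simps)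
      have "(r * u1 r)^2 \<le> ((real n + 1) * u r)^2" using d1(2)[of r] r0 True d by (intro power_mono) auto
      then have "(u1 r)^2 * r \<le> (real n + 1)^2 * ((u r)^2 / r)" using r0 by (simp add: field_simps power2_eq_square)
      also have "\<dots> \<le> (real n + 1)^2 * \<bar>K\<bar>" using K by (intro mult_left_mono) auto
      finally have 1: "(u1 r)^2 * r \<le> (real n + 1)^2 * \<bar>K\<bar>" .
      have "\<bar>v1 r\<bar> \<le> K1 * R'" using K1(2)[OF rd] mult_left_mono[of r R' K1] r0 K1(1) by linarith
      then have "\<bar>v1 r\<bar>^2 \<le> (K1 * R')^2" by (intro power_mono) auto
      then have 2: "(v1 r)^2 * r \<le> (K1 * R')^2 * R'" using r0 by (intro mult_mono) auto
      have "(real n)^2 * ((u r)^2 / r) \<le> (real n)^2 * \<bar>K\<bar>" using K by (intro mult_left_mono) auto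
      then show ?thesis unfolding Y_def using 1 2 nn by linarith
    next
      case False
      then have Lr: "\<bar>u1 r\<bar> \<le> L" "\<bar>v1 r\<bar> \<le> L" using L(2)[OF rd] by auto
      have "\<bar>u1 r\<bar>^2 \<le> L^2" "\<bar>v1 r\<bar>^2 \<le> L^2"
        using power_mono[OF Lr(1) abs_ge_zero] power_mono[OF Lr(2) abs_ge_zero] by blast+
      then have 1: "(u1 r)^2 * r \<le> L^2 * R'" "(v1 r)^2 * r \<le> L^2 * R'" using r0 by (auto intro!: mult_mono)
      have "(u r)^2 \<le> 4 * q^2" using P_le[OF rd] zero_le_power2[of "v r"] by linarith
      then have "(u r)^2 / r \<le> 4 * q^2 / d" using False d(4) by (intro frac_le) auto
      then have "(real n)^2 * ((u r)^2 / r) \<le> (real n)^2 * (4 * q^2 / d)" by (intro mult_left_mono) auto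
      also have "\<dots> = (real n)^2 * (4 * q^2) / d" by simp
      finally show ?thesis unfolding Y_def using 1 nn by linarith
    qed
    define X where "X = (u1 r)^2 * r + (v1 r)^2 * r + (real n)^2 * ((u r)^2 / r)"
    have e: "edens r (u r) (v r) (u1 r) (v1 r) = 1 / 2 * X + ff (u r) (v r) * r"
      unfolding edens_def X_def using r0 by (simp add: field_simps power2_eq_square)
    have "0 \<le> X" unfolding X_def using r0 by simp
    then have "\<bar>1 / 2 * X + ff (u r) (v r) * r\<bar> \<le> 1 / 2 * X + F * R'" using f by linarith
    then show ?thesis unfolding e M_def using k[folded X_def] by linarith
  qed
  have "set_integrable lborel {0<..<R'} (\<lambda>r. M)"
    by (rule set_integrable_subset[of _ "{0..R'}"]) (auto intro: borel_integrable_atLeastAtMost' continuous_intros)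
  then show ?thesis
  proof (rule set_integrable_bound)
    have "continuous_on {0<..<R'} (\<lambda>r. edens r (u r) (v r) (u1 r) (v1 r))"
      unfolding edens_def ff_def using sub
      by (intro continuous_intros continuous_on_subset[OF cont_u] continuous_on_subset[OF cont_v]
          continuous_on_subset[OF cont_u1] continuous_on_subset[OF cont_v1]) auto
    then show "set_borel_measurable lborel {0<..<R'} (\<lambda>r. edens r (u r) (v r) (u1 r) (v1 r))"
      unfolding set_borel_measurable_def by (simp add: borel_measurable_continuous_on_indicator del: real_scaleR_def)
    show "AE r in lborel. r \<in> {0<..<R'} \<longrightarrow> norm (edens r (u r) (v r) (u1 r) (v1 r)) \<le> norm M"
    proof (intro AE_I2 impI)
      fix r assume "r \<in> {0<..<R'}"
      from bound[OF this] show "norm (edens r (u r) (v r) (u1 r) (v1 r)) \<le> norm M" by simp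
    qed
  qed
qed

text \<open>The first variation vanishes, half the second variation is at least \<kappa> / 2 times
  the integral of \<open>w\<close>, and for small perturbations the remainder loses at most the same
  amount.\<close>

lemma local_minimality:
  assumes R': "0 < R'" "ereal R' \<le> R"
  shows "\<exists>\<delta>>0. \<forall>\<xi> \<eta>. test_fun R' \<xi> \<and> test_fun R' \<eta> \<and> (SUP x. \<bar>\<xi> x\<bar>) + (SUP x. \<bar>\<eta> x\<bar>) < \<delta> \<longrightarrow>
     (LINT r:{0<..<R'}|lborel. edens r (u r) (v r) (u1 r) (v1 r))
     \<le> (LINT r:{0<..<R'}|lborel. edens r (u r + \<xi> r) (v r + \<eta> r) (u1 r + deriv \<xi> r) (v1 r + deriv \<eta> r))"
proof -
  have sub: "{0<..<R'} \<subseteq> dom0 R" using R' by (auto simp: dom0_def intro: less_le_trans[of _ "ereal R'"])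
  obtain \<kappa> t where \<kappa>: "0 < \<kappa>" "0 \<le> t" "t \<le> 1" "\<And>r x y. r \<in> dom0 R \<Longrightarrow> \<kappa> * (x^2 + y^2) \<le>
     (1 - t) * (lam * ((u r)^2 * x^2 + y^2)) + t * (((real n)^2 / r^2 - coeff_bound) * x^2 - coeff_bound * y^2)"
    using coercive by blast
  define K3 where "K3 = 4 * C * q + B"
  have K3: "0 < K3" unfolding K3_def using B C q by (intro add_pos_pos mult_pos_pos) auto
  \<comment> \<open>Chosen so that \<open>K3 * \<delta> = \<kappa> / 2\<close>, the coefficient left
    by half the second variation.\<close>
  define \<delta> where "\<delta> = \<kappa> / (2 * K3)"
  have \<delta>: "0 < \<delta>" unfolding \<delta>_def using \<kappa>(1) K3 by simp
  have "(LINT r:{0<..<R'}|lborel. edens r (u r) (v r) (u1 r) (v1 r))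
     \<le> (LINT r:{0<..<R'}|lborel. edens r (u r + \<xi> r) (v r + \<eta> r) (u1 r + deriv \<xi> r) (v1 r + deriv \<eta> r))"
    if T: "test_fun R' \<xi>" "test_fun R' \<eta>" and small: "(SUP x. \<bar>\<xi> x\<bar>) + (SUP x. \<bar>\<eta> x\<bar>) < \<delta>" for \<xi> \<eta>
  proof -
    have bd: "\<bar>\<xi> x\<bar> \<le> \<delta>" "\<bar>\<eta> x\<bar> \<le> \<delta>" for x
      using test_fun_le_SUP[OF T(1) R'(1), of x] test_fun_le_SUP[OF T(2) R'(1), of x] small
        abs_ge_zero[of "\<xi> x"] abs_ge_zero[of "\<eta> x"] by linarith+
    obtain x1 y1 where 1: "0 < x1" "x1 < y1" "y1 < R'" "\<And>x. x \<le> x1 \<or> y1 \<le> x \<Longrightarrow> \<xi> x = 0 \<and> deriv \<xi> x = 0"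
      using test_fun_support[OF T(1) R'(1)] by blast
    obtain x2 y2 where 2: "0 < x2" "x2 < y2" "y2 < R'" "\<And>x. x \<le> x2 \<or> y2 \<le> x \<Longrightarrow> \<eta> x = 0 \<and> deriv \<eta> x = 0"
      using test_fun_support[OF T(2) R'(1)] by blast
    define x0 y0 where "x0 = min x1 x2" and "y0 = max y1 y2"
    have xy: "0 < x0" "x0 \<le> y0" "y0 < R'" using 1 2 by (auto simp: x0_def y0_def)
    have out: "\<xi> x = 0 \<and> deriv \<xi> x = 0 \<and> \<eta> x = 0 \<and> deriv \<eta> x = 0" if "x \<le> x0 \<or> y0 \<le> x" for x
      using 1(4)[of x] 2(4)[of x] that by (auto simp: x0_def y0_def)
    have y0d: "y0 \<in> dom0 R" using sub xy by auto
    have dom: "r \<in> dom0 R" if "r \<in> {x0..y0}" for r using that dom0_Icc[OF y0d xy(1)] by auto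
    have sub0: "{x0..y0} \<subseteq> dom0 R" using dom by blast
    note cu = continuous_on_subset[OF cont_u sub0] continuous_on_subset[OF cont_v sub0]
      continuous_on_subset[OF cont_u1 sub0] continuous_on_subset[OF cont_v1 sub0]
    note c\<xi> = test_fun_DERIV(2)[OF T(1)] test_fun_DERIV(3)[OF T(1)]
    note c\<eta> = test_fun_DERIV(2)[OF T(2)] test_fun_DERIV(3)[OF T(2)]
    have nz: "r \<noteq> 0" if "r \<in> {x0..y0}" for r using that xy by auto
    define e0 where "e0 = (\<lambda>r. edens r (u r) (v r) (u1 r) (v1 r))"
    define e1 where "e1 = (\<lambda>r. edens r (u r + \<xi> r) (v r + \<eta> r) (u1 r + deriv \<xi> r) (v1 r + deriv \<eta> r))"
    define lin where "lin = (\<lambda>r. (u1 r * deriv \<xi> r + v1 r * deriv \<eta> r + (real n)^2 / r^2 * u r * \<xi> r + hh (u r) (v r) * \<xi> r + gg (u r) (v r) * \<eta> r) * r)"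
    define dn where "dn = (\<lambda>r. dens r (u r) (v r) (\<xi> r) (deriv \<xi> r) (\<eta> r) (deriv \<eta> r))"
    define rm where "rm = (\<lambda>r. remainder (u r) (v r) (\<xi> r) (\<eta> r) * r)"
    define w where "w = (\<lambda>r. ((\<xi> r)^2 + (\<eta> r)^2) * r)"
    have exp: "e1 r - e0 r = lin r + (1 / 2 * dn r + rm r)" for r
      unfolding e1_def e0_def lin_def dn_def rm_def by (rule edens_expansion)
    have ilin: "set_integrable lborel {x0..y0} lin" and idn: "set_integrable lborel {x0..y0} dn"
      and irm: "set_integrable lborel {x0..y0} rm" and iw: "set_integrable lborel {x0..y0} w"
      unfolding lin_def dn_def rm_def w_def dens_def remainder_def hh_def gg_def
      by (intro borel_integrable_atLeastAtMost' continuous_intros cu c\<xi> c\<eta>; use nz in simp)+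
    have lin0: "(LINT r:{x0..y0}|lborel. lin r) = 0"
    proof -
      \<comment> \<open>By the equations in divergence form the first variation is an exact
        derivative, of a function vanishing at both endpoints.\<close>
      have D: "((\<lambda>r. (r * u1 r) * \<xi> r + (r * v1 r) * \<eta> r) has_real_derivative lin r) (at r)" if "x0 \<le> r" "r \<le> y0" for r
      proof -
        have rd: "r \<in> dom0 R" using dom that by auto
        show ?thesis
          by (rule DERIV_cong[OF DERIV_add[OF DERIV_mult[OF flux_u[OF rd] test_fun_DERIV(1)[OF T(1)]] DERIV_mult[OF flux_v[OF rd] test_fun_DERIV(1)[OF T(2)]]]])
            (use nz[of r] that in \<open>simp add: lin_def field_simps power2_eq_square\<close>)
      qed
      have "continuous_on {x0..y0} lin"
        unfolding lin_def hh_def gg_def by (intro continuous_intros cu c\<xi> c\<eta>) (use nz in auto)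
      from set_integral_FTC(2)[OF xy(2) D this] show ?thesis using out[of x0] out[of y0] by simp
    qed
    have dn_low: "\<kappa> * (LINT r:{x0..y0}|lborel. w r) \<le> (LINT r:{x0..y0}|lborel. dn r)"
    proof -
      define h1 where "h1 = (\<lambda>r. lam * ((u r)^2 * (\<xi> r)^2 + (\<eta> r)^2) * r)"
      have ih1: "set_integrable lborel {x0..y0} h1"
        unfolding h1_def by (intro borel_integrable_atLeastAtMost' continuous_intros cu c\<xi> c\<eta>)
      have hi: "(deriv \<phi> has_integral (\<phi> t - \<phi> x0)) {x0..t}" if "x0 \<le> t" "test_fun R' \<phi>" for t \<phi>
        using test_fun_DERIV(1)[OF that(2)] that(1)
        by (intro fundamental_theorem_of_calculus)
          (auto simp flip: has_real_derivative_iff_has_vector_derivative intro: has_field_derivative_at_within)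
      have di: "set_integrable lborel {x0..y0} (deriv \<phi>)" "set_integrable lborel {x0..y0} (\<lambda>r. r * (deriv \<phi> r)^2)"
        if "test_fun R' \<phi>" for \<phi>
        using test_fun_DERIV(3)[OF that] by (auto intro!: borel_integrable_atLeastAtMost' continuous_intros)
      have "bdry \<xi> \<eta> y0 - bdry \<xi> \<eta> x0 + (LINT r:{x0..y0}|lborel. h1 r) \<le> (LINT r:{x0..y0}|lborel. dn r)"
        unfolding h1_def dn_def
        by (rule hardy_interval(2)[OF xy(1,2) y0d di[OF T(1)] hi[OF _ T(1)] di[OF T(2)] hi[OF _ T(2)]])
      then have H: "(LINT r:{x0..y0}|lborel. h1 r) \<le> (LINT r:{x0..y0}|lborel. dn r)"
        using out[of x0] out[of y0] by (simp add: bdry_def)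
      have "\<kappa> * (LINT r:{x0..y0}|lborel. w r) = (LINT r:{x0..y0}|lborel. \<kappa> * w r)" by simp
      also have "\<dots> \<le> (LINT r:{x0..y0}|lborel. (1 - t) * h1 r + t * dn r)"
      proof (rule set_integral_mono)
        fix r assume r: "r \<in> {x0..y0}"
        have rd: "r \<in> dom0 R" and r0: "0 < r" using dom[OF r] by (auto simp: dom0_def)
        have "\<kappa> * w r = (\<kappa> * ((\<xi> r)^2 + (\<eta> r)^2)) * r" by (simp add: w_def)
        also have "\<dots> \<le> ((1 - t) * (lam * ((u r)^2 * (\<xi> r)^2 + (\<eta> r)^2)) + t * (((real n)^2 / r^2 - coeff_bound) * (\<xi> r)^2 - coeff_bound * (\<eta> r)^2)) * r"
          using \<kappa>(4)[OF rd] r0 by (intro mult_right_mono) auto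
        also have "\<dots> = (1 - t) * h1 r + t * ((((real n)^2 / r^2 - coeff_bound) * (\<xi> r)^2 - coeff_bound * (\<eta> r)^2) * r)"
          by (simp add: h1_def algebra_simps)
        also have "\<dots> \<le> (1 - t) * h1 r + t * dn r"
          unfolding dn_def using \<kappa>(2) r0 upos[OF rd]
          by (intro add_left_mono mult_left_mono dens_lower v_ge[OF rd] v_le[OF rd] u_le[OF rd]) auto
        finally show "\<kappa> * w r \<le> (1 - t) * h1 r + t * dn r" .
      qed (use iw ih1 idn in \<open>auto intro!: set_integral_add(1)\<close>)
      also have "\<dots> = (1 - t) * (LINT r:{x0..y0}|lborel. h1 r) + t * (LINT r:{x0..y0}|lborel. dn r)"
        using ih1 idn by (subst set_integral_add(2)) auto
      also have "\<dots> \<le> (1 - t) * (LINT r:{x0..y0}|lborel. dn r) + t * (LINT r:{x0..y0}|lborel. dn r)"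
        using H \<kappa>(3) by (intro add_right_mono mult_left_mono) auto
      also have "\<dots> = (LINT r:{x0..y0}|lborel. dn r)" by (simp add: algebra_simps)
      finally show ?thesis .
    qed
    have rm_low: "- (\<kappa> / 2) * (LINT r:{x0..y0}|lborel. w r) \<le> (LINT r:{x0..y0}|lborel. rm r)"
    proof -
      have "- (\<kappa> / 2) * (LINT r:{x0..y0}|lborel. w r) = (LINT r:{x0..y0}|lborel. - (\<kappa> / 2) * w r)"
        by (simp only: set_integral_mult_right)
      also have "\<dots> \<le> (LINT r:{x0..y0}|lborel. rm r)"
      proof (rule set_integral_mono[OF _ irm])
        show "set_integrable lborel {x0..y0} (\<lambda>r. - (\<kappa> / 2) * w r)"
          by (rule set_integrable_mult_right) (rule iw)
        fix r assume r: "r \<in> {x0..y0}"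
        have rd: "r \<in> dom0 R" and r0: "0 < r" using dom[OF r] by (auto simp: dom0_def)
        have "- (K3 * \<delta> * ((\<xi> r)^2 + (\<eta> r)^2)) \<le> remainder (u r) (v r) (\<xi> r) (\<eta> r)"
          unfolding K3_def using upos[OF rd] u_le[OF rd] vneg[OF rd] v_ge[OF rd] bd
          by (intro remainder_lower) auto
        then have "- (K3 * \<delta> * ((\<xi> r)^2 + (\<eta> r)^2)) * r \<le> rm r" unfolding rm_def using r0 by (intro mult_right_mono) auto
        moreover have "K3 * \<delta> = \<kappa> / 2" using K3 by (simp add: \<delta>_def)
        ultimately show "- (\<kappa> / 2) * w r \<le> rm r" by (simp add: w_def)
      qed
      finally show ?thesis .
    qed
    have idiff: "set_integrable lborel {x0..y0} (\<lambda>r. 1 / 2 * dn r + rm r)"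
      using idn irm by (auto intro!: set_integral_add(1))
    \<comment> \<open>The energy difference, cut off to the support interval. In this form the
      perturbed energy is integrable as a sum of integrable functions.\<close>
    define D where "D = (\<lambda>r. indicator {x0..y0} r * (lin r + (1 / 2 * dn r + rm r)))"
    have iD: "set_integrable lborel {0<..<R'} D" and eD: "(LINT r:{0<..<R'}|lborel. D r) = (LINT r:{x0..y0}|lborel. lin r + (1 / 2 * dn r + rm r))"
    proof -
      have s: "(\<lambda>r. indicator {0<..<R'} r *\<^sub>R D r) = (\<lambda>r. indicator {x0..y0} r *\<^sub>R (lin r + (1 / 2 * dn r + rm r)))"
        using xy by (auto simp: D_def fun_eq_iff split: split_indicator)
      show "set_integrable lborel {0<..<R'} D"
        using set_integral_add(1)[OF ilin idiff] unfolding set_integrable_def s .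
      show "(LINT r:{0<..<R'}|lborel. D r) = (LINT r:{x0..y0}|lborel. lin r + (1 / 2 * dn r + rm r))"
        unfolding set_lebesgue_integral_def s ..
    qed
    have e1_eq: "e1 r = e0 r + D r" for r
    proof (cases "r \<in> {x0..y0}")
      case True
      then show ?thesis using exp[of r] by (simp add: D_def)
    next
      case False
      then have "\<xi> r = 0 \<and> deriv \<xi> r = 0 \<and> \<eta> r = 0 \<and> deriv \<eta> r = 0" by (intro out) auto
      then show ?thesis using False by (simp add: D_def e1_def e0_def)
    qed
    have ie0: "set_integrable lborel {0<..<R'} e0" unfolding e0_def by (rule energy_integrable[OF R'])
    have "(LINT r:{x0..y0}|lborel. lin r + (1 / 2 * dn r + rm r)) = 1 / 2 * (LINT r:{x0..y0}|lborel. dn r) + (LINT r:{x0..y0}|lborel. rm r)"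
      using set_integral_add(2)[OF ilin idiff] lin0 set_integral_add(2)[of lborel "{x0..y0}" "\<lambda>r. 1 / 2 * dn r" rm] idn irm by simp
    also have "\<dots> \<ge> 0" using dn_low rm_low by simp
    finally have "0 \<le> (LINT r:{0<..<R'}|lborel. D r)" unfolding eD .
    then have "(LINT r:{0<..<R'}|lborel. e0 r) \<le> (LINT r:{0<..<R'}|lborel. e1 r)"
      unfolding e1_eq using set_integral_add(2)[OF ie0 iD] by simp
    then show ?thesis unfolding e0_def e1_def .
  qed
  then show ?thesis using \<delta> by blast
qed

end

section \<open>Translation of the constants and assembly of the claims\<close>

theorem mainTheorem3:
  fixes a b c :: real and R :: ereal and k :: int
  assumes "a^2 > 0" and "b^2 > 0" and "c^2 > 0" and "b^4 \<le> 3 * a^2 * c^2"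
    and "0 < R" and "k \<noteq> 0"
  shows "\<exists>u v. is_solution a b c R k u v
           \<and> (\<forall>u' v'. is_solution a b c R k u' v' \<longrightarrow> (\<forall>r \<in> dom0 R. u' r = u r \<and> v' r = v r))
           \<and> (\<forall>\<xi> \<xi>' \<eta> \<eta>'. hatX R \<xi> \<xi>' \<eta> \<eta>' \<and> (\<exists>r \<in> dom0 R. \<xi> r \<noteq> 0 \<or> \<eta> r \<noteq> 0)
                 \<longrightarrow> Bform a b c R k u v \<xi> \<xi>' \<eta> \<eta>' > 0)
           \<and> local_minimizer a b c R k u v"
proof -
  define s where "s = s_plus a b c"
  define A B C q n where "A = a^2" and "B = b^2 / sqrt 6" and "C = c^2" and "q = s / sqrt 6" and "n = nat \<bar>k\<bar>"
  have n2: "(real n)^2 = (of_int k)^2" by (simp add: n_def flip: of_int_power)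
  have b4: "b^4 = (b^2)^2" by (simp flip: power_mult)
  define D where "D = sqrt (b^4 + 24 * a^2 * c^2)"
  have D2: "D^2 = (b^2)^2 + 24 * a^2 * c^2" unfolding D_def b4 using assms by simp
  have sc: "s * (4 * c^2) = b^2 + D" unfolding s_def s_plus_def D_def[symmetric] using assms(3) by simp
  have D0: "0 \<le> D" unfolding D_def using assms by simp
  have s0: "0 < s" unfolding s_def s_plus_def D_def[symmetric] using assms(2,3) D0
    by (intro divide_pos_pos add_pos_nonneg mult_pos_pos) auto
  \<comment> \<open>\<open>s_plus\<close> is the positive root of this quadratic; divided by 3 it
    becomes \<open>A = 4 * C * q^2 - 2 * B * q\<close>.\<close>
  have quad: "2 * c^2 * s^2 - b^2 * s = 3 * a^2"
  proof -
    have "(s * (4 * c^2) - b^2)^2 = (b^2)^2 + 24 * a^2 * c^2" unfolding sc using D2 by simp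
    then have "8 * c^2 * (2 * c^2 * s^2 - b^2 * s) = 8 * c^2 * (3 * a^2)" by algebra
    then show ?thesis using assms(3) by simp
  qed
  \<comment> \<open>The hypothesis on the constants says \<open>D^2 \<ge> 9 * b^4\<close>. Then 4
    c^2 s = b^2 + D \<ge> 4 b^2, which is \<open>B \<le> C * q\<close>.\<close>
  have D3: "3 * b^2 \<le> D"
  proof (rule power2_le_imp_le[OF _ D0])
    have "(3 * b^2)^2 = 9 * (b^2)^2" by (simp add: power_mult_distrib)
    then show "(3 * b^2)^2 \<le> D^2" using D2 assms(4) b4 by linarith
  qed
  have s6: "sqrt 6 * sqrt 6 = (6::real)" "0 < sqrt (6::real)" by simp_all
  have q2: "q^2 = s^2 / 6" by (simp add: q_def power_divide)
  have Bq: "B * q = b^2 * s / 6" by (simp add: B_def q_def)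
  interpret gl_params A B C q n
  proof
    show "0 < B" "0 < C" "0 < q" using assms s0 by (simp_all add: B_def C_def q_def)
    have "4 * c^2 * q^2 = 4 * c^2 * s^2 / 6" "2 * B * q = 2 * (b^2 * s / 6)"
      unfolding q2 mult.assoc[of 2 B] Bq by simp_all
    then show "A = 4 * C * q^2 - 2 * B * q" using quad unfolding A_def C_def by linarith
    have "4 * (c^2 * s) = b^2 + D" using sc by (simp add: mult_ac)
    then have "b^2 \<le> c^2 * s" using D3 by linarith
    then show "B \<le> C * q" using s6 by (simp add: B_def C_def q_def divide_right_mono)
    show "1 \<le> n" using assms(6) by (simp add: n_def)
  qed
  have sqrt23: "sqrt (2 / 3) = 2 / sqrt 6"
    by (rule real_sqrt_unique) (auto simp: power_divide)
  have hfun: "hfun a b c x y = hh x y" for x y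
    unfolding hfun_def hh_def unfolding sqrt23 A_def B_def C_def by simp
  have gfun: "gfun a b c x y = gg x y" for x y
    unfolding gfun_def gg_def unfolding A_def B_def C_def by simp
  have ffun: "ffun a b c x y = ff x y" for x y
    unfolding ffun_def ff_def unfolding A_def B_def C_def by simp
  have "sqrt 3 * sqrt 2 = sqrt (6::real)" by (simp flip: real_sqrt_mult)
  then have uend: "s_plus a b c / sqrt 2 = sqrt 3 * q"
    unfolding q_def s_def by (simp add: field_simps)
  have vend: "- s_plus a b c / sqrt 6 = - q" by (simp add: q_def s_def)
  have to_sol: "gl_sol A B C q n R u (deriv u) v (deriv v)" if S: "is_solution a b c R k u v" for u v
  proof
    have S': "\<forall>r \<in> dom0 R. u differentiable (at r) \<and> deriv u differentiable (at r) \<and>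
        v differentiable (at r) \<and> deriv v differentiable (at r) \<and>
        deriv (deriv u) r + deriv u r / r - (of_int k)^2 * u r / r^2 = hh (u r) (v r) \<and>
        deriv (deriv v) r + deriv v r / r = gg (u r) (v r) \<and> u r > 0 \<and> v r < 0"
      and lims: "(u \<longlongrightarrow> 0) (at_right 0)" "(deriv v \<longlongrightarrow> 0) (at_right 0)"
        "(u \<longlongrightarrow> sqrt 3 * q) (at_end R)" "(v \<longlongrightarrow> - q) (at_end R)"
      using S unfolding is_solution_def hfun gfun uend vend by blast+
    show "0 < R" by fact
    fix r assume r: "r \<in> dom0 R"
    note Sr = bspec[OF S' r]
    show "(u has_real_derivative deriv u r) (at r)" "(v has_real_derivative deriv v r) (at r)"
      using Sr by (auto simp: DERIV_deriv_iff_real_differentiable)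
    have e: "deriv (deriv u) r = (real n)^2 * u r / r^2 + hh (u r) (v r) - deriv u r / r"
      "deriv (deriv v) r = gg (u r) (v r) - deriv v r / r" using Sr n2 by (auto simp: algebra_simps)
    show "(deriv u has_real_derivative (real n)^2 * u r / r^2 + hh (u r) (v r) - deriv u r / r) (at r)"
      "(deriv v has_real_derivative gg (u r) (v r) - deriv v r / r) (at r)"
      unfolding e[symmetric] using Sr by (auto simp: DERIV_deriv_iff_real_differentiable)
    show "0 < u r" "v r < 0" using Sr by auto
  next
    show "(u \<longlongrightarrow> 0) (at_right 0)" "(deriv v \<longlongrightarrow> 0) (at_right 0)"
        "(u \<longlongrightarrow> sqrt 3 * q) (at_end R)" "(v \<longlongrightarrow> - q) (at_end R)"
      using S unfolding is_solution_def uend vend by blast+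
  qed
  interpret E: gl_existence A B C q n R by standard fact
  define u u1 v v1 where "u = E.us" and "u1 = E.us1" and "v = E.vs" and "v1 = E.vs1"
  interpret S: gl_sol A B C q n R u u1 v v1 unfolding u_def u1_def v_def v1_def by (rule E.solution_exists)
  have du: "deriv u r = u1 r" "deriv v r = v1 r" if "r \<in> dom0 R" for r
    using that by (auto intro!: DERIV_imp_deriv S.du S.dv)
  \<comment> \<open>\<open>deriv u\<close> is identified with \<open>u1\<close> only on
    \<open>dom0 R\<close>; as that set is open, the second derivatives carry over.\<close>
  have ddu: "(deriv u has_real_derivative ((real n)^2 * u r / r^2 + hh (u r) (v r) - u1 r / r)) (at r)"
    "(deriv v has_real_derivative (gg (u r) (v r) - v1 r / r)) (at r)" if r: "r \<in> dom0 R" for r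
    by (rule has_field_derivative_transform_within_open[OF S.ddu[OF r] open_dom0 r], simp add: du)
      (rule has_field_derivative_transform_within_open[OF S.ddv[OF r] open_dom0 r], simp add: du)
  have sol: "is_solution a b c R k u v"
    unfolding is_solution_def hfun gfun uend vend
  proof (intro conjI ballI)
    fix r assume r: "r \<in> dom0 R"
    show "u differentiable (at r)" "v differentiable (at r)" "deriv u differentiable (at r)" "deriv v differentiable (at r)"
      using S.du[OF r] S.dv[OF r] ddu[OF r] unfolding real_differentiable_def by blast+
    show "deriv (deriv u) r + deriv u r / r - (of_int k)^2 * u r / r^2 = hh (u r) (v r)"
      using DERIV_imp_deriv[OF ddu(1)[OF r]] du(1)[OF r] n2 by simp
    show "deriv (deriv v) r + deriv v r / r = gg (u r) (v r)"
      using DERIV_imp_deriv[OF ddu(2)[OF r]] du(2)[OF r] by simp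
    show "0 < u r" "v r < 0" using S.upos[OF r] S.vneg[OF r] .
  next
    obtain x where x: "x \<in> dom0 R" using dom0_nonempty[OF assms(5)] by blast
    show "(deriv v \<longlongrightarrow> 0) (at_right 0)"
    proof (rule Lim_transform_eventually[OF S.v10])
      show "eventually (\<lambda>r. v1 r = deriv v r) (at_right 0)"
        using eventually_dom0_right_0[OF x] by eventually_elim (use du in auto)
    qed
  qed (rule S.u0 S.uR S.vR)+
  have uniq: "\<forall>r\<in>dom0 R. u' r = u r \<and> v' r = v r" if "is_solution a b c R k u' v'" for u' v'
    using S.solution_unique[OF to_sol[OF that]] by blast
  have stable: "0 < Bform a b c R k u v \<xi> \<xi>' \<eta> \<eta>'"
    if h: "hatX R \<xi> \<xi>' \<eta> \<eta>'" and ne: "\<exists>r \<in> dom0 R. \<xi> r \<noteq> 0 \<or> \<eta> r \<noteq> 0" for \<xi> \<xi>' \<eta> \<eta>'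
  proof -
    have "Bform a b c R k u v \<xi> \<xi>' \<eta> \<eta>' = (LINT r:dom0 R|lborel. dens r (u r) (v r) (\<xi> r) (\<xi>' r) (\<eta> r) (\<eta>' r))"
      unfolding Bform_def dens_def unfolding n2 A_def B_def C_def by simp
    then show ?thesis using S.strict_stability[OF h] ne by auto
  qed
  have dens_eq: "energy_density a b c k f g r = edens r (f r) (g r) (deriv f r) (deriv g r)" for f g r
    unfolding energy_density_def edens_def ffun n2 by simp
  have "local_minimizer a b c R k u v"
    unfolding local_minimizer_def
  proof (intro allI impI conjI; elim conjE)
    fix R' :: real assume R': "0 < R'" "ereal R' \<le> R"
    have sub: "r \<in> dom0 R" if "r \<in> {0<..<R'}" for r
      using R' that by (auto simp: dom0_def intro: less_le_trans[of _ "ereal R'"])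
    have e0: "energy_density a b c k u v r = edens r (u r) (v r) (u1 r) (v1 r)" if "r \<in> {0<..<R'}" for r
      unfolding dens_eq using du[OF sub[OF that]] by simp
    show "set_integrable lborel {0<..<R'} (energy_density a b c k u v)"
      using S.energy_integrable[OF R'] by (rule set_integrable_cong[THEN iffD1, rotated -1]) (use e0 in auto)
    have E0: "energy a b c k R' u v = (LINT r:{0<..<R'}|lborel. edens r (u r) (v r) (u1 r) (v1 r))"
      unfolding energy_def by (intro set_lebesgue_integral_cong) (use e0 in auto)
    have E1: "energy a b c k R' (\<lambda>r. u r + \<xi> r) (\<lambda>r. v r + \<eta> r)
      = (LINT r:{0<..<R'}|lborel. edens r (u r + \<xi> r) (v r + \<eta> r) (u1 r + deriv \<xi> r) (v1 r + deriv \<eta> r))"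
      if T: "test_fun R' \<xi>" "test_fun R' \<eta>" for \<xi> \<eta>
      unfolding energy_def
    proof (intro set_lebesgue_integral_cong ballI allI impI)
      fix r assume r: "r \<in> {0<..<R'}"
      have "deriv (\<lambda>r. u r + \<xi> r) r = u1 r + deriv \<xi> r"
        by (rule DERIV_imp_deriv[OF DERIV_add[OF S.du[OF sub[OF r]] test_fun_DERIV(1)[OF T(1)]]])
      moreover have "deriv (\<lambda>r. v r + \<eta> r) r = v1 r + deriv \<eta> r"
        by (rule DERIV_imp_deriv[OF DERIV_add[OF S.dv[OF sub[OF r]] test_fun_DERIV(1)[OF T(2)]]])
      ultimately show "energy_density a b c k (\<lambda>r. u r + \<xi> r) (\<lambda>r. v r + \<eta> r) r
        = edens r (u r + \<xi> r) (v r + \<eta> r) (u1 r + deriv \<xi> r) (v1 r + deriv \<eta> r)"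
        unfolding dens_eq by simp
    qed simp
    show "\<exists>\<delta>>0. \<forall>\<xi> \<eta>. test_fun R' \<xi> \<and> test_fun R' \<eta> \<and> (SUP x. \<bar>\<xi> x\<bar>) + (SUP x. \<bar>\<eta> x\<bar>) < \<delta> \<longrightarrow>
        energy a b c k R' u v \<le> energy a b c k R' (\<lambda>r. u r + \<xi> r) (\<lambda>r. v r + \<eta> r)"
      using S.local_minimality[OF R'] unfolding E0 by (simp add: E1 cong: conj_cong)
  qed
  with sol uniq stable show ?thesis by blast
qed

end
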